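(* Assume $l=0$ (and $k\ge0$) and $\kappa>0$. Then the optimal consumption-investment strategy is the feedback strategy $$(c_t,\pi_t)=\Big(\max\{\kappa,k\}X_t,\ \frac{\mu}{\sigma^2(1-p)}X_t\Big),\quad t\ge0,$$ and the value function equals $$V(x)=V_k(x):=\frac{\max\{\kappa,k\}^p}{p(\kappa(1-p)+\max\{\kappa,k\}p)}x^p=\begin{cases}\frac{k^p}{p(\kappa(1-p)+kp)}x^p,& k>\kappa,\\[2pt] \frac1p\kappa^{p-1}x^p,& 0\le k\le\kappa.\end{cases}$$
   Context: Fix constants $r\ge 0$, $\mu>0$, $\sigma>0$, $\beta>0$, $0<p<1$, $k\ge0$, $l\ge0$. Let $W$ be a standard Brownian motion. For a progressively measurable pair $(c_t,\pi_t)$, the wealth $X$ solves $dX_t=(rX_t-c_t+\mu\pi_t)\,dt+\pi_t\sigma\,dW_t$, $X_0=x\ge0$. The pair is admissible if for all $t\ge0$: $\mathbb E\int_0^t (c_s+\pi_s^2)\,ds<\infty$, $X_t\ge0$ and $c_t\ge kX_t+l$. With $U(c)=c^p/p$, the value function is $V(x)=\sup\mathbb E\big[\int_0^\infty e^{-\beta t}U(c_t)\,dt\mid X_0=x\big]$, the supremum over admissible pairs; a strategy is optimal if it is admissible and attains this supremum. Set $\kappa=\frac{\beta-p\left(\frac{\mu^2}{2\sigma^2(1-p)}+r\right)}{1-p}$. *)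

theory Defs
  imports "HOL-Probability.Probability"
begin

definition filtration_on :: "'w measure \<Rightarrow> (real \<Rightarrow> 'w measure) \<Rightarrow> bool" where
  "filtration_on M F \<longleftrightarrow>
     (\<forall>t. space (F t) = space M \<and> sets (F t) \<subseteq> sets M) \<and>
     (\<forall>s t. s \<le> t \<longrightarrow> sets (F s) \<subseteq> sets (F t))"

definition brownian_motion :: "'w measure \<Rightarrow> (real \<Rightarrow> 'w measure) \<Rightarrow> (real \<Rightarrow> 'w \<Rightarrow> real) \<Rightarrow> bool" where
  "brownian_motion M F W \<longleftrightarrow>
     prob_space M \<and> filtration_on M F \<and>
     (\<forall>t\<ge>0. W t \<in> borel_measurable (F t)) \<and>
     (\<forall>\<omega>\<in>space M. W 0 \<omega> = 0 \<and> continuous_on {0..} (\<lambda>t. W t \<omega>)) \<and>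
     (\<forall>s t. 0 \<le> s \<and> s < t \<longrightarrow>
        distributed M lborel (\<lambda>\<omega>. W t \<omega> - W s \<omega>) (\<lambda>y. ennreal (normal_density 0 (sqrt (t - s)) y))) \<and>
     (\<forall>s t. 0 \<le> s \<and> s < t \<longrightarrow>
        (\<forall>A\<in>sets (F s). \<forall>B\<in>sets borel.
           measure M (A \<inter> {\<omega>\<in>space M. W t \<omega> - W s \<omega> \<in> B}) =
           measure M A * measure M {\<omega>\<in>space M. W t \<omega> - W s \<omega> \<in> B}))"

definition progressive :: "'w measure \<Rightarrow> (real \<Rightarrow> 'w measure) \<Rightarrow> (real \<Rightarrow> 'w \<Rightarrow> real) \<Rightarrow> bool" where
  "progressive M F f \<longleftrightarrow>
     (\<forall>t\<ge>0. (\<lambda>(s, \<omega>). f s \<omega>) \<in> borel_measurable (restrict_space borel {0..t} \<Otimes>\<^sub>M F t))"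

definition simple_adapted :: "'w measure \<Rightarrow> (real \<Rightarrow> 'w measure) \<Rightarrow> nat \<Rightarrow> (nat \<Rightarrow> real) \<Rightarrow> (nat \<Rightarrow> 'w \<Rightarrow> real) \<Rightarrow> bool" where
  "simple_adapted M F n ts \<xi> \<longleftrightarrow> ts 0 = 0 \<and> (\<forall>i<n. ts i < ts (Suc i)) \<and>
     (\<forall>i<n. \<xi> i \<in> borel_measurable (F (ts i)) \<and> (\<exists>B. \<forall>\<omega>\<in>space M. \<bar>\<xi> i \<omega>\<bar> \<le> B))"

definition simple_val :: "nat \<Rightarrow> (nat \<Rightarrow> real) \<Rightarrow> (nat \<Rightarrow> 'w \<Rightarrow> real) \<Rightarrow> real \<Rightarrow> 'w \<Rightarrow> real" where
  "simple_val n ts \<xi> s \<omega> = (\<Sum>i<n. if ts i \<le> s \<and> s < ts (Suc i) then \<xi> i \<omega> else 0)"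

definition simple_stoch_int :: "(real \<Rightarrow> 'w \<Rightarrow> real) \<Rightarrow> nat \<Rightarrow> (nat \<Rightarrow> real) \<Rightarrow> (nat \<Rightarrow> 'w \<Rightarrow> real) \<Rightarrow> real \<Rightarrow> 'w \<Rightarrow> real" where
  "simple_stoch_int W n ts \<xi> t \<omega> =
     (\<Sum>i<n. \<xi> i \<omega> * (W (min t (ts (Suc i))) \<omega> - W (min t (ts i)) \<omega>))"

definition ito_integral :: "'w measure \<Rightarrow> (real \<Rightarrow> 'w measure) \<Rightarrow> (real \<Rightarrow> 'w \<Rightarrow> real) \<Rightarrow> (real \<Rightarrow> 'w \<Rightarrow> real) \<Rightarrow> (real \<Rightarrow> 'w \<Rightarrow> real) \<Rightarrow> bool" where
  "ito_integral M F W \<pi> I \<longleftrightarrow>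
     (\<forall>t\<ge>0. I t \<in> borel_measurable M \<and>
        (\<exists>N TS \<Xi>. (\<forall>j. simple_adapted M F (N j) (TS j) (\<Xi> j)) \<and>
           ((\<lambda>j. \<integral>\<^sup>+\<omega>. (\<integral>\<^sup>+s\<in>{0..t}. ennreal ((simple_val (N j) (TS j) (\<Xi> j) s \<omega> - \<pi> s \<omega>)\<^sup>2) \<partial>lborel) \<partial>M)
              \<longlonglongrightarrow> 0) \<and>
           ((\<lambda>j. \<integral>\<^sup>+\<omega>. ennreal ((I t \<omega> - simple_stoch_int W (N j) (TS j) (\<Xi> j) t \<omega>)\<^sup>2) \<partial>M)
              \<longlonglongrightarrow> 0)))"

definition wealth_eq :: "'w measure \<Rightarrow> real \<Rightarrow> real \<Rightarrow> real \<Rightarrow> real \<Rightarrow> (real \<Rightarrow> 'w \<Rightarrow> real) \<Rightarrow> (real \<Rightarrow> 'w \<Rightarrow> real) \<Rightarrow> (real \<Rightarrow> 'w \<Rightarrow> real) \<Rightarrow> (real \<Rightarrow> 'w \<Rightarrow> real) \<Rightarrow> bool" where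
  "wealth_eq M r \<mu> \<sigma> x c \<pi> X I \<longleftrightarrow>
     (\<forall>t\<ge>0. AE \<omega> in M.
        set_integrable lborel {0..t} (\<lambda>s. r * X s \<omega> - c s \<omega> + \<mu> * \<pi> s \<omega>) \<and>
        X t \<omega> = x + (LINT s:{0..t}|lborel. r * X s \<omega> - c s \<omega> + \<mu> * \<pi> s \<omega>) + \<sigma> * I t \<omega>)"

definition admissible :: "'w measure \<Rightarrow> (real \<Rightarrow> 'w measure) \<Rightarrow> (real \<Rightarrow> 'w \<Rightarrow> real) \<Rightarrow> real \<Rightarrow> real \<Rightarrow> real \<Rightarrow> real \<Rightarrow> real \<Rightarrow> real \<Rightarrow> (real \<Rightarrow> 'w \<Rightarrow> real) \<Rightarrow> (real \<Rightarrow> 'w \<Rightarrow> real) \<Rightarrow> bool" where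
  "admissible M F W r \<mu> \<sigma> k l x c \<pi> \<longleftrightarrow>
     progressive M F c \<and> progressive M F \<pi> \<and>
     (\<exists>X I. progressive M F X \<and> ito_integral M F W \<pi> I \<and> wealth_eq M r \<mu> \<sigma> x c \<pi> X I \<and>
        (\<forall>t\<ge>0. (\<integral>\<^sup>+\<omega>. (\<integral>\<^sup>+s\<in>{0..t}. ennreal (c s \<omega> + (\<pi> s \<omega>)\<^sup>2) \<partial>lborel) \<partial>M) < \<infinity> \<and>
                (AE \<omega> in M. X t \<omega> \<ge> 0 \<and> c t \<omega> \<ge> k * X t \<omega> + l)))"

definition objective :: "'w measure \<Rightarrow> real \<Rightarrow> real \<Rightarrow> (real \<Rightarrow> 'w \<Rightarrow> real) \<Rightarrow> ennreal" where
  "objective M \<beta> p c =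
     (\<integral>\<^sup>+\<omega>. (\<integral>\<^sup>+t\<in>{0..}. ennreal (exp (- \<beta> * t) * (c t \<omega> powr p / p)) \<partial>lborel) \<partial>M)"

definition value_fn :: "'w measure \<Rightarrow> (real \<Rightarrow> 'w measure) \<Rightarrow> (real \<Rightarrow> 'w \<Rightarrow> real) \<Rightarrow> real \<Rightarrow> real \<Rightarrow> real \<Rightarrow> real \<Rightarrow> real \<Rightarrow> real \<Rightarrow> real \<Rightarrow> real \<Rightarrow> ennreal" where
  "value_fn M F W r \<mu> \<sigma> \<beta> p k l x =
     (SUP cp\<in>{(c, \<pi>). admissible M F W r \<mu> \<sigma> k l x c \<pi>}. objective M \<beta> p (fst cp))"

definition kappa :: "real \<Rightarrow> real \<Rightarrow> real \<Rightarrow> real \<Rightarrow> real \<Rightarrow> real" where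
  "kappa r \<mu> \<sigma> \<beta> p = (\<beta> - p * (\<mu>\<^sup>2 / (2 * \<sigma>\<^sup>2 * (1 - p)) + r)) / (1 - p)"

definition closed_loop :: "'w measure \<Rightarrow> (real \<Rightarrow> 'w measure) \<Rightarrow> (real \<Rightarrow> 'w \<Rightarrow> real) \<Rightarrow> real \<Rightarrow> real \<Rightarrow> real \<Rightarrow> real \<Rightarrow> real \<Rightarrow> real \<Rightarrow> (real \<Rightarrow> 'w \<Rightarrow> real) \<Rightarrow> bool" where
  "closed_loop M F W r \<mu> \<sigma> x K m X \<longleftrightarrow>
     progressive M F X \<and>
     (\<exists>I. ito_integral M F W (\<lambda>t \<omega>. m * X t \<omega>) I \<and>
          wealth_eq M r \<mu> \<sigma> x (\<lambda>t \<omega>. K * X t \<omega>) (\<lambda>t \<omega>. m * X t \<omega>) X I)"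

end

theory Submission
  imports Defs
begin

text \<open>
  The upper bound is a duality argument. Put \<open>\<delta> = (1 - p) (K - \<kappa>)\<close> and
  \<open>Z\<^sub>t = exp (- (r - \<delta>) t - \<theta> W\<^sub>t - \<theta>\<^sup>2 t / 2)\<close> with \<open>\<theta> = \<mu> / \<sigma>\<close>. Since the tilt by \<open>\<theta>\<close> removes the
  drift \<open>\<mu> \<pi>\<close> of the wealth, every admissible pair satisfies \<open>E \<integral> Z (c - \<delta> X) dt \<le> x\<close>, and the
  constraint \<open>c \<ge> k X\<close> gives \<open>c - \<delta> X \<ge> (D / K) c\<close> with \<open>D = \<kappa> (1 - p) + K p\<close>. Fenchel's inequality for
  \<open>c powr p / p\<close> against \<open>y Z (D / K) c\<close>, with the best \<open>y\<close>, yields exactly the claimed value. No Ito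
  formula is needed: the budget inequality comes from a linear integral equation for the function
  \<open>t \<mapsto> E[exp (- \<theta> W\<^sub>t - \<theta>\<^sup>2 t / 2) X\<^sub>t]\<close>, whose finiteness follows from a pathwise Gronwall argument.

  The bound is attained by geometric Brownian motion, which solves the closed-loop equation (the errors of
  the Riemann sums are orthogonal up to a term that is small in mean square) and is its only solution up
  to modification, by the Ito isometry and Gronwall's inequality.
\<close>

section \<open>Brownian increments\<close>

text \<open>The value of \<delta> is forced. Along the optimal wealth the budget charges at rate
  \<open>K - \<delta>\<close>, while the mean of the conjugate utility of the state price decays at
  rate \<open>\<kappa> + p * \<delta> / (1 - p)\<close>; the two rates agree exactly for this
  \<delta>, and their common value is D. It is a multiplier for the consumption constraint: it
  vanishes unless \<open>k > \<kappa>\<close>, and in that case \<open>K = k\<close>. The best y is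
  the derivative of the claimed value function at x; at \<open>x = 0\<close> there is none, and y
  tends to infinity instead. Two features of the definitions shape the proof.
  \<open>ito_integral\<close> is a mean-square limit taken separately for every t, so no path
  regularity or joint measurability in time is at hand; computations are made at fixed times and
  under an expectation. And admissibility bounds no moment of the wealth, so a finiteness statement
  has to precede every cancellation. Since \<open>closed_loop\<close> does not ask for nonnegative
  wealth, admissibility of the feedback pair rests on uniqueness.\<close>

lemma normal_density_exp_tilt:
  assumes "s > 0"
  shows "normal_density 0 s y * exp (b * y) = exp (b\<^sup>2 * s\<^sup>2 / 2) * normal_density (b * s\<^sup>2) s y"
proof -
  have "- y\<^sup>2 / (2 * s\<^sup>2) + b * y = b\<^sup>2 * s\<^sup>2 / 2 + - (y - b * s\<^sup>2)\<^sup>2 / (2 * s\<^sup>2)"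
    using assms by (simp add: field_simps power2_eq_square)
  then show ?thesis
    unfolding normal_density_def by (simp add: exp_add[symmetric])
qed

locale brownian = prob_space M for M :: "'w measure" +
  fixes F :: "real \<Rightarrow> 'w measure" and W :: "real \<Rightarrow> 'w \<Rightarrow> real"
  assumes bm: "brownian_motion M F W"
begin

lemma space_F [simp]: "space (F t) = space M"
  using bm by (auto simp: brownian_motion_def filtration_on_def)

lemma sets_F_subset: "sets (F t) \<subseteq> sets M"
  using bm by (auto simp: brownian_motion_def filtration_on_def)

lemma sets_F_mono: "s \<le> t \<Longrightarrow> sets (F s) \<subseteq> sets (F t)"
  using bm by (auto simp: brownian_motion_def filtration_on_def)

lemma measurable_F_mono: "f \<in> measurable (F s) N \<Longrightarrow> s \<le> t \<Longrightarrow> f \<in> measurable (F t) N"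
  using sets_F_mono[of s t] by (auto simp: measurable_def)

lemma measurable_F_M: "f \<in> measurable (F s) N \<Longrightarrow> f \<in> measurable M N"
  using sets_F_subset[of s] by (auto simp: measurable_def)

lemma W_F: "0 \<le> s \<Longrightarrow> s \<le> t \<Longrightarrow> W s \<in> borel_measurable (F t)"
  using bm unfolding brownian_motion_def by (blast intro: measurable_F_mono)

lemma W_M: "0 \<le> s \<Longrightarrow> W s \<in> borel_measurable M"
  using measurable_F_M[OF W_F[of s s]] by simp

lemma W_0: "\<omega> \<in> space M \<Longrightarrow> W 0 \<omega> = 0"
  using bm unfolding brownian_motion_def by blast

lemma W_continuous: "\<omega> \<in> space M \<Longrightarrow> continuous_on {0..} (\<lambda>t. W t \<omega>)"
  using bm unfolding brownian_motion_def by blast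

lemma W_normal:
  "0 \<le> s \<Longrightarrow> s < t \<Longrightarrow> distributed M lborel (\<lambda>\<omega>. W t \<omega> - W s \<omega>) (\<lambda>y. ennreal (normal_density 0 (sqrt (t - s)) y))"
  using bm unfolding brownian_motion_def by blast

text \<open>The product rule in \<open>brownian_motion\<close> speaks of single events. Pre-images
  under \<open>f\<close> and under \<open>g\<close> of the increment form intersection-stable
  families that generate the two sigma-algebras, so the rule lifts to them.\<close>

lemma indep_increment:
  assumes st: "0 \<le> s" "s < t" and f: "f \<in> measurable (F s) N" and g [measurable]: "g \<in> measurable borel N'"
  shows "indep_var N f N' (\<lambda>\<omega>. g (W t \<omega> - W s \<omega>))"
proof -
  have [measurable]: "W s \<in> borel_measurable M" "W t \<in> borel_measurable M"
    using st by (auto intro: W_M)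
  have fM: "f \<in> measurable M N" by (rule measurable_F_M[OF f])
  have gM: "(\<lambda>\<omega>. g (W t \<omega> - W s \<omega>)) \<in> measurable M N'" by measurable
  have Int_stable: "Int_stable {X -` A \<inter> space M |A. A \<in> sets S}" for X :: "'w \<Rightarrow> 'b" and S
  proof (safe intro!: Int_stableI)
    fix A B assume "A \<in> sets S" "B \<in> sets S"
    then show "\<exists>C. X -` A \<inter> space M \<inter> (X -` B \<inter> space M) = X -` C \<inter> space M \<and> C \<in> sets S"
      by (intro exI[of _ "A \<inter> B"]) auto
  qed
  show ?thesis
    unfolding indep_var_eq
  proof (intro conjI indep_set_sigma_sets Int_stable fM gM)
    show "indep_set {f -` A \<inter> space M |A. A \<in> sets N}
                    {(\<lambda>\<omega>. g (W t \<omega> - W s \<omega>)) -` A \<inter> space M |A. A \<in> sets N'}"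
    proof (rule indep_setI)
      show "{f -` A \<inter> space M |A. A \<in> sets N} \<subseteq> events"
        using measurable_sets[OF fM] by auto
      show "{(\<lambda>\<omega>. g (W t \<omega> - W s \<omega>)) -` A \<inter> space M |A. A \<in> sets N'} \<subseteq> events"
        using measurable_sets[OF gM] by auto
      fix a b assume "a \<in> {f -` A \<inter> space M |A. A \<in> sets N}"
        "b \<in> {(\<lambda>\<omega>. g (W t \<omega> - W s \<omega>)) -` A \<inter> space M |A. A \<in> sets N'}"
      then obtain A B where A: "a = f -` A \<inter> space M" "A \<in> sets N"
        and B: "b = (\<lambda>\<omega>. g (W t \<omega> - W s \<omega>)) -` B \<inter> space M" "B \<in> sets N'" by auto
      have a: "a \<in> sets (F s)" using A measurable_sets[OF f A(2)] by simp
      have b: "b = {\<omega>\<in>space M. W t \<omega> - W s \<omega> \<in> g -` B}" using B by auto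
      have g': "g -` B \<in> sets borel" using measurable_sets[OF g B(2)] by simp
      have "\<forall>A\<in>sets (F s). \<forall>B\<in>sets borel.
           measure M (A \<inter> {\<omega>\<in>space M. W t \<omega> - W s \<omega> \<in> B}) =
           measure M A * measure M {\<omega>\<in>space M. W t \<omega> - W s \<omega> \<in> B}"
        using bm st unfolding brownian_motion_def by blast
      then show "prob (a \<inter> b) = prob a * prob b" using a g' unfolding b by blast
    qed
  qed
qed

text \<open>Independence makes the joint law a product, and Tonelli factorises the integral without
  any integrability. The case \<open>s = t\<close> is split off because the law of the increment is
  available for \<open>s < t\<close> only; there the second factor is a constant.\<close>

lemma nn_integral_increment:
  fixes f :: "'w \<Rightarrow> ennreal" and g :: "real \<Rightarrow> ennreal"
  assumes st: "0 \<le> s" "s \<le> t" and f: "f \<in> borel_measurable (F s)" and g [measurable]: "g \<in> borel_measurable borel"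
  shows "(\<integral>\<^sup>+\<omega>. f \<omega> * g (W t \<omega> - W s \<omega>) \<partial>M) = (\<integral>\<^sup>+\<omega>. f \<omega> \<partial>M) * (\<integral>\<^sup>+\<omega>. g (W t \<omega> - W s \<omega>) \<partial>M)"
proof (cases "s = t")
  case True
  then show ?thesis
    using f by (simp add: nn_integral_multc measurable_F_M emeasure_space_1)
next
  case False
  then have lt: "s < t" using st by simp
  let ?D = "\<lambda>\<omega>. g (W t \<omega> - W s \<omega>)"
  have ind: "indep_var borel f borel ?D" by (rule indep_increment[OF st(1) lt f g])
  have [measurable]: "f \<in> borel_measurable M" "?D \<in> borel_measurable M"
    and eq: "distr M borel f \<Otimes>\<^sub>M distr M borel ?D = distr M (borel \<Otimes>\<^sub>M borel) (\<lambda>x. (f x, ?D x))"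
    using ind unfolding indep_var_distribution_eq by auto
  interpret X: prob_space "distr M borel f" by (rule prob_space_distr) simp
  interpret Y: prob_space "distr M borel ?D" by (rule prob_space_distr) simp
  interpret XY: pair_prob_space "distr M borel f" "distr M borel ?D" ..
  have "(\<integral>\<^sup>+\<omega>. f \<omega> * ?D \<omega> \<partial>M) = (\<integral>\<^sup>+z. fst z * snd z \<partial>distr M (borel \<Otimes>\<^sub>M borel) (\<lambda>x. (f x, ?D x)))"
    by (subst nn_integral_distr) auto
  also have "\<dots> = (\<integral>\<^sup>+x. \<integral>\<^sup>+y. x * y \<partial>distr M borel ?D \<partial>distr M borel f)"
    unfolding eq[symmetric] by (subst Y.nn_integral_fst[symmetric]) auto
  also have "\<dots> = (\<integral>\<^sup>+\<omega>. f \<omega> \<partial>M) * (\<integral>\<^sup>+\<omega>. ?D \<omega> \<partial>M)"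
    by (simp add: nn_integral_cmult nn_integral_multc nn_integral_distr)
  finally show ?thesis .
qed

lemma
  fixes f :: "'w \<Rightarrow> real" and g :: "real \<Rightarrow> real"
  assumes st: "0 \<le> s" "s \<le> t" and f: "f \<in> borel_measurable (F s)" "integrable M f"
    and g [measurable]: "g \<in> borel_measurable borel" and ig: "integrable M (\<lambda>\<omega>. g (W t \<omega> - W s \<omega>))"
  shows integrable_increment: "integrable M (\<lambda>\<omega>. f \<omega> * g (W t \<omega> - W s \<omega>))"
    and integral_increment: "(\<integral>\<omega>. f \<omega> * g (W t \<omega> - W s \<omega>) \<partial>M) = (\<integral>\<omega>. f \<omega> \<partial>M) * (\<integral>\<omega>. g (W t \<omega> - W s \<omega>) \<partial>M)"
proof -
  have "integrable M (\<lambda>\<omega>. f \<omega> * g (W t \<omega> - W s \<omega>)) \<and>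
     (\<integral>\<omega>. f \<omega> * g (W t \<omega> - W s \<omega>) \<partial>M) = (\<integral>\<omega>. f \<omega> \<partial>M) * (\<integral>\<omega>. g (W t \<omega> - W s \<omega>) \<partial>M)"
  proof (cases "s = t")
    case True
    then show ?thesis using f by (simp add: prob_space)
  next
    case False
    then have "s < t" using st by simp
    have "indep_var borel f borel (\<lambda>\<omega>. g (W t \<omega> - W s \<omega>))"
      by (rule indep_increment[OF st(1) \<open>s < t\<close> f(1) g])
    from indep_var_lebesgue_integral[OF this f(2) ig] indep_var_integrable[OF this f(2) ig]
    show ?thesis by simp
  qed
  then show "integrable M (\<lambda>\<omega>. f \<omega> * g (W t \<omega> - W s \<omega>))"
    "(\<integral>\<omega>. f \<omega> * g (W t \<omega> - W s \<omega>) \<partial>M) = (\<integral>\<omega>. f \<omega> \<partial>M) * (\<integral>\<omega>. g (W t \<omega> - W s \<omega>) \<partial>M)" by auto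
qed

lemma has_integral_increment_density:
  fixes g :: "real \<Rightarrow> real"
  assumes st: "0 \<le> s" "s < t" and [measurable]: "g \<in> borel_measurable borel"
    and "has_bochner_integral lborel (\<lambda>y. normal_density 0 (sqrt (t - s)) y * g y) v"
  shows "has_bochner_integral M (\<lambda>\<omega>. g (W t \<omega> - W s \<omega>)) v"
proof -
  have "integrable M (\<lambda>\<omega>. g (W t \<omega> - W s \<omega>))"
    using assms(4) by (intro distributed_integrable[OF W_normal[OF st], THEN iffD1]) (auto simp: has_bochner_integral_iff)
  moreover have "(\<integral>\<omega>. g (W t \<omega> - W s \<omega>) \<partial>M) = v"
    using assms(4) by (subst distributed_integral[OF W_normal[OF st], symmetric]) (auto simp: has_bochner_integral_iff)
  ultimately show ?thesis by (simp add: has_bochner_integral_iff)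
qed

text \<open>Completing the square turns the exponential weight into a shift of the mean; what
  remains is the total mass of a normal density.\<close>

lemma has_integral_exp_increment:
  assumes st: "0 \<le> s" "s \<le> t"
  shows "has_bochner_integral M (\<lambda>\<omega>. exp (b * (W t \<omega> - W s \<omega>))) (exp (b\<^sup>2 * (t - s) / 2))"
proof (cases "s = t")
  case True
  then show ?thesis by (simp add: has_bochner_integral_iff prob_space)
next
  case False
  then have lt: "s < t" using st by simp
  have "has_bochner_integral lborel (\<lambda>y. exp (b\<^sup>2 * (t - s) / 2) * normal_density (b * (t - s)) (sqrt (t - s)) y)
     (exp (b\<^sup>2 * (t - s) / 2) * 1)"
    using lt by (intro has_bochner_integral_mult_right) (auto simp: has_bochner_integral_iff)
  moreover have "exp (b\<^sup>2 * (t - s) / 2) * normal_density (b * (t - s)) (sqrt (t - s)) y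
     = normal_density 0 (sqrt (t - s)) y * exp (b * y)" for y
    using normal_density_exp_tilt[of "sqrt (t - s)" y b] lt by simp
  ultimately have "has_bochner_integral lborel (\<lambda>y. normal_density 0 (sqrt (t - s)) y * exp (b * y)) (exp (b\<^sup>2 * (t - s) / 2))"
    by simp
  then show ?thesis
    by (intro has_integral_increment_density[OF st(1) lt]) auto
qed

text \<open>After the same shift the first moment is the new mean \<open>b * (t - s)\<close>. This
  is the source of the drift that an exponential change of measure gives to the Brownian
  motion.\<close>

lemma has_integral_increment_exp_increment:
  assumes st: "0 \<le> s" "s \<le> t"
  shows "has_bochner_integral M (\<lambda>\<omega>. (W t \<omega> - W s \<omega>) * exp (b * (W t \<omega> - W s \<omega>))) (b * (t - s) * exp (b\<^sup>2 * (t - s) / 2))"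
proof (cases "s = t")
  case True
  then show ?thesis by (simp add: has_bochner_integral_zero)
next
  case False
  then have lt: "s < t" using st by simp
  have "has_bochner_integral lborel (\<lambda>y. exp (b\<^sup>2 * (t - s) / 2) * (normal_density (b * (t - s)) (sqrt (t - s)) y * y))
     (exp (b\<^sup>2 * (t - s) / 2) * (b * (t - s)))"
    using lt by (intro has_bochner_integral_mult_right normal_moment_nz_1) auto
  moreover have "exp (b\<^sup>2 * (t - s) / 2) * (normal_density (b * (t - s)) (sqrt (t - s)) y * y)
     = normal_density 0 (sqrt (t - s)) y * (y * exp (b * y))" for y
    using normal_density_exp_tilt[of "sqrt (t - s)" y b] lt by (simp add: mult_ac)
  ultimately have "has_bochner_integral lborel (\<lambda>y. normal_density 0 (sqrt (t - s)) y * (y * exp (b * y)))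
     (b * (t - s) * exp (b\<^sup>2 * (t - s) / 2))"
    by (simp only: mult.commute)
  then show ?thesis
    by (intro has_integral_increment_density[OF st(1) lt]) auto
qed

lemma has_integral_increment:
  assumes st: "0 \<le> s" "s \<le> t"
  shows "has_bochner_integral M (\<lambda>\<omega>. W t \<omega> - W s \<omega>) 0"
  using has_integral_increment_exp_increment[OF st, of 0] by simp

lemma has_integral_increment_sq:
  assumes st: "0 \<le> s" "s \<le> t"
  shows "has_bochner_integral M (\<lambda>\<omega>. (W t \<omega> - W s \<omega>)\<^sup>2) (t - s)"
proof (cases "s = t")
  case True
  then show ?thesis by (simp add: has_bochner_integral_zero)
next
  case False
  then have lt: "s < t" using st by simp
  have "has_bochner_integral lborel (\<lambda>y. normal_density 0 (sqrt (t - s)) y * y\<^sup>2) (t - s)"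
    using normal_moment_even[of "sqrt (t - s)" 0 1] lt by (simp add: fact_numeral diff_divide_distrib)
  then show ?thesis
    by (intro has_integral_increment_density[OF st(1) lt]) simp_all
qed

end

section \<open>Progressive processes and exponential martingales\<close>

context brownian
begin

lemma progressive_section:
  assumes "progressive M F f" "0 \<le> t"
  shows "f t \<in> borel_measurable (F t)"
proof -
  have [measurable]: "(\<lambda>(s, \<omega>). f s \<omega>) \<in> borel_measurable (restrict_space borel {0..t} \<Otimes>\<^sub>M F t)"
    using assms by (auto simp: progressive_def)
  have "(\<lambda>\<omega>. (t, \<omega>)) \<in> measurable (F t) (restrict_space borel {0..t} \<Otimes>\<^sub>M F t)"
    using assms by (intro measurable_Pair) (auto simp: space_restrict_space)
  from measurable_compose[OF this, of "\<lambda>(s, \<omega>). f s \<omega>" borel] show ?thesis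
    by simp
qed

lemma progressive_section_M: "progressive M F f \<Longrightarrow> 0 \<le> t \<Longrightarrow> f t \<in> borel_measurable M"
  by (rule measurable_F_M[OF progressive_section])

text \<open>\<open>progressive\<close> works with pairs of time and outcome on \<open>{0..T}\<close>
  and \<open>F T\<close>. Fubini is applied on the product of \<open>M\<close> with Lebesgue measure
  on the whole line, hence the swapped pair and the extension by zero.\<close>

lemma progressive_joint:
  assumes "progressive M F f" "0 \<le> T"
  shows "(\<lambda>z. if snd z \<in> {0..T} then f (snd z) (fst z) else 0) \<in> borel_measurable (M \<Otimes>\<^sub>M lborel)"
proof -
  have f: "(\<lambda>(s, \<omega>). f s \<omega>) \<in> borel_measurable (restrict_space borel {0..T} \<Otimes>\<^sub>M F T)"
    using assms by (auto simp: progressive_def)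
  let ?R = "restrict_space (M \<Otimes>\<^sub>M lborel) {z. snd z \<in> {0..T}}"
  have id: "(\<lambda>\<omega>. \<omega>) \<in> measurable M (F T)"
    by (rule measurable_F_M[of _ T]) simp
  have 1: "(\<lambda>z. fst z) \<in> measurable ?R (F T)"
    by (rule measurable_compose[OF _ id]) (rule measurable_restrict_space1, measurable)
  have 2: "(\<lambda>z. snd z) \<in> measurable ?R (restrict_space borel {0..T})"
    by (rule measurable_restrict_space2) (auto simp: space_restrict_space intro: measurable_restrict_space1)
  have "(\<lambda>z. f (snd z) (fst z)) \<in> borel_measurable ?R"
    using measurable_compose[OF measurable_Pair[OF 2 1] f] by simp
  moreover have "{z \<in> space (M \<Otimes>\<^sub>M lborel). snd z \<in> {0..T}} \<in> sets (M \<Otimes>\<^sub>M lborel)" by measurable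
  ultimately show ?thesis
    by (subst measurable_If_restrict_space_iff) simp_all
qed

lemma progressive_joint':
  assumes "progressive M F f"
  shows "(\<lambda>z. if snd z \<in> {0..} then f (snd z) (fst z) else 0) \<in> borel_measurable (M \<Otimes>\<^sub>M lborel)"
proof (rule borel_measurable_LIMSEQ_real)
  fix z :: "'w \<times> real"
  obtain N :: nat where N: "snd z \<le> real N" using real_arch_simple by blast
  show "(\<lambda>n. if snd z \<in> {0..real n} then f (snd z) (fst z) else 0) \<longlonglongrightarrow>
         (if snd z \<in> {0..} then f (snd z) (fst z) else 0)"
    using N by (intro tendsto_eventually eventually_sequentiallyI[of N]) auto
qed (rule progressive_joint[OF assms], simp)

lemma progressive_const_mult: "progressive M F f \<Longrightarrow> progressive M F (\<lambda>t \<omega>. c * f t \<omega>)"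
  unfolding progressive_def by (auto simp: case_prod_beta')

text \<open>The process is the pointwise limit of its samples on grids of mesh
  \<open>1 / Suc n\<close>. Each sample is measurable because the sampling time takes countably many
  values.\<close>

lemma progressive_continuous:
  assumes ad: "\<And>t. 0 \<le> t \<Longrightarrow> f t \<in> borel_measurable (F t)"
    and cont: "\<And>\<omega>. \<omega> \<in> space M \<Longrightarrow> continuous_on {0..} (\<lambda>t. f t \<omega>)"
  shows "progressive M F f"
  unfolding progressive_def
proof (intro allI impI)
  fix t :: real assume t: "0 \<le> t"
  let ?N = "restrict_space borel {0..t} \<Otimes>\<^sub>M F t"
  \<comment> \<open>Clamping to \<open>{0..t}\<close> makes every sampled value
    \<open>F t\<close>-measurable, whatever the integer index is.\<close>
  define d where "d n i = max 0 (min t (real_of_int i / real (Suc n)))" for n :: nat and i :: int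
  show "(\<lambda>(s, \<omega>). f s \<omega>) \<in> borel_measurable ?N"
  proof (rule borel_measurable_LIMSEQ_real)
    fix n
    show "(\<lambda>z. f (d n \<lfloor>real (Suc n) * fst z\<rfloor>) (snd z)) \<in> borel_measurable ?N"
    proof (rule measurable_compose_countable[where g="\<lambda>z. \<lfloor>real (Suc n) * fst z\<rfloor>"])
      fix i :: int
      have "f (d n i) \<in> borel_measurable (F t)"
        using t by (intro measurable_F_mono[OF ad]) (auto simp: d_def)
      then show "(\<lambda>z. f (d n i) (snd z)) \<in> borel_measurable ?N" by measurable
    next
      have [measurable]: "fst \<in> borel_measurable ?N"
        by (rule measurable_compose[OF measurable_fst]) (auto intro: measurable_restrict_space1)
      show "(\<lambda>z. \<lfloor>real (Suc n) * fst z\<rfloor>) \<in> measurable ?N (count_space UNIV)" by measurable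
    qed
  next
    fix z assume "z \<in> space ?N"
    then obtain s \<omega> where z: "z = (s, \<omega>)" "0 \<le> s" "s \<le> t" "\<omega> \<in> space M"
      by (cases z) (auto simp: space_pair_measure space_restrict_space)
    have "(\<lambda>n. real_of_int \<lfloor>real (Suc n) * s\<rfloor> / real (Suc n)) \<longlonglongrightarrow> s"
    proof (rule tendsto_sandwich)
      show "\<forall>\<^sub>F n in sequentially. s - 1 / real (Suc n) \<le> real_of_int \<lfloor>real (Suc n) * s\<rfloor> / real (Suc n)"
      proof (rule always_eventually, rule allI)
        fix n
        have "real (Suc n) * s - 1 \<le> real_of_int \<lfloor>real (Suc n) * s\<rfloor>" by linarith
        then have "(real (Suc n) * s - 1) / real (Suc n) \<le> real_of_int \<lfloor>real (Suc n) * s\<rfloor> / real (Suc n)"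
          by (rule divide_right_mono) simp
        then show "s - 1 / real (Suc n) \<le> real_of_int \<lfloor>real (Suc n) * s\<rfloor> / real (Suc n)"
          by (simp add: diff_divide_distrib)
      qed
      show "\<forall>\<^sub>F n in sequentially. real_of_int \<lfloor>real (Suc n) * s\<rfloor> / real (Suc n) \<le> s"
      proof (rule always_eventually, rule allI)
        fix n
        have "real_of_int \<lfloor>real (Suc n) * s\<rfloor> / real (Suc n) \<le> (real (Suc n) * s) / real (Suc n)"
          by (rule divide_right_mono) auto
        then show "real_of_int \<lfloor>real (Suc n) * s\<rfloor> / real (Suc n) \<le> s" by simp
      qed
      have "(\<lambda>n. 1 / real (Suc n)) \<longlonglongrightarrow> 0" by (rule lim_1_over_n[THEN LIMSEQ_Suc])
      then show "(\<lambda>n. s - 1 / real (Suc n)) \<longlonglongrightarrow> s" using tendsto_diff[OF tendsto_const, of _ 0 sequentially s] by simp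
    qed simp
    then have "(\<lambda>n. d n \<lfloor>real (Suc n) * s\<rfloor>) \<longlonglongrightarrow> max 0 (min t s)"
      unfolding d_def by (intro tendsto_intros)
    then have lim: "(\<lambda>n. d n \<lfloor>real (Suc n) * s\<rfloor>) \<longlonglongrightarrow> s" using z by simp
    have "(\<lambda>n. f (d n \<lfloor>real (Suc n) * s\<rfloor>) \<omega>) \<longlonglongrightarrow> f s \<omega>"
      by (rule continuous_on_tendsto_compose[OF cont[OF z(4)] lim]) (use z in \<open>auto simp: d_def\<close>)
    then show "(\<lambda>n. f (d n \<lfloor>real (Suc n) * fst z\<rfloor>) (snd z)) \<longlonglongrightarrow> (case z of (s, \<omega>) \<Rightarrow> f s \<omega>)"
      using z by simp
  qed
qed

text \<open>The stochastic exponential of \<open>b * W\<close>: a martingale with mean one, and the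
  density of the measure under which \<open>W\<close> acquires drift \<open>b\<close>.\<close>

definition expm :: "real \<Rightarrow> real \<Rightarrow> 'w \<Rightarrow> real" where
  "expm b t \<omega> = exp (b * W t \<omega> - b\<^sup>2 * t / 2)"

lemma expm_pos [simp]: "0 < expm b t \<omega>" and expm_nonneg [simp]: "0 \<le> expm b t \<omega>"
  by (auto simp: expm_def)

lemma expm_F: "0 \<le> s \<Longrightarrow> s \<le> t \<Longrightarrow> expm b s \<in> borel_measurable (F t)"
  using W_F[of s t] unfolding expm_def by measurable

lemma expm_M: "0 \<le> s \<Longrightarrow> expm b s \<in> borel_measurable M"
  using W_M[of s] unfolding expm_def by measurable

lemma expm_0: "\<omega> \<in> space M \<Longrightarrow> expm b 0 \<omega> = 1"
  by (simp add: expm_def W_0)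

text \<open>The second factor depends on the increment alone and has mean one, which is the
  martingale property in multiplicative form.\<close>

lemma expm_split: "expm b t \<omega> = expm b s \<omega> * (exp (- (b\<^sup>2 * (t - s) / 2)) * exp (b * (W t \<omega> - W s \<omega>)))"
  unfolding expm_def exp_add[symmetric] by (simp add: algebra_simps diff_divide_distrib)

text \<open>Powers stay in the family up to a deterministic factor, so every moment computed later
  reduces to a mean equal to one.\<close>

lemma expm_powr: "expm b t \<omega> powr q = exp ((q\<^sup>2 - q) * b\<^sup>2 * t / 2) * expm (q * b) t \<omega>"
  unfolding expm_def exp_powr_real exp_add[symmetric]
  by (simp add: algebra_simps power2_eq_square diff_divide_distrib)

lemma expm_square: "(expm b t \<omega>)\<^sup>2 = exp (b\<^sup>2 * t) * expm (2 * b) t \<omega>"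
  using expm_powr[of b t \<omega> 2] by simp

lemma progressive_expm: "progressive M F (expm b)"
proof (rule progressive_continuous)
  fix \<omega> assume "\<omega> \<in> space M"
  then show "continuous_on {0..} (\<lambda>t. expm b t \<omega>)"
    unfolding expm_def by (intro continuous_intros W_continuous) auto
qed (auto intro: expm_F)

lemma nn_integral_expm:
  assumes st: "0 \<le> s" "s \<le> t" and f: "f \<in> borel_measurable (F s)"
  shows "(\<integral>\<^sup>+\<omega>. f \<omega> * ennreal (expm b t \<omega>) \<partial>M) = (\<integral>\<^sup>+\<omega>. f \<omega> * ennreal (expm b s \<omega>) \<partial>M)"
proof -
  let ?g = "\<lambda>y. ennreal (exp (- (b\<^sup>2 * (t - s) / 2)) * exp (b * y))"
  have [measurable]: "f \<in> borel_measurable (F s)" "expm b s \<in> borel_measurable (F s)"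
    using f expm_F[of s s] st by auto
  have "(\<integral>\<^sup>+\<omega>. ?g (W t \<omega> - W s \<omega>) \<partial>M) = ennreal (\<integral>\<omega>. exp (- (b\<^sup>2 * (t - s) / 2)) * exp (b * (W t \<omega> - W s \<omega>)) \<partial>M)"
    using has_integral_exp_increment[OF st, of b]
    by (intro nn_integral_eq_integral) (auto simp: has_bochner_integral_iff)
  also have "\<dots> = 1"
    using has_integral_exp_increment[OF st, of b]
    by (simp add: has_bochner_integral_iff exp_minus)
  finally have g: "(\<integral>\<^sup>+\<omega>. ?g (W t \<omega> - W s \<omega>) \<partial>M) = 1" .
  have "(\<integral>\<^sup>+\<omega>. f \<omega> * ennreal (expm b t \<omega>) \<partial>M) = (\<integral>\<^sup>+\<omega>. (f \<omega> * ennreal (expm b s \<omega>)) * ?g (W t \<omega> - W s \<omega>) \<partial>M)"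
    by (subst expm_split[of b t _ s]) (simp add: ennreal_mult mult.assoc)
  also have "\<dots> = (\<integral>\<^sup>+\<omega>. f \<omega> * ennreal (expm b s \<omega>) \<partial>M)"
    by (subst nn_integral_increment[OF st]) (auto simp: g)
  finally show ?thesis .
qed

lemma has_integral_expm:
  assumes st: "0 \<le> s" "s \<le> t" and f: "f \<in> borel_measurable (F s)" "integrable M (\<lambda>\<omega>. f \<omega> * expm b s \<omega>)"
  shows "has_bochner_integral M (\<lambda>\<omega>. f \<omega> * expm b t \<omega>) (\<integral>\<omega>. f \<omega> * expm b s \<omega> \<partial>M)"
proof -
  let ?g = "\<lambda>y. exp (- (b\<^sup>2 * (t - s) / 2)) * exp (b * y)"
  have [measurable]: "f \<in> borel_measurable (F s)" "expm b s \<in> borel_measurable (F s)"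
    using f expm_F[of s s] st by auto
  have g: "integrable M (\<lambda>\<omega>. ?g (W t \<omega> - W s \<omega>))" "(\<integral>\<omega>. ?g (W t \<omega> - W s \<omega>) \<partial>M) = 1"
    using has_integral_exp_increment[OF st, of b] by (auto simp: has_bochner_integral_iff exp_minus)
  have eq: "(\<lambda>\<omega>. f \<omega> * expm b t \<omega>) = (\<lambda>\<omega>. (f \<omega> * expm b s \<omega>) * ?g (W t \<omega> - W s \<omega>))"
    by (subst expm_split[of b t _ s]) (simp add: mult.assoc)
  show ?thesis
    unfolding has_bochner_integral_iff eq
    using integrable_increment[OF st _ f(2) _ g(1)] integral_increment[OF st _ f(2) _ g(1)] g(2)
    by simp
qed

lemma has_integral_expm_one: "0 \<le> t \<Longrightarrow> has_bochner_integral M (expm b t) 1"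
proof -
  assume t: "0 \<le> t"
  have "has_bochner_integral M (expm b 0) 1"
    using has_bochner_integral_cong[of M M "\<lambda>_. 1" "expm b 0" 1 1]
    by (simp add: expm_0 has_bochner_integral_iff prob_space)
  with has_integral_expm[of 0 t "\<lambda>_. 1" b] t show ?thesis
    by (simp add: has_bochner_integral_iff)
qed

lemma nn_integral_expm_one: "0 \<le> t \<Longrightarrow> (\<integral>\<^sup>+\<omega>. ennreal (expm b t \<omega>) \<partial>M) = 1"
  using has_integral_expm_one[of t b] by (subst nn_integral_eq_integral) (auto simp: has_bochner_integral_iff)

lemma nn_integral_expm_square: "0 \<le> t \<Longrightarrow> (\<integral>\<^sup>+\<omega>. ennreal ((expm b t \<omega>)\<^sup>2) \<partial>M) = ennreal (exp (b\<^sup>2 * t))"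
  using expm_M[of t "2 * b"] by (simp add: expm_square ennreal_mult nn_integral_cmult nn_integral_expm_one)

text \<open>Girsanov's theorem for one increment: weighted with \<open>expm b T\<close>, an
  increment of \<open>W\<close> over \<open>s\<close> to \<open>t\<close> may be replaced by its
  drift \<open>b * (t - s)\<close>. Multiplying by \<mu> and \<sigma> later, this is what cancels
  the drift of the wealth.\<close>

lemma has_integral_expm_increment:
  assumes st: "0 \<le> s" "s \<le> t" "t \<le> T" and f: "f \<in> borel_measurable (F s)" "integrable M (\<lambda>\<omega>. f \<omega> * expm b s \<omega>)"
  shows "has_bochner_integral M (\<lambda>\<omega>. f \<omega> * (W t \<omega> - W s \<omega>) * expm b T \<omega>) (b * (t - s) * (\<integral>\<omega>. f \<omega> * expm b T \<omega> \<partial>M))"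
proof -
  let ?g = "\<lambda>y. exp (- (b\<^sup>2 * (t - s) / 2)) * (y * exp (b * y))"
  have [measurable]: "f \<in> borel_measurable (F s)" "expm b s \<in> borel_measurable (F s)"
    using f expm_F[of s s] st by auto
  have g: "integrable M (\<lambda>\<omega>. ?g (W t \<omega> - W s \<omega>))" "(\<integral>\<omega>. ?g (W t \<omega> - W s \<omega>) \<partial>M) = b * (t - s)"
    using has_integral_increment_exp_increment[OF st(1,2), of b] by (auto simp: has_bochner_integral_iff exp_minus)
  have eq: "(\<lambda>\<omega>. f \<omega> * (W t \<omega> - W s \<omega>) * expm b t \<omega>) = (\<lambda>\<omega>. (f \<omega> * expm b s \<omega>) * ?g (W t \<omega> - W s \<omega>))"
    by (subst expm_split[of b t _ s]) (simp add: mult_ac)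
  have 1: "integrable M (\<lambda>\<omega>. f \<omega> * (W t \<omega> - W s \<omega>) * expm b t \<omega>)"
    "(\<integral>\<omega>. f \<omega> * (W t \<omega> - W s \<omega>) * expm b t \<omega> \<partial>M) = b * (t - s) * (\<integral>\<omega>. f \<omega> * expm b s \<omega> \<partial>M)"
    unfolding eq
    using integrable_increment[OF st(1,2) _ f(2) _ g(1)] integral_increment[OF st(1,2) _ f(2) _ g(1)] g(2)
    by simp_all
  have m: "(\<lambda>\<omega>. f \<omega> * (W t \<omega> - W s \<omega>)) \<in> borel_measurable (F t)"
  proof -
    have [measurable]: "f \<in> borel_measurable (F t)" "W s \<in> borel_measurable (F t)" "W t \<in> borel_measurable (F t)"
      using measurable_F_mono[OF f(1) st(2)] W_F[of s t] W_F[of t t] st by auto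
    show ?thesis by measurable
  qed
  \<comment> \<open>The martingale property moves the weight from time \<open>s\<close> to
    \<open>T\<close>, so that all increments are compared under one and the same weight.\<close>
  have 2: "(\<integral>\<omega>. f \<omega> * expm b s \<omega> \<partial>M) = (\<integral>\<omega>. f \<omega> * expm b T \<omega> \<partial>M)"
    using has_integral_expm[of s T f b] f st by (auto simp: has_bochner_integral_iff)
  show ?thesis
    using has_integral_expm[of t T "\<lambda>\<omega>. f \<omega> * (W t \<omega> - W s \<omega>)" b, OF _ _ m 1(1)] 1(2) st unfolding 2 by simp
qed

end

section \<open>Ito integrals\<close>

lemma integrable_mult_square_integrable:
  fixes f g :: "'a \<Rightarrow> real"
  assumes [measurable]: "f \<in> borel_measurable N" "g \<in> borel_measurable N"
    and "integrable N (\<lambda>x. (f x)\<^sup>2)" "integrable N (\<lambda>x. (g x)\<^sup>2)"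
  shows "integrable N (\<lambda>x. f x * g x)"
proof (rule Bochner_Integration.integrable_bound)
  show "integrable N (\<lambda>x. (f x)\<^sup>2 + (g x)\<^sup>2)" using assms by auto
  have "\<bar>a * b\<bar> \<le> a\<^sup>2 + b\<^sup>2" for a b :: real
  proof -
    have "2 * (\<bar>a\<bar> * \<bar>b\<bar>) \<le> a\<^sup>2 + b\<^sup>2" "0 \<le> \<bar>a\<bar> * \<bar>b\<bar>"
      using sum_squares_bound[of "\<bar>a\<bar>" "\<bar>b\<bar>"] by (simp_all add: mult.assoc)
    then show ?thesis unfolding abs_mult by linarith
  qed
  then show "AE x in N. norm (f x * g x) \<le> norm ((f x)\<^sup>2 + (g x)\<^sup>2)" by auto
qed measurable

lemma integrable_mult_bounded:
  fixes f g :: "'a \<Rightarrow> real"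
  assumes [measurable]: "f \<in> borel_measurable N" and g: "integrable N g"
    and B: "\<And>x. x \<in> space N \<Longrightarrow> \<bar>f x\<bar> \<le> B"
  shows "integrable N (\<lambda>x. f x * g x)"
proof (rule Bochner_Integration.integrable_bound)
  show "integrable N (\<lambda>x. B * g x)" using g by auto
  have [measurable]: "g \<in> borel_measurable N" using g by auto
  show "(\<lambda>x. f x * g x) \<in> borel_measurable N" by measurable
  show "AE x in N. norm (f x * g x) \<le> norm (B * g x)"
  proof (rule AE_I2)
    fix x assume "x \<in> space N"
    from B[OF this] have "\<bar>f x\<bar> \<le> \<bar>B\<bar>" by linarith
    then show "norm (f x * g x) \<le> norm (B * g x)" by (simp add: abs_mult mult_right_mono)
  qed
qed

text \<open>No square root is taken: once \<open>c * y n\<close> is below the square of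
  \<open>a\<close>, monotonicity of squaring forces \<open>x n < a\<close>.\<close>

lemma ennreal_tendsto_0_power2:
  fixes x :: "nat \<Rightarrow> ennreal"
  assumes le: "\<And>n. (x n)\<^sup>2 \<le> c * y n" and y: "y \<longlonglongrightarrow> 0" and c: "c < top"
  shows "x \<longlonglongrightarrow> 0"
proof (rule order_tendstoI)
  fix a :: ennreal assume a: "0 < a"
  have "(\<lambda>n. c * y n) \<longlonglongrightarrow> c * 0" using y c by (intro ennreal_tendsto_cmult)
  then have "(\<lambda>n. c * y n) \<longlonglongrightarrow> 0" by simp
  moreover have "0 < a\<^sup>2" using a by (simp add: power2_eq_square ennreal_zero_less_mult_iff)
  ultimately have "\<forall>\<^sub>F n in sequentially. c * y n < a\<^sup>2" by (rule order_tendstoD)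
  then show "\<forall>\<^sub>F n in sequentially. x n < a"
  proof eventually_elim
    case (elim n)
    then have "(x n)\<^sup>2 < a\<^sup>2" using le[of n] by simp
    then show "x n < a" by (meson power_mono not_less zero_le)
  qed
qed simp

text \<open>By Cauchy-Schwarz, mean-square convergence becomes convergence in mean after
  multiplication by one fixed square integrable function.\<close>

lemma tendsto_integral_mult_L2:
  fixes e f :: "'a \<Rightarrow> real" and g :: "nat \<Rightarrow> 'a \<Rightarrow> real"
  assumes [measurable]: "e \<in> borel_measurable N" "f \<in> borel_measurable N" "\<And>j. g j \<in> borel_measurable N"
    and e: "(\<integral>\<^sup>+x. ennreal ((e x)\<^sup>2) \<partial>N) < \<infinity>"
    and lim: "(\<lambda>j. \<integral>\<^sup>+x. ennreal ((g j x - f x)\<^sup>2) \<partial>N) \<longlonglongrightarrow> 0"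
    and int: "\<And>j. integrable N (\<lambda>x. e x * g j x)" "integrable N (\<lambda>x. e x * f x)"
  shows "(\<lambda>j. \<integral>x. e x * g j x \<partial>N) \<longlonglongrightarrow> (\<integral>x. e x * f x \<partial>N)"
proof (rule tendsto_L1_int[OF int])
  have sq: "ennreal \<bar>x\<bar> ^ 2 = ennreal (x\<^sup>2)" for x :: real by (simp add: ennreal_power)
  show "(\<lambda>j. \<integral>\<^sup>+x. ennreal (norm (e x * g j x - e x * f x)) \<partial>N) \<longlonglongrightarrow> 0"
  proof (rule ennreal_tendsto_0_power2[OF _ lim])
    fix j
    have "(\<integral>\<^sup>+x. ennreal (norm (e x * g j x - e x * f x)) \<partial>N) = (\<integral>\<^sup>+x. ennreal \<bar>e x\<bar> * ennreal \<bar>g j x - f x\<bar> \<partial>N)"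
      by (simp add: ennreal_mult[symmetric] abs_mult[symmetric] right_diff_distrib)
    then show "(\<integral>\<^sup>+x. ennreal (norm (e x * g j x - e x * f x)) \<partial>N)\<^sup>2 \<le> (\<integral>\<^sup>+x. ennreal ((e x)\<^sup>2) \<partial>N) * (\<integral>\<^sup>+x. ennreal ((g j x - f x)\<^sup>2) \<partial>N)"
      using Cauchy_Schwarz_nn_integral[of "\<lambda>x. ennreal \<bar>e x\<bar>" N "\<lambda>x. ennreal \<bar>g j x - f x\<bar>"] by (simp add: sq)
  qed (use e in auto)
qed

lemma ennreal_square_sum3: "ennreal ((a + b + c)\<^sup>2) \<le> 3 * (ennreal (a\<^sup>2) + ennreal (b\<^sup>2) + ennreal (c\<^sup>2))"
proof -
  \<comment> \<open>This sum of squared differences is exactly the gap between the two sides of the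
    next inequality.\<close>
  have "0 \<le> (a - b)\<^sup>2 + (b - c)\<^sup>2 + (a - c)\<^sup>2" by simp
  then have "(a + b + c)\<^sup>2 \<le> 3 * (a\<^sup>2 + b\<^sup>2 + c\<^sup>2)"
    by (simp add: power2_eq_square algebra_simps)
  then have "ennreal ((a + b + c)\<^sup>2) \<le> ennreal (3 * (a\<^sup>2 + b\<^sup>2 + c\<^sup>2))" by (rule ennreal_leI)
  also have "\<dots> = 3 * (ennreal (a\<^sup>2) + ennreal (b\<^sup>2) + ennreal (c\<^sup>2))"
    by (subst ennreal_mult) (auto simp: ennreal_plus)
  finally show ?thesis .
qed

lemma nn_integral_square_sum3:
  fixes f g h :: "'a \<Rightarrow> real"
  assumes [measurable]: "f \<in> borel_measurable N" "g \<in> borel_measurable N" "h \<in> borel_measurable N"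
  shows "(\<integral>\<^sup>+x. ennreal ((f x + g x + h x)\<^sup>2) \<partial>N)
    \<le> 3 * ((\<integral>\<^sup>+x. ennreal ((f x)\<^sup>2) \<partial>N) + (\<integral>\<^sup>+x. ennreal ((g x)\<^sup>2) \<partial>N) + (\<integral>\<^sup>+x. ennreal ((h x)\<^sup>2) \<partial>N))"
proof -
  have "(\<integral>\<^sup>+x. ennreal ((f x + g x + h x)\<^sup>2) \<partial>N) \<le> (\<integral>\<^sup>+x. 3 * (ennreal ((f x)\<^sup>2) + ennreal ((g x)\<^sup>2) + ennreal ((h x)\<^sup>2)) \<partial>N)"
    by (intro nn_integral_mono ennreal_square_sum3)
  also have "\<dots> = 3 * ((\<integral>\<^sup>+x. ennreal ((f x)\<^sup>2) \<partial>N) + (\<integral>\<^sup>+x. ennreal ((g x)\<^sup>2) \<partial>N) + (\<integral>\<^sup>+x. ennreal ((h x)\<^sup>2) \<partial>N))"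
    by (simp add: nn_integral_cmult nn_integral_add)
  finally show ?thesis .
qed

text \<open>A process on \<open>{0..T}\<close> as one function of the pair of outcome and time. The
  value 0 outside turns set integrals over time into plain integrals, so mean squares become
  integrals over the product measure.\<close>

definition clip :: "real \<Rightarrow> (real \<Rightarrow> 'w \<Rightarrow> real) \<Rightarrow> 'w \<times> real \<Rightarrow> real" where
  "clip T f z = (if snd z \<in> {0..T} then f (snd z) (fst z) else 0)"

lemma clip_diff: "clip T (\<lambda>s \<omega>. f s \<omega> - g s \<omega>) z = clip T f z - clip T g z"
  by (simp add: clip_def)

lemma nn_integral_clip_square:
  assumes "clip T f \<in> borel_measurable (N \<Otimes>\<^sub>M lborel)"
  shows "(\<integral>\<^sup>+\<omega>. (\<integral>\<^sup>+s\<in>{0..T}. ennreal ((f s \<omega>)\<^sup>2) \<partial>lborel) \<partial>N) = (\<integral>\<^sup>+z. ennreal ((clip T f z)\<^sup>2) \<partial>(N \<Otimes>\<^sub>M lborel))"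
proof -
  note assms [measurable]
  have "(\<integral>\<^sup>+z. ennreal ((clip T f z)\<^sup>2) \<partial>(N \<Otimes>\<^sub>M lborel)) = (\<integral>\<^sup>+\<omega>. \<integral>\<^sup>+s. ennreal ((clip T f (\<omega>, s))\<^sup>2) \<partial>lborel \<partial>N)"
    by (subst lborel.nn_integral_fst) auto
  also have "\<dots> = (\<integral>\<^sup>+\<omega>. (\<integral>\<^sup>+s\<in>{0..T}. ennreal ((f s \<omega>)\<^sup>2) \<partial>lborel) \<partial>N)"
    by (intro nn_integral_cong) (auto simp: clip_def indicator_def)
  finally show ?thesis by simp
qed

text \<open>The length of the common part of \<open>{0..t}\<close>, \<open>{a..<b}\<close> and
  \<open>{c..<d}\<close> when \<open>a\<close> and \<open>c\<close> are nonnegative. It is at once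
  the time integral of a product of two steps and the covariance of the two stopped Brownian
  increments, which is the whole content of the isometry.\<close>

definition overlap :: "real \<Rightarrow> real \<Rightarrow> real \<Rightarrow> real \<Rightarrow> real \<Rightarrow> real" where
  "overlap t a b c d = max 0 (min (min t b) (min t d) - max a c)"

lemma has_integral_overlap:
  assumes "0 \<le> a" "0 \<le> c"
  shows "has_bochner_integral lborel
    (\<lambda>s. indicator {0..t} s * ((if a \<le> s \<and> s < b then x else 0) * (if c \<le> s \<and> s < d then y else 0)))
    (x * y * overlap t a b c d)"
proof -
  \<comment> \<open>Time runs over a closed interval but steps are half-open, so the common part is
    closed at \<open>t\<close> if \<open>t\<close> comes first and half-open otherwise. Its length
    is the same.\<close>
  let ?A = "if t < min b d then {max a c..t} else {max a c..<min b d}"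
  have eq: "(\<lambda>s. indicator {0..t} s * ((if a \<le> s \<and> s < b then x else 0) * (if c \<le> s \<and> s < d then y else 0)))
      = (\<lambda>s. x * y * indicator ?A s)"
    using assms by (intro ext) (auto simp: indicator_def)
  have m: "emeasure lborel ?A = ennreal (overlap t a b c d)"
  proof (cases "t < min b d")
    case True
    then show ?thesis by (auto simp: overlap_def emeasure_lborel_Icc_eq ennreal_eq_0_iff)
  next
    case False
    have "emeasure lborel {max a c..<min b d} = ennreal (max 0 (min b d - max a c))"
      by (cases "max a c \<le> min b d") (auto simp: ennreal_eq_0_iff)
    moreover have "min (min t b) (min t d) = min b d" using False by (auto simp: min_def)
    ultimately show ?thesis using False by (auto simp: overlap_def)
  qed
  have "has_bochner_integral lborel (indicator ?A) (measure lborel ?A)"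
    using m by (intro has_bochner_integral_real_indicator) (auto simp: less_top[symmetric])
  moreover have "measure lborel ?A = overlap t a b c d"
    unfolding measure_def m by (simp add: overlap_def del: ennreal_max_0)
  ultimately show ?thesis unfolding eq by (intro has_bochner_integral_mult_right) simp
qed

section \<open>The isometry for simple integrands\<close>

context brownian
begin

sublocale PL: pair_sigma_finite M lborel ..

lemma progressive_clip: "progressive M F f \<Longrightarrow> 0 \<le> T \<Longrightarrow> clip T f \<in> borel_measurable (M \<Otimes>\<^sub>M lborel)"
  using progressive_joint unfolding clip_def[abs_def] .

lemma increment_mean_zero:
  assumes "0 \<le> c" "c \<le> d" "G \<in> borel_measurable (F c)" "integrable M G"
  shows "has_bochner_integral M (\<lambda>\<omega>. G \<omega> * (W d \<omega> - W c \<omega>)) 0"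
  using integrable_increment[OF assms, of "\<lambda>x. x"] integral_increment[OF assms, of "\<lambda>x. x"]
    has_integral_increment[OF assms(1,2)] by (simp add: has_bochner_integral_iff)

text \<open>Cut the longer increment at \<open>b\<close>: its first piece gives the square, and the
  piece after \<open>b\<close> is orthogonal to everything known at \<open>b\<close>.\<close>

lemma increment_product:
  assumes st: "0 \<le> c" "c \<le> b" "b \<le> d" and G: "G \<in> borel_measurable (F c)" "integrable M G"
  shows "has_bochner_integral M (\<lambda>\<omega>. G \<omega> * ((W b \<omega> - W c \<omega>) * (W d \<omega> - W c \<omega>))) ((\<integral>\<omega>. G \<omega> \<partial>M) * (b - c))"
proof -
  have 1: "has_bochner_integral M (\<lambda>\<omega>. G \<omega> * (W b \<omega> - W c \<omega>)\<^sup>2) ((\<integral>\<omega>. G \<omega> \<partial>M) * (b - c))"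
    using integrable_increment[OF st(1,2) G, of "\<lambda>x. x\<^sup>2"] integral_increment[OF st(1,2) G, of "\<lambda>x. x\<^sup>2"]
      has_integral_increment_sq[OF st(1,2)] by (simp add: has_bochner_integral_iff)
  have [measurable]: "G \<in> borel_measurable (F b)" "W c \<in> borel_measurable (F b)" "W b \<in> borel_measurable (F b)"
    using measurable_F_mono[OF G(1) st(2)] W_F[of c b] W_F[of b b] st by auto
  have 2: "has_bochner_integral M (\<lambda>\<omega>. G \<omega> * (W b \<omega> - W c \<omega>) * (W d \<omega> - W b \<omega>)) 0"
    using increment_mean_zero[OF st(1,2) G] st
    by (intro increment_mean_zero) (auto simp: has_bochner_integral_iff)
  show ?thesis
    using has_bochner_integral_add[OF 1 2] by (simp add: algebra_simps power2_eq_square)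
qed

text \<open>With the first interval starting earlier, its increment is cut at \<open>c\<close>. The
  part before \<open>c\<close> is known at \<open>c\<close> and hence orthogonal to the second
  increment; the part after \<open>c\<close> shares its left end with the second interval, where
  \<open>increment_product\<close> applies.\<close>

lemma increment_product_pair_aux:
  assumes ab: "0 \<le> a" "a \<le> b" "a \<le> c" "c \<le> d"
    and \<xi>: "\<xi> \<in> borel_measurable (F a)" "\<And>\<omega>. \<omega> \<in> space M \<Longrightarrow> \<bar>\<xi> \<omega>\<bar> \<le> B"
    and \<zeta>: "\<zeta> \<in> borel_measurable (F c)" "\<And>\<omega>. \<omega> \<in> space M \<Longrightarrow> \<bar>\<zeta> \<omega>\<bar> \<le> B'"
  shows "has_bochner_integral M (\<lambda>\<omega>. (\<xi> \<omega> * (W b \<omega> - W a \<omega>)) * (\<zeta> \<omega> * (W d \<omega> - W c \<omega>)))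
    ((\<integral>\<omega>. \<xi> \<omega> * \<zeta> \<omega> \<partial>M) * max 0 (min b d - c))"
proof -
  \<comment> \<open>The cut point: it is \<open>c\<close> if the first interval reaches beyond
    \<open>c\<close>, and \<open>b\<close> if the two intervals do not meet.\<close>
  define b' where "b' = min b c"
  define G where "G \<omega> = \<xi> \<omega> * \<zeta> \<omega>" for \<omega>
  have [measurable]: "\<xi> \<in> borel_measurable (F c)" "\<zeta> \<in> borel_measurable (F c)" "W a \<in> borel_measurable (F c)"
      "W b' \<in> borel_measurable (F c)" "W c \<in> borel_measurable (F c)"
    using measurable_F_mono[OF \<xi>(1)] \<zeta>(1) ab by (auto simp: b'_def intro!: W_F)
  have Gm [measurable]: "G \<in> borel_measurable (F c)" unfolding G_def by measurable
  have GM [measurable]: "G \<in> borel_measurable M" by (rule measurable_F_M[OF Gm])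
  have GB: "\<bar>G \<omega>\<bar> \<le> B * B'" if "\<omega> \<in> space M" for \<omega>
    using \<xi>(2)[OF that] \<zeta>(2)[OF that] by (auto simp: G_def abs_mult intro: mult_mono')
  have Gi: "integrable M G"
    using GB by (intro integrable_const_bound[of _ "B * B'"]) auto
  have H: "(\<lambda>\<omega>. G \<omega> * (W b' \<omega> - W a \<omega>)) \<in> borel_measurable (F c)" by measurable
  have Hi: "integrable M (\<lambda>\<omega>. G \<omega> * (W b' \<omega> - W a \<omega>))"
    using GB has_integral_increment[of a b'] ab
    by (intro integrable_mult_bounded[where B="B * B'"]) (auto simp: b'_def has_bochner_integral_iff)
  have 1: "has_bochner_integral M (\<lambda>\<omega>. G \<omega> * (W b' \<omega> - W a \<omega>) * (W d \<omega> - W c \<omega>)) 0"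
    using ab H Hi by (intro increment_mean_zero) auto
  show ?thesis
  proof (cases "b \<le> c")
    case True
    then show ?thesis using 1 by (simp add: b'_def G_def mult_ac)
  next
    case False
    then have b': "b' = c" by (simp add: b'_def)
    have 2: "has_bochner_integral M (\<lambda>\<omega>. G \<omega> * ((W b \<omega> - W c \<omega>) * (W d \<omega> - W c \<omega>))) ((\<integral>\<omega>. G \<omega> \<partial>M) * (min b d - c))"
    proof (cases "b \<le> d")
      case True
      then show ?thesis using increment_product[of c b d G] False ab Gi by simp
    next
      case *: False
      then show ?thesis using increment_product[of c d b G] False ab Gi by (simp add: mult_ac)
    qed
    have "(\<lambda>\<omega>. G \<omega> * (W b' \<omega> - W a \<omega>) * (W d \<omega> - W c \<omega>) + G \<omega> * ((W b \<omega> - W c \<omega>) * (W d \<omega> - W c \<omega>)))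
      = (\<lambda>\<omega>. (\<xi> \<omega> * (W b \<omega> - W a \<omega>)) * (\<zeta> \<omega> * (W d \<omega> - W c \<omega>)))"
      unfolding b' G_def by (intro ext) algebra
    with has_bochner_integral_add[OF 1 2] show ?thesis
      using False ab by (simp add: G_def max_def)
  qed
qed

lemma increment_product_pair:
  assumes ab: "0 \<le> a" "a \<le> b" "0 \<le> c" "c \<le> d" "0 \<le> t"
    and \<xi>: "\<xi> \<in> borel_measurable (F a)" "\<And>\<omega>. \<omega> \<in> space M \<Longrightarrow> \<bar>\<xi> \<omega>\<bar> \<le> B"
    and \<zeta>: "\<zeta> \<in> borel_measurable (F c)" "\<And>\<omega>. \<omega> \<in> space M \<Longrightarrow> \<bar>\<zeta> \<omega>\<bar> \<le> B'"
  shows "has_bochner_integral M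
     (\<lambda>\<omega>. (\<xi> \<omega> * (W (min t b) \<omega> - W (min t a) \<omega>)) * (\<zeta> \<omega> * (W (min t d) \<omega> - W (min t c) \<omega>)))
    ((\<integral>\<omega>. \<xi> \<omega> * \<zeta> \<omega> \<partial>M) * overlap t a b c d)"
proof -
  \<comment> \<open>If \<open>t\<close> precedes a left endpoint, that stopped increment vanishes
    together with the overlap. Otherwise symmetry lets the interval that starts first take the role
    of the first one.\<close>
  consider "t < a" | "t < c" | "a \<le> c" "c \<le> t" | "c \<le> a" "a \<le> t" by linarith
  then show ?thesis
  proof cases
    case 1
    then show ?thesis using ab by (auto simp: overlap_def has_bochner_integral_zero)
  next
    case 2
    then show ?thesis using ab by (auto simp: overlap_def has_bochner_integral_zero)
  next
    case 3
    then have "min t a = a" "min t c = c" "max a c = c" by auto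
    with 3 show ?thesis using increment_product_pair_aux[of a "min t b" c "min t d" \<xi> B \<zeta> B'] ab \<xi> \<zeta>
      by (simp add: overlap_def)
  next
    case 4
    then have "min t a = a" "min t c = c" "max a c = a" by auto
    with 4 show ?thesis using increment_product_pair_aux[of c "min t d" a "min t b" \<zeta> B' \<xi> B] ab \<xi> \<zeta>
      by (simp add: overlap_def mult.commute min.commute)
  qed
qed

lemma simple_adaptedD:
  assumes "simple_adapted M F n ts \<xi>" "i < n"
  shows "0 \<le> ts i" "ts i \<le> ts (Suc i)" "\<xi> i \<in> borel_measurable (F (ts i))" "\<xi> i \<in> borel_measurable M"
    "\<exists>B. \<forall>\<omega>\<in>space M. \<bar>\<xi> i \<omega>\<bar> \<le> B"
proof -
  have "i \<le> n \<Longrightarrow> 0 \<le> ts i" for i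
  proof (induction i)
    case 0
    then show ?case using assms(1) by (simp add: simple_adapted_def)
  next
    case (Suc i)
    then have "ts i < ts (Suc i)" using assms(1) by (auto simp: simple_adapted_def)
    then show ?case using Suc by simp
  qed
  then show "0 \<le> ts i" using assms(2) by simp
  show "ts i \<le> ts (Suc i)" "\<xi> i \<in> borel_measurable (F (ts i))" "\<exists>B. \<forall>\<omega>\<in>space M. \<bar>\<xi> i \<omega>\<bar> \<le> B"
    using assms by (auto simp: simple_adapted_def less_imp_le)
  then show "\<xi> i \<in> borel_measurable M" by (auto intro: measurable_F_M)
qed

lemma simple_val_joint:
  assumes "simple_adapted M F n ts \<xi>"
  shows "(\<lambda>z. simple_val n ts \<xi> (snd z) (fst z)) \<in> borel_measurable (M \<Otimes>\<^sub>M lborel)"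
  unfolding simple_val_def
proof (intro borel_measurable_sum)
  fix i assume "i \<in> {..<n}"
  then have [measurable]: "\<xi> i \<in> borel_measurable M" using simple_adaptedD[OF assms] by auto
  show "(\<lambda>z. if ts i \<le> snd z \<and> snd z < ts (Suc i) then \<xi> i (fst z) else 0) \<in> borel_measurable (M \<Otimes>\<^sub>M lborel)"
    by measurable
qed

lemma clip_simple_val: "simple_adapted M F n ts \<xi> \<Longrightarrow> clip T (simple_val n ts \<xi>) \<in> borel_measurable (M \<Otimes>\<^sub>M lborel)"
  using simple_val_joint[of n ts \<xi>] unfolding clip_def[abs_def] by measurable

lemma simple_stoch_int_measurable:
  assumes "simple_adapted M F n ts \<xi>" "0 \<le> t"
  shows "simple_stoch_int W n ts \<xi> t \<in> borel_measurable M"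
  unfolding simple_stoch_int_def
proof (intro borel_measurable_sum)
  fix i assume "i \<in> {..<n}"
  then have [measurable]: "\<xi> i \<in> borel_measurable M" "W (min t (ts (Suc i))) \<in> borel_measurable M" "W (min t (ts i)) \<in> borel_measurable M"
    using simple_adaptedD[OF assms(1), of i] assms(2) by (auto intro!: W_M)
  show "(\<lambda>\<omega>. \<xi> i \<omega> * (W (min t (ts (Suc i))) \<omega> - W (min t (ts i)) \<omega>)) \<in> borel_measurable M"
    by measurable
qed

lemma simple_stoch_int_product:
  assumes S: "simple_adapted M F n ts \<xi>" "simple_adapted M F n' ts' \<xi>'" and t: "0 \<le> t"
  shows "has_bochner_integral M (\<lambda>\<omega>. simple_stoch_int W n ts \<xi> t \<omega> * simple_stoch_int W n' ts' \<xi>' t \<omega>)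
    (\<Sum>i<n. \<Sum>j<n'. (\<integral>\<omega>. \<xi> i \<omega> * \<xi>' j \<omega> \<partial>M) * overlap t (ts i) (ts (Suc i)) (ts' j) (ts' (Suc j)))"
  unfolding simple_stoch_int_def sum_product
proof (intro has_bochner_integral_sum)
  fix i j assume i: "i \<in> {..<n}" and j: "j \<in> {..<n'}"
  obtain B B' where "\<forall>\<omega>\<in>space M. \<bar>\<xi> i \<omega>\<bar> \<le> B" "\<forall>\<omega>\<in>space M. \<bar>\<xi>' j \<omega>\<bar> \<le> B'"
    using simple_adaptedD(5)[OF S(1)] simple_adaptedD(5)[OF S(2)] i j by (metis lessThan_iff)
  then show "has_bochner_integral M
     (\<lambda>\<omega>. \<xi> i \<omega> * (W (min t (ts (Suc i))) \<omega> - W (min t (ts i)) \<omega>) *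
          (\<xi>' j \<omega> * (W (min t (ts' (Suc j))) \<omega> - W (min t (ts' j)) \<omega>)))
     ((\<integral>\<omega>. \<xi> i \<omega> * \<xi>' j \<omega> \<partial>M) * overlap t (ts i) (ts (Suc i)) (ts' j) (ts' (Suc j)))"
    using simple_adaptedD(1-3)[OF S(1), of i] simple_adaptedD(1-3)[OF S(2), of j] i j t
    by (intro increment_product_pair) auto
qed

lemma simple_val_product:
  assumes S: "simple_adapted M F n ts \<xi>" "simple_adapted M F n' ts' \<xi>'"
  shows "has_bochner_integral lborel (\<lambda>s. indicator {0..t} s * (simple_val n ts \<xi> s \<omega> * simple_val n' ts' \<xi>' s \<omega>))
    (\<Sum>i<n. \<Sum>j<n'. \<xi> i \<omega> * \<xi>' j \<omega> * overlap t (ts i) (ts (Suc i)) (ts' j) (ts' (Suc j)))"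
  unfolding simple_val_def sum_product unfolding sum_distrib_left
  using simple_adaptedD(1)[OF S(1)] simple_adaptedD(1)[OF S(2)]
  by (intro has_bochner_integral_sum has_integral_overlap) auto

lemma simple_val_product_mean:
  assumes S: "simple_adapted M F n ts \<xi>" "simple_adapted M F n' ts' \<xi>'"
  shows "has_bochner_integral M (\<lambda>\<omega>. \<Sum>i<n. \<Sum>j<n'. \<xi> i \<omega> * \<xi>' j \<omega> * overlap t (ts i) (ts (Suc i)) (ts' j) (ts' (Suc j)))
    (\<Sum>i<n. \<Sum>j<n'. (\<integral>\<omega>. \<xi> i \<omega> * \<xi>' j \<omega> \<partial>M) * overlap t (ts i) (ts (Suc i)) (ts' j) (ts' (Suc j)))"
proof (intro has_bochner_integral_sum has_bochner_integral_mult_left)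
  fix i j assume i: "i \<in> {..<n}" and j: "j \<in> {..<n'}"
  obtain B B' where B: "\<forall>\<omega>\<in>space M. \<bar>\<xi> i \<omega>\<bar> \<le> B" "\<forall>\<omega>\<in>space M. \<bar>\<xi>' j \<omega>\<bar> \<le> B'"
    using simple_adaptedD(5)[OF S(1)] simple_adaptedD(5)[OF S(2)] i j by (metis lessThan_iff)
  have [measurable]: "\<xi> i \<in> borel_measurable M" "\<xi>' j \<in> borel_measurable M"
    using simple_adaptedD(4)[OF S(1)] simple_adaptedD(4)[OF S(2)] i j by auto
  have "integrable M (\<lambda>\<omega>. \<xi> i \<omega> * \<xi>' j \<omega>)"
    using B by (intro integrable_mult_bounded[where B=B] integrable_const_bound[of _ B']) auto
  then show "has_bochner_integral M (\<lambda>\<omega>. \<xi> i \<omega> * \<xi>' j \<omega>) (\<integral>\<omega>. \<xi> i \<omega> * \<xi>' j \<omega> \<partial>M)"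
    by (simp add: has_bochner_integral_iff)
qed

text \<open>Both sides are expanded into the same double sums over pairs of steps, with
  \<open>overlap\<close> as the coefficient. Two unrelated partitions are thus compared without a
  common refinement, and a real \<open>v\<close> on the right records finiteness as well.\<close>

lemma simple_isometry:
  assumes S: "simple_adapted M F n ts \<xi>" "simple_adapted M F n' ts' \<xi>'" and t: "0 \<le> t"
  shows "\<exists>v. (\<integral>\<^sup>+\<omega>. ennreal ((simple_stoch_int W n ts \<xi> t \<omega> - simple_stoch_int W n' ts' \<xi>' t \<omega>)\<^sup>2) \<partial>M) = ennreal v \<and>
    (\<integral>\<^sup>+\<omega>. (\<integral>\<^sup>+s\<in>{0..t}. ennreal ((simple_val n ts \<xi> s \<omega> - simple_val n' ts' \<xi>' s \<omega>)\<^sup>2) \<partial>lborel) \<partial>M) = ennreal v"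
proof -
  let ?S = "simple_stoch_int W n ts \<xi> t" and ?S' = "simple_stoch_int W n' ts' \<xi>' t"
  let ?f = "simple_val n ts \<xi>" and ?f' = "simple_val n' ts' \<xi>'"
  \<comment> \<open>The \<open>q\<close> are the expected values of the random double sums
    \<open>r11\<close>, \<open>r12\<close>, \<open>r22\<close> defined next: the \<open>q\<close>
    come from products of the stochastic integrals, the \<open>r\<close> from time integrals of
    products of the integrands.\<close>
  define q11 where "q11 = (\<Sum>i<n. \<Sum>j<n. (\<integral>\<omega>. \<xi> i \<omega> * \<xi> j \<omega> \<partial>M) * overlap t (ts i) (ts (Suc i)) (ts j) (ts (Suc j)))"
  define q12 where "q12 = (\<Sum>i<n. \<Sum>j<n'. (\<integral>\<omega>. \<xi> i \<omega> * \<xi>' j \<omega> \<partial>M) * overlap t (ts i) (ts (Suc i)) (ts' j) (ts' (Suc j)))"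
  define q22 where "q22 = (\<Sum>i<n'. \<Sum>j<n'. (\<integral>\<omega>. \<xi>' i \<omega> * \<xi>' j \<omega> \<partial>M) * overlap t (ts' i) (ts' (Suc i)) (ts' j) (ts' (Suc j)))"
  define r11 where "r11 \<omega> = (\<Sum>i<n. \<Sum>j<n. \<xi> i \<omega> * \<xi> j \<omega> * overlap t (ts i) (ts (Suc i)) (ts j) (ts (Suc j)))" for \<omega>
  define r12 where "r12 \<omega> = (\<Sum>i<n. \<Sum>j<n'. \<xi> i \<omega> * \<xi>' j \<omega> * overlap t (ts i) (ts (Suc i)) (ts' j) (ts' (Suc j)))" for \<omega>
  define r22 where "r22 \<omega> = (\<Sum>i<n'. \<Sum>j<n'. \<xi>' i \<omega> * \<xi>' j \<omega> * overlap t (ts' i) (ts' (Suc i)) (ts' j) (ts' (Suc j)))" for \<omega>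
  define v where "v = q11 - 2 * q12 + q22"
  have r: "has_bochner_integral M r11 q11" "has_bochner_integral M r12 q12" "has_bochner_integral M r22 q22"
    unfolding r11_def[abs_def] r12_def[abs_def] r22_def[abs_def] q11_def q12_def q22_def
    by (intro simple_val_product_mean S)+
  have s: "has_bochner_integral M (\<lambda>\<omega>. ?S \<omega> * ?S \<omega>) q11" "has_bochner_integral M (\<lambda>\<omega>. ?S \<omega> * ?S' \<omega>) q12"
    "has_bochner_integral M (\<lambda>\<omega>. ?S' \<omega> * ?S' \<omega>) q22"
    unfolding q11_def q12_def q22_def by (intro simple_stoch_int_product S t)+
  have f: "has_bochner_integral lborel (\<lambda>s. indicator {0..t} s * (?f s \<omega> * ?f s \<omega>)) (r11 \<omega>)"
    "has_bochner_integral lborel (\<lambda>s. indicator {0..t} s * (?f s \<omega> * ?f' s \<omega>)) (r12 \<omega>)"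
    "has_bochner_integral lborel (\<lambda>s. indicator {0..t} s * (?f' s \<omega> * ?f' s \<omega>)) (r22 \<omega>)" for \<omega>
    unfolding r11_def r12_def r22_def by (intro simple_val_product S)+
  have "has_bochner_integral M (\<lambda>\<omega>. ?S \<omega> * ?S \<omega> - 2 * (?S \<omega> * ?S' \<omega>) + ?S' \<omega> * ?S' \<omega>) v"
    unfolding v_def by (intro has_bochner_integral_add has_bochner_integral_diff has_bochner_integral_mult_right s)
  then have "has_bochner_integral M (\<lambda>\<omega>. (?S \<omega> - ?S' \<omega>)\<^sup>2) v"
    by (simp add: power2_eq_square algebra_simps)
  then have 1: "(\<integral>\<^sup>+\<omega>. ennreal ((?S \<omega> - ?S' \<omega>)\<^sup>2) \<partial>M) = ennreal v"
    by (subst nn_integral_eq_integral) (auto simp: has_bochner_integral_iff)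
  define r where "r \<omega> = r11 \<omega> - 2 * r12 \<omega> + r22 \<omega>" for \<omega>
  have fr: "has_bochner_integral lborel (\<lambda>s. indicator {0..t} s * (?f s \<omega> - ?f' s \<omega>)\<^sup>2) (r \<omega>)" for \<omega>
  proof -
    have "has_bochner_integral lborel (\<lambda>s. indicator {0..t} s * (?f s \<omega> * ?f s \<omega>) -
       2 * (indicator {0..t} s * (?f s \<omega> * ?f' s \<omega>)) + indicator {0..t} s * (?f' s \<omega> * ?f' s \<omega>)) (r \<omega>)"
      unfolding r_def by (intro has_bochner_integral_add has_bochner_integral_diff has_bochner_integral_mult_right f)
    then show ?thesis by (simp add: power2_eq_square algebra_simps)
  qed
  have inner: "(\<integral>\<^sup>+s\<in>{0..t}. ennreal ((?f s \<omega> - ?f' s \<omega>)\<^sup>2) \<partial>lborel) = ennreal (r \<omega>)" for \<omega>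
  proof -
    have "(\<integral>\<^sup>+s\<in>{0..t}. ennreal ((?f s \<omega> - ?f' s \<omega>)\<^sup>2) \<partial>lborel) = (\<integral>\<^sup>+s. ennreal (indicator {0..t} s * (?f s \<omega> - ?f' s \<omega>)\<^sup>2) \<partial>lborel)"
      by (intro nn_integral_cong) (auto simp: indicator_def)
    also have "\<dots> = ennreal (r \<omega>)"
      using fr[of \<omega>] by (subst nn_integral_eq_integral) (auto simp: has_bochner_integral_iff)
    finally show ?thesis .
  qed
  have r0: "0 \<le> r \<omega>" for \<omega>
  proof -
    have e: "r \<omega> = (\<integral>s. indicator {0..t} s * (?f s \<omega> - ?f' s \<omega>)\<^sup>2 \<partial>lborel)"
      using has_bochner_integral_integral_eq[OF fr] by simp
    show ?thesis unfolding e by (intro integral_nonneg_AE) auto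
  qed
  have "has_bochner_integral M r v"
    unfolding r_def[abs_def] v_def by (intro has_bochner_integral_add has_bochner_integral_diff has_bochner_integral_mult_right r)
  then have 2: "(\<integral>\<^sup>+\<omega>. ennreal (r \<omega>) \<partial>M) = ennreal v"
    using r0 by (subst nn_integral_eq_integral) (auto simp: has_bochner_integral_iff)
  show ?thesis using 1 2 by (intro exI[of _ v]) (simp add: inner)
qed

section \<open>General Ito integrals as mean-square limits\<close>

lemma ito_integral_measurable: "ito_integral M F W \<pi> I \<Longrightarrow> 0 \<le> t \<Longrightarrow> I t \<in> borel_measurable M"
  by (auto simp: ito_integral_def)

lemma ito_integral_zero: "ito_integral M F W (\<lambda>_ _. 0) (\<lambda>_ _. 0)"
  unfolding ito_integral_def
  by (intro allI impI conjI exI[of _ "\<lambda>_. 0"] exI[of _ "\<lambda>_ _. 0"] exI[of _ "\<lambda>_ _ _. 0"])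
     (auto simp: simple_adapted_def simple_val_def simple_stoch_int_def)

lemma ito_integral_approx:
  assumes "ito_integral M F W \<pi> I" "progressive M F \<pi>" "0 \<le> t"
  obtains N TS \<Xi> where "\<And>j. simple_adapted M F (N j) (TS j) (\<Xi> j)"
    "(\<lambda>j. \<integral>\<^sup>+z. ennreal ((clip t (simple_val (N j) (TS j) (\<Xi> j)) z - clip t \<pi> z)\<^sup>2) \<partial>(M \<Otimes>\<^sub>M lborel)) \<longlonglongrightarrow> 0"
    "(\<lambda>j. \<integral>\<^sup>+\<omega>. ennreal ((I t \<omega> - simple_stoch_int W (N j) (TS j) (\<Xi> j) t \<omega>)\<^sup>2) \<partial>M) \<longlonglongrightarrow> 0"
proof -
  from assms(1,3) obtain N TS \<Xi> where S: "\<And>j. simple_adapted M F (N j) (TS j) (\<Xi> j)"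
    and 1: "(\<lambda>j. \<integral>\<^sup>+\<omega>. (\<integral>\<^sup>+s\<in>{0..t}. ennreal ((simple_val (N j) (TS j) (\<Xi> j) s \<omega> - \<pi> s \<omega>)\<^sup>2) \<partial>lborel) \<partial>M) \<longlonglongrightarrow> 0"
    and 2: "(\<lambda>j. \<integral>\<^sup>+\<omega>. ennreal ((I t \<omega> - simple_stoch_int W (N j) (TS j) (\<Xi> j) t \<omega>)\<^sup>2) \<partial>M) \<longlonglongrightarrow> 0"
    unfolding ito_integral_def by blast
  have "(\<integral>\<^sup>+\<omega>. (\<integral>\<^sup>+s\<in>{0..t}. ennreal ((simple_val (N j) (TS j) (\<Xi> j) s \<omega> - \<pi> s \<omega>)\<^sup>2) \<partial>lborel) \<partial>M)
    = (\<integral>\<^sup>+z. ennreal ((clip t (simple_val (N j) (TS j) (\<Xi> j)) z - clip t \<pi> z)\<^sup>2) \<partial>(M \<Otimes>\<^sub>M lborel))" for j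
    using clip_simple_val[OF S, of t j] progressive_clip[OF assms(2,3)]
    by (subst nn_integral_clip_square) (auto simp: clip_diff[abs_def])
  with 1 have "(\<lambda>j. \<integral>\<^sup>+z. ennreal ((clip t (simple_val (N j) (TS j) (\<Xi> j)) z - clip t \<pi> z)\<^sup>2) \<partial>(M \<Otimes>\<^sub>M lborel)) \<longlonglongrightarrow> 0"
    by simp
  with S 2 show ?thesis by (intro that)
qed

text \<open>The factor 9 is lossy, but it lets three-term expansions of squares replace norms.\<close>

lemma ito_integral_diff_bound:
  assumes I: "ito_integral M F W \<pi> I" "ito_integral M F W \<pi>' I'"
    and p: "progressive M F \<pi>" "progressive M F \<pi>'" and t: "0 \<le> t"
  shows "(\<integral>\<^sup>+\<omega>. ennreal ((I t \<omega> - I' t \<omega>)\<^sup>2) \<partial>M) \<le> 9 * (\<integral>\<^sup>+z. ennreal ((clip t \<pi> z - clip t \<pi>' z)\<^sup>2) \<partial>(M \<Otimes>\<^sub>M lborel))"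
proof -
  let ?P = "M \<Otimes>\<^sub>M lborel"
  obtain N TS \<Xi> where S: "\<And>j. simple_adapted M F (N j) (TS j) (\<Xi> j)"
    and 1: "(\<lambda>j. \<integral>\<^sup>+z. ennreal ((clip t (simple_val (N j) (TS j) (\<Xi> j)) z - clip t \<pi> z)\<^sup>2) \<partial>?P) \<longlonglongrightarrow> 0"
    and 2: "(\<lambda>j. \<integral>\<^sup>+\<omega>. ennreal ((I t \<omega> - simple_stoch_int W (N j) (TS j) (\<Xi> j) t \<omega>)\<^sup>2) \<partial>M) \<longlonglongrightarrow> 0"
    by (rule ito_integral_approx[OF I(1) p(1) t]) blast
  obtain N' TS' \<Xi>' where S': "\<And>j. simple_adapted M F (N' j) (TS' j) (\<Xi>' j)"
    and a1: "(\<lambda>j. \<integral>\<^sup>+z. ennreal ((clip t (simple_val (N' j) (TS' j) (\<Xi>' j)) z - clip t \<pi>' z)\<^sup>2) \<partial>?P) \<longlonglongrightarrow> 0"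
    and a2: "(\<lambda>j. \<integral>\<^sup>+\<omega>. ennreal ((I' t \<omega> - simple_stoch_int W (N' j) (TS' j) (\<Xi>' j) t \<omega>)\<^sup>2) \<partial>M) \<longlonglongrightarrow> 0"
    by (rule ito_integral_approx[OF I(2) p(2) t]) blast
  define f where "f j = clip t (simple_val (N j) (TS j) (\<Xi> j))" for j
  define f' where "f' j = clip t (simple_val (N' j) (TS' j) (\<Xi>' j))" for j
  define s where "s j = simple_stoch_int W (N j) (TS j) (\<Xi> j) t" for j
  define s' where "s' j = simple_stoch_int W (N' j) (TS' j) (\<Xi>' j) t" for j
  have [measurable]: "f j \<in> borel_measurable ?P" "f' j \<in> borel_measurable ?P"
      "s j \<in> borel_measurable M" "s' j \<in> borel_measurable M" for j
    unfolding f_def f'_def s_def s'_def by (auto intro: clip_simple_val S S' simple_stoch_int_measurable t)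
  have [measurable]: "I t \<in> borel_measurable M" "I' t \<in> borel_measurable M"
    using I t by (auto intro: ito_integral_measurable)
  have [measurable]: "clip t \<pi> \<in> borel_measurable ?P" "clip t \<pi>' \<in> borel_measurable ?P"
    using p t by (auto intro: progressive_clip)
  define A where "A j = (\<integral>\<^sup>+\<omega>. ennreal ((I t \<omega> - s j \<omega>)\<^sup>2) \<partial>M)" for j
  define A' where "A' j = (\<integral>\<^sup>+\<omega>. ennreal ((I' t \<omega> - s' j \<omega>)\<^sup>2) \<partial>M)" for j
  define E where "E j = (\<integral>\<^sup>+z. ennreal ((f j z - clip t \<pi> z)\<^sup>2) \<partial>?P)" for j
  define E' where "E' j = (\<integral>\<^sup>+z. ennreal ((f' j z - clip t \<pi>' z)\<^sup>2) \<partial>?P)" for j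
  define D where "D = (\<integral>\<^sup>+z. ennreal ((clip t \<pi> z - clip t \<pi>' z)\<^sup>2) \<partial>?P)"
  have lims: "A \<longlonglongrightarrow> 0" "A' \<longlonglongrightarrow> 0" "E \<longlonglongrightarrow> 0" "E' \<longlonglongrightarrow> 0"
    using 1 a1 2 a2 unfolding A_def A'_def E_def E'_def f_def f'_def s_def s'_def by auto
  have bound: "(\<integral>\<^sup>+\<omega>. ennreal ((I t \<omega> - I' t \<omega>)\<^sup>2) \<partial>M) \<le> 3 * (A j + 3 * (E j + D + E' j) + A' j)" for j
  proof -
    have "(\<integral>\<^sup>+\<omega>. ennreal ((I t \<omega> - I' t \<omega>)\<^sup>2) \<partial>M)
       = (\<integral>\<^sup>+\<omega>. ennreal (((I t \<omega> - s j \<omega>) + (s j \<omega> - s' j \<omega>) + (s' j \<omega> - I' t \<omega>))\<^sup>2) \<partial>M)" by simp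
    also have "\<dots> \<le> 3 * (A j + (\<integral>\<^sup>+\<omega>. ennreal ((s j \<omega> - s' j \<omega>)\<^sup>2) \<partial>M) + (\<integral>\<^sup>+\<omega>. ennreal ((s' j \<omega> - I' t \<omega>)\<^sup>2) \<partial>M))"
      unfolding A_def by (intro nn_integral_square_sum3) measurable
    also have "(\<integral>\<^sup>+\<omega>. ennreal ((s' j \<omega> - I' t \<omega>)\<^sup>2) \<partial>M) = A' j"
      unfolding A'_def by (simp add: power2_commute)
    \<comment> \<open>The isometry trades the distance of the simple integrals for that of the
      simple integrands, which is then routed through \<open>clip t \<pi>\<close> and
      \<open>clip t \<pi>'\<close>.\<close>
    also have "(\<integral>\<^sup>+\<omega>. ennreal ((s j \<omega> - s' j \<omega>)\<^sup>2) \<partial>M) = (\<integral>\<^sup>+z. ennreal ((f j z - f' j z)\<^sup>2) \<partial>?P)"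
    proof -
      have m: "clip t (\<lambda>s \<omega>. simple_val (N j) (TS j) (\<Xi> j) s \<omega> - simple_val (N' j) (TS' j) (\<Xi>' j) s \<omega>) = (\<lambda>z. f j z - f' j z)"
        by (simp add: clip_diff[abs_def] f_def f'_def)
      have "(\<integral>\<^sup>+\<omega>. ennreal ((s j \<omega> - s' j \<omega>)\<^sup>2) \<partial>M) =
         (\<integral>\<^sup>+\<omega>. (\<integral>\<^sup>+s\<in>{0..t}. ennreal ((simple_val (N j) (TS j) (\<Xi> j) s \<omega> - simple_val (N' j) (TS' j) (\<Xi>' j) s \<omega>)\<^sup>2) \<partial>lborel) \<partial>M)"
        using simple_isometry[OF S S' t, of j j] unfolding s_def s'_def by auto
      also have "\<dots> = (\<integral>\<^sup>+z. ennreal ((f j z - f' j z)\<^sup>2) \<partial>?P)"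
        by (subst nn_integral_clip_square) (simp_all add: m)
      finally show ?thesis .
    qed
    also have "(\<integral>\<^sup>+z. ennreal ((f j z - f' j z)\<^sup>2) \<partial>?P)
       = (\<integral>\<^sup>+z. ennreal (((f j z - clip t \<pi> z) + (clip t \<pi> z - clip t \<pi>' z) + (clip t \<pi>' z - f' j z))\<^sup>2) \<partial>?P)" by simp
    also have "\<dots> \<le> 3 * (E j + D + (\<integral>\<^sup>+z. ennreal ((clip t \<pi>' z - f' j z)\<^sup>2) \<partial>?P))"
      unfolding E_def D_def by (intro nn_integral_square_sum3) measurable
    also have "(\<integral>\<^sup>+z. ennreal ((clip t \<pi>' z - f' j z)\<^sup>2) \<partial>?P) = E' j"
      unfolding E'_def by (simp add: power2_commute)
    finally show ?thesis by (simp add: add_mono mult_left_mono)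
  qed
  have "(\<lambda>j. 3 * (A j + 3 * (E j + D + E' j) + A' j)) \<longlonglongrightarrow> 3 * (0 + 3 * (0 + D + 0) + 0)"
    by (intro ennreal_tendsto_cmult tendsto_add tendsto_const lims) auto
  then have "(\<integral>\<^sup>+\<omega>. ennreal ((I t \<omega> - I' t \<omega>)\<^sup>2) \<partial>M) \<le> 3 * (0 + 3 * (0 + D + 0) + 0)"
    by (rule LIMSEQ_le_const) (use bound in auto)
  also have "\<dots> = 9 * D" by (simp add: mult.assoc[symmetric])
  finally show ?thesis unfolding D_def .
qed

lemma ito_integral_square_bound:
  assumes "ito_integral M F W \<pi> I" "progressive M F \<pi>" "0 \<le> t"
  shows "(\<integral>\<^sup>+\<omega>. ennreal ((I t \<omega>)\<^sup>2) \<partial>M) \<le> 9 * (\<integral>\<^sup>+z. ennreal ((clip t \<pi> z)\<^sup>2) \<partial>(M \<Otimes>\<^sub>M lborel))"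
proof -
  have "progressive M F (\<lambda>_ _. 0)" by (auto simp: progressive_def case_prod_beta')
  from ito_integral_diff_bound[OF assms(1) ito_integral_zero assms(2) this assms(3)]
  show ?thesis by (simp add: clip_def)
qed

section \<open>Ito integrals under an exponential weight\<close>

lemma simple_val_integral:
  assumes S: "simple_adapted M F n ts \<xi>" and T: "0 \<le> T"
  shows "has_bochner_integral lborel (\<lambda>s. indicator {0..T} s * simple_val n ts \<xi> s \<omega>)
    (\<Sum>i<n. \<xi> i \<omega> * (min T (ts (Suc i)) - min T (ts i)))"
  unfolding simple_val_def sum_distrib_left
proof (rule has_bochner_integral_sum)
  fix i assume i: "i \<in> {..<n}"
  then have ts: "0 \<le> ts i" "ts i \<le> ts (Suc i)" using simple_adaptedD[OF S] by auto
  \<comment> \<open>A single step is written as a product with its own indicator, so that the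
    formula for two steps can be reused.\<close>
  have "has_bochner_integral lborel
    (\<lambda>s. indicator {0..T} s * ((if ts i \<le> s \<and> s < ts (Suc i) then \<xi> i \<omega> else 0) * (if ts i \<le> s \<and> s < ts (Suc i) then 1 else 0)))
    (\<xi> i \<omega> * 1 * overlap T (ts i) (ts (Suc i)) (ts i) (ts (Suc i)))"
    by (rule has_integral_overlap[OF ts(1) ts(1)])
  moreover have "overlap T (ts i) (ts (Suc i)) (ts i) (ts (Suc i)) = min T (ts (Suc i)) - min T (ts i)"
    using ts by (auto simp: overlap_def min_def max_def)
  moreover have "(\<lambda>s. indicator {0..T} s * ((if ts i \<le> s \<and> s < ts (Suc i) then \<xi> i \<omega> else 0) * (if ts i \<le> s \<and> s < ts (Suc i) then 1 else 0)))
     = (\<lambda>s. indicator {0..T} s * (if ts i \<le> s \<and> s < ts (Suc i) then \<xi> i \<omega> else 0))" by auto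
  ultimately show "has_bochner_integral lborel
    (\<lambda>s. indicator {0..T} s * (if ts i \<le> s \<and> s < ts (Suc i) then \<xi> i \<omega> else 0))
    (\<xi> i \<omega> * (min T (ts (Suc i)) - min T (ts i)))" by simp
qed

lemma integrable_expm_square:
  assumes "0 \<le> T" shows "integrable M (\<lambda>\<omega>. (expm b T \<omega>)\<^sup>2)"
  using expm_M[OF assms, of b] nn_integral_expm_square[OF assms, of b]
  by (intro integrableI_bounded) auto

text \<open>The weight at the final time is regarded as a process that is constant in time. Its
  square integrability makes it the fixed factor for \<open>tendsto_integral_mult_L2\<close> on the
  product space.\<close>

lemma clip_expm:
  assumes T: "0 \<le> T"
  shows "clip T (\<lambda>_. expm b T) \<in> borel_measurable (M \<Otimes>\<^sub>M lborel)"
    "(\<integral>\<^sup>+z. ennreal ((clip T (\<lambda>_. expm b T) z)\<^sup>2) \<partial>(M \<Otimes>\<^sub>M lborel)) = ennreal (T * exp (b\<^sup>2 * T))"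
proof -
  have [measurable]: "expm b T \<in> borel_measurable M" using T by (rule expm_M)
  show m: "clip T (\<lambda>_. expm b T) \<in> borel_measurable (M \<Otimes>\<^sub>M lborel)"
    unfolding clip_def[abs_def] by measurable
  have "(\<integral>\<^sup>+z. ennreal ((clip T (\<lambda>_. expm b T) z)\<^sup>2) \<partial>(M \<Otimes>\<^sub>M lborel)) = (\<integral>\<^sup>+\<omega>. ennreal ((expm b T \<omega>)\<^sup>2) * ennreal T \<partial>M)"
    using T by (subst nn_integral_clip_square[OF m, symmetric]) (simp add: nn_integral_cmult)
  also have "\<dots> = ennreal (T * exp (b\<^sup>2 * T))"
    using T by (simp add: nn_integral_multc nn_integral_expm_square ennreal_mult' mult.commute[of T])
  finally show "(\<integral>\<^sup>+z. ennreal ((clip T (\<lambda>_. expm b T) z)\<^sup>2) \<partial>(M \<Otimes>\<^sub>M lborel)) = ennreal (T * exp (b\<^sup>2 * T))" .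
qed

lemma integrable_clip_square:
  assumes "clip T f \<in> borel_measurable (M \<Otimes>\<^sub>M lborel)" "(\<integral>\<^sup>+z. ennreal ((clip T f z)\<^sup>2) \<partial>(M \<Otimes>\<^sub>M lborel)) < \<infinity>"
  shows "integrable (M \<Otimes>\<^sub>M lborel) (\<lambda>z. (clip T f z)\<^sup>2)"
  using assms by (intro integrableI_bounded) auto

lemma integrable_clip:
  assumes T: "0 \<le> T" and [measurable]: "clip T f \<in> borel_measurable (M \<Otimes>\<^sub>M lborel)"
    and fin: "(\<integral>\<^sup>+z. ennreal ((clip T f z)\<^sup>2) \<partial>(M \<Otimes>\<^sub>M lborel)) < \<infinity>"
  shows "integrable (M \<Otimes>\<^sub>M lborel) (clip T f)"
proof -
  let ?i = "clip T (\<lambda>_ _. 1)"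
  have [measurable]: "?i \<in> borel_measurable (M \<Otimes>\<^sub>M lborel)" unfolding clip_def[abs_def] by measurable
  have "(\<integral>\<^sup>+z. ennreal ((?i z)\<^sup>2) \<partial>(M \<Otimes>\<^sub>M lborel)) < \<infinity>"
    using T by (subst nn_integral_clip_square[symmetric]) (auto simp: emeasure_space_1)
  then have "integrable (M \<Otimes>\<^sub>M lborel) (\<lambda>z. (?i z)\<^sup>2)" by (intro integrable_clip_square) auto
  moreover have "integrable (M \<Otimes>\<^sub>M lborel) (\<lambda>z. (clip T f z)\<^sup>2)" using fin by (intro integrable_clip_square) auto
  ultimately have "integrable (M \<Otimes>\<^sub>M lborel) (\<lambda>z. ?i z * clip T f z)" by (intro integrable_mult_square_integrable) auto
  also have "(\<lambda>z. ?i z * clip T f z) = clip T f" by (auto simp: clip_def)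
  finally show ?thesis .
qed

text \<open>Summing \<open>has_integral_expm_increment\<close> over the steps replaces each
  increment by \<open>b\<close> times the length of the step; the result is a time integral, which
  Fubini turns into an integral over the product space.\<close>

lemma simple_stoch_int_expm:
  assumes S: "simple_adapted M F n ts \<xi>" and T: "0 \<le> T"
  shows "integrable M (\<lambda>\<omega>. expm b T \<omega> * simple_stoch_int W n ts \<xi> T \<omega>)"
    and "integrable (M \<Otimes>\<^sub>M lborel) (\<lambda>z. clip T (\<lambda>_. expm b T) z * clip T (simple_val n ts \<xi>) z)"
    and "(\<integral>\<omega>. expm b T \<omega> * simple_stoch_int W n ts \<xi> T \<omega> \<partial>M) =
      b * (\<integral>z. clip T (\<lambda>_. expm b T) z * clip T (simple_val n ts \<xi>) z \<partial>(M \<Otimes>\<^sub>M lborel))"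
proof -
  let ?P = "M \<Otimes>\<^sub>M lborel"
  let ?d = "\<lambda>i. min T (ts (Suc i)) - min T (ts i)"
  have 1: "has_bochner_integral M (\<lambda>\<omega>. \<Sum>i<n. \<xi> i \<omega> * (W (min T (ts (Suc i))) \<omega> - W (min T (ts i)) \<omega>) * expm b T \<omega>)
    (\<Sum>i<n. b * ?d i * (\<integral>\<omega>. \<xi> i \<omega> * expm b T \<omega> \<partial>M))"
  and 2: "has_bochner_integral M (\<lambda>\<omega>. \<Sum>i<n. ?d i * (\<xi> i \<omega> * expm b T \<omega>)) (\<Sum>i<n. ?d i * (\<integral>\<omega>. \<xi> i \<omega> * expm b T \<omega> \<partial>M))"
  proof (safe intro!: has_bochner_integral_sum)
    fix i assume "i < n"
    note D = simple_adaptedD[OF S this]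
    obtain B where B: "\<And>\<omega>. \<omega> \<in> space M \<Longrightarrow> \<bar>\<xi> i \<omega>\<bar> \<le> B" using D(5) by blast
    have int: "integrable M (\<lambda>\<omega>. \<xi> i \<omega> * expm b s \<omega>)" if "0 \<le> s" for s
      using has_integral_expm_one[OF that, of b] B D(4)
      by (intro integrable_mult_bounded[where B=B]) (auto simp: has_bochner_integral_iff)
    show "has_bochner_integral M (\<lambda>\<omega>. \<xi> i \<omega> * (W (min T (ts (Suc i))) \<omega> - W (min T (ts i)) \<omega>) * expm b T \<omega>)
        (b * ?d i * (\<integral>\<omega>. \<xi> i \<omega> * expm b T \<omega> \<partial>M))"
    \<comment> \<open>For a step that begins after \<open>T\<close> both endpoints are cut to
      \<open>T\<close>, and the increment and its length vanish.\<close>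
    proof (cases "ts i \<le> T")
      case True
      then show ?thesis
        using has_integral_expm_increment[of "ts i" "min T (ts (Suc i))" T "\<xi> i" b] D int[of "ts i"]
        by (simp add: min_def has_bochner_integral_zero)
    next
      case False
      then show ?thesis using D by (simp add: min_def has_bochner_integral_zero)
    qed
    show "has_bochner_integral M (\<lambda>\<omega>. ?d i * (\<xi> i \<omega> * expm b T \<omega>)) (?d i * (\<integral>\<omega>. \<xi> i \<omega> * expm b T \<omega> \<partial>M))"
      using int[OF T] by (intro has_bochner_integral_mult_right) (simp add: has_bochner_integral_iff)
  qed
  have eq: "(\<lambda>\<omega>. \<Sum>i<n. \<xi> i \<omega> * (W (min T (ts (Suc i))) \<omega> - W (min T (ts i)) \<omega>) * expm b T \<omega>)
     = (\<lambda>\<omega>. expm b T \<omega> * simple_stoch_int W n ts \<xi> T \<omega>)"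
    by (simp add: simple_stoch_int_def sum_distrib_left mult_ac)
  show "integrable M (\<lambda>\<omega>. expm b T \<omega> * simple_stoch_int W n ts \<xi> T \<omega>)"
    using 1 unfolding eq by (simp add: has_bochner_integral_iff)
  \<comment> \<open>Comparison with the empty simple integrand extracts the finite second moment
    from the isometry for differences.\<close>
  have S0: "simple_adapted M F 0 (\<lambda>_. 0) (\<lambda>_ _. 0)" by (simp add: simple_adapted_def)
  obtain v where "(\<integral>\<^sup>+\<omega>. (\<integral>\<^sup>+s\<in>{0..T}. ennreal ((simple_val n ts \<xi> s \<omega> - simple_val 0 (\<lambda>_. 0) (\<lambda>_ _. 0) s \<omega>)\<^sup>2) \<partial>lborel) \<partial>M) = ennreal v"
    using simple_isometry[OF S S0 T] by auto
  then have "(\<integral>\<^sup>+\<omega>. (\<integral>\<^sup>+s\<in>{0..T}. ennreal ((simple_val n ts \<xi> s \<omega>)\<^sup>2) \<partial>lborel) \<partial>M) < \<infinity>"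
    by (simp add: simple_val_def[of 0])
  then have "integrable ?P (\<lambda>z. (clip T (simple_val n ts \<xi>) z)\<^sup>2)"
    using clip_simple_val[OF S] by (intro integrable_clip_square) (simp_all add: nn_integral_clip_square)
  moreover have "integrable ?P (\<lambda>z. (clip T (\<lambda>_. expm b T) z)\<^sup>2)"
    using clip_expm[OF T, of b] by (intro integrable_clip_square) simp_all
  ultimately show i: "integrable ?P (\<lambda>z. clip T (\<lambda>_. expm b T) z * clip T (simple_val n ts \<xi>) z)"
    using clip_simple_val[OF S] clip_expm[OF T] by (intro integrable_mult_square_integrable) auto
  have inner: "(\<integral>s. clip T (\<lambda>_. expm b T) (\<omega>, s) * clip T (simple_val n ts \<xi>) (\<omega>, s) \<partial>lborel) = (\<Sum>i<n. ?d i * (\<xi> i \<omega> * expm b T \<omega>))" for \<omega>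
  proof -
    have "(\<integral>s. clip T (\<lambda>_. expm b T) (\<omega>, s) * clip T (simple_val n ts \<xi>) (\<omega>, s) \<partial>lborel)
       = (\<integral>s. expm b T \<omega> * (indicator {0..T} s * simple_val n ts \<xi> s \<omega>) \<partial>lborel)"
      by (intro Bochner_Integration.integral_cong) (auto simp: clip_def indicator_def)
    also have "\<dots> = expm b T \<omega> * (\<Sum>i<n. \<xi> i \<omega> * ?d i)"
      using has_bochner_integral_integral_eq[OF simple_val_integral[OF S T, of \<omega>]] by simp
    also have "\<dots> = (\<Sum>i<n. ?d i * (\<xi> i \<omega> * expm b T \<omega>))"
      by (simp add: sum_distrib_left mult_ac)
    finally show ?thesis .
  qed
  have "(\<integral>z. clip T (\<lambda>_. expm b T) z * clip T (simple_val n ts \<xi>) z \<partial>?P) = (\<integral>\<omega>. (\<Sum>i<n. ?d i * (\<xi> i \<omega> * expm b T \<omega>)) \<partial>M)"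
    using PL.integral_fst'[OF i] by (simp add: inner)
  then show "(\<integral>\<omega>. expm b T \<omega> * simple_stoch_int W n ts \<xi> T \<omega> \<partial>M) =
      b * (\<integral>z. clip T (\<lambda>_. expm b T) z * clip T (simple_val n ts \<xi>) z \<partial>?P)"
    using 1 2 unfolding eq by (simp add: has_bochner_integral_iff sum_distrib_left mult.assoc)
qed

text \<open>Both sides of \<open>simple_stoch_int_expm\<close> pass to the mean-square limit because
  the weight is square integrable. This takes the place of Girsanov's theorem: it says that the Ito
  integral has mean drift \<open>b * \<pi>\<close> under the weight.\<close>

lemma ito_integral_expm:
  assumes I: "ito_integral M F W \<pi> I" and p: "progressive M F \<pi>" and T: "0 \<le> T"
    and fin: "(\<integral>\<^sup>+z. ennreal ((clip T \<pi> z)\<^sup>2) \<partial>(M \<Otimes>\<^sub>M lborel)) < \<infinity>"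
  shows "integrable M (\<lambda>\<omega>. expm b T \<omega> * I T \<omega>)"
    and "integrable (M \<Otimes>\<^sub>M lborel) (\<lambda>z. clip T (\<lambda>_. expm b T) z * clip T \<pi> z)"
    and "(\<integral>\<omega>. expm b T \<omega> * I T \<omega> \<partial>M) = b * (\<integral>z. clip T (\<lambda>_. expm b T) z * clip T \<pi> z \<partial>(M \<Otimes>\<^sub>M lborel))"
proof -
  let ?P = "M \<Otimes>\<^sub>M lborel"
  have [measurable]: "expm b T \<in> borel_measurable M" "clip T (\<lambda>_. expm b T) \<in> borel_measurable ?P"
    "I T \<in> borel_measurable M" "clip T \<pi> \<in> borel_measurable ?P"
    using T I p by (auto intro: expm_M clip_expm ito_integral_measurable progressive_clip)
  have "(\<integral>\<^sup>+\<omega>. ennreal ((I T \<omega>)\<^sup>2) \<partial>M) < \<infinity>"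
    using ito_integral_square_bound[OF I p T] fin by (auto simp: ennreal_mult_less_top intro: le_less_trans)
  then have "integrable M (\<lambda>\<omega>. (I T \<omega>)\<^sup>2)" by (intro integrableI_bounded) auto
  then show i1: "integrable M (\<lambda>\<omega>. expm b T \<omega> * I T \<omega>)"
    using integrable_expm_square[OF T] by (intro integrable_mult_square_integrable) auto
  have "integrable ?P (\<lambda>z. (clip T \<pi> z)\<^sup>2)" using fin by (intro integrable_clip_square) auto
  moreover have "integrable ?P (\<lambda>z. (clip T (\<lambda>_. expm b T) z)\<^sup>2)"
    using clip_expm[OF T, of b] by (intro integrable_clip_square) simp_all
  ultimately show i2: "integrable ?P (\<lambda>z. clip T (\<lambda>_. expm b T) z * clip T \<pi> z)"
    by (intro integrable_mult_square_integrable) auto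
  obtain N TS \<Xi> where S: "\<And>j. simple_adapted M F (N j) (TS j) (\<Xi> j)"
    and 1: "(\<lambda>j. \<integral>\<^sup>+z. ennreal ((clip T (simple_val (N j) (TS j) (\<Xi> j)) z - clip T \<pi> z)\<^sup>2) \<partial>?P) \<longlonglongrightarrow> 0"
    and 2: "(\<lambda>j. \<integral>\<^sup>+\<omega>. ennreal ((I T \<omega> - simple_stoch_int W (N j) (TS j) (\<Xi> j) T \<omega>)\<^sup>2) \<partial>M) \<longlonglongrightarrow> 0"
    by (rule ito_integral_approx[OF I p T]) blast
  have l1: "(\<lambda>j. \<integral>\<omega>. expm b T \<omega> * simple_stoch_int W (N j) (TS j) (\<Xi> j) T \<omega> \<partial>M) \<longlonglongrightarrow> (\<integral>\<omega>. expm b T \<omega> * I T \<omega> \<partial>M)"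
    using 2 nn_integral_expm_square[OF T, of b]
    by (intro tendsto_integral_mult_L2 i1 simple_stoch_int_expm S T simple_stoch_int_measurable)
       (auto simp: power2_commute)
  have l2: "(\<lambda>j. \<integral>z. clip T (\<lambda>_. expm b T) z * clip T (simple_val (N j) (TS j) (\<Xi> j)) z \<partial>?P) \<longlonglongrightarrow> (\<integral>z. clip T (\<lambda>_. expm b T) z * clip T \<pi> z \<partial>?P)"
    using 1 clip_expm[OF T, of b]
    by (intro tendsto_integral_mult_L2 i2 simple_stoch_int_expm S T clip_simple_val) auto
  have "(\<lambda>j. \<integral>\<omega>. expm b T \<omega> * simple_stoch_int W (N j) (TS j) (\<Xi> j) T \<omega> \<partial>M) \<longlonglongrightarrow> b * (\<integral>z. clip T (\<lambda>_. expm b T) z * clip T \<pi> z \<partial>?P)"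
    unfolding simple_stoch_int_expm(3)[OF S T] by (intro tendsto_mult l2 tendsto_const)
  with l1 show "(\<integral>\<omega>. expm b T \<omega> * I T \<omega> \<partial>M) = b * (\<integral>z. clip T (\<lambda>_. expm b T) z * clip T \<pi> z \<partial>?P)"
    by (rule LIMSEQ_unique)
qed

end

section \<open>Linear integral inequalities\<close>

text \<open>An integrated form for merely measurable functions and an inequality that holds almost
  everywhere. Multiplying by \<open>exp (C * (T - s))\<close> and exchanging the order of
  integration reproduces the integral of \<open>f\<close> on the right with the weight lowered by
  one; subtracting leaves the unweighted integral of \<open>f\<close>.\<close>

lemma gronwall_nn:
  fixes f N :: "real \<Rightarrow> ennreal"
  assumes [measurable]: "f \<in> borel_measurable borel" "N \<in> borel_measurable borel"
    and C: "0 \<le> C" and T: "0 \<le> T"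
    and fin: "(\<integral>\<^sup>+s\<in>{0..T}. f s \<partial>lborel) < \<infinity>"
    and le: "AE s in lborel. s \<in> {0..T} \<longrightarrow> f s \<le> N s + ennreal C * (\<integral>\<^sup>+u\<in>{0..s}. f u \<partial>lborel)"
  shows "(\<integral>\<^sup>+s\<in>{0..T}. f s \<partial>lborel) \<le> ennreal (exp (C * T)) * (\<integral>\<^sup>+s\<in>{0..T}. N s \<partial>lborel)"
proof -
  \<comment> \<open>The weights satisfy \<open>w = 1 + v\<close>, and \<open>v u\<close> is the
    integral of \<open>C * w\<close> over \<open>{u..T}\<close>; these two identities drive the
    argument.\<close>
  define w where "w s = ennreal (exp (C * (T - s)))" for s
  define v where "v s = ennreal (exp (C * (T - s)) - 1)" for s
  have [measurable]: "w \<in> borel_measurable borel" "v \<in> borel_measurable borel"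
    unfolding w_def[abs_def] v_def[abs_def] by measurable
  have wv: "w s = 1 + v s" if "s \<in> {0..T}" for s
  proof -
    have "0 \<le> C * (T - s)" using that C by auto
    then have "1 \<le> exp (C * (T - s))" by simp
    then show ?thesis unfolding w_def v_def by (simp flip: ennreal_plus ennreal_1)
  qed
  have wle: "w s \<le> ennreal (exp (C * T))" if "s \<in> {0..T}" for s
    using that C unfolding w_def by (intro ennreal_leI) (auto intro: mult_left_mono)
  have vle: "v s \<le> ennreal (exp (C * T))" if "s \<in> {0..T}" for s
    by (rule order_trans[OF _ wle[OF that]]) (auto simp: v_def w_def intro!: ennreal_leI)
  have inner: "(\<integral>\<^sup>+s\<in>{u..T}. ennreal C * w s \<partial>lborel) = v u" if "u \<in> {0..T}" for u
  proof -
    have "(\<integral>\<^sup>+s. ennreal (C * exp (C * (T - s))) * indicator {u..T} s \<partial>lborel) = ennreal ((- exp (C * (T - T))) - (- exp (C * (T - u))))"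
      using that C by (intro nn_integral_FTC_Icc) (auto intro!: derivative_eq_intros)
    then show ?thesis using C by (simp add: w_def v_def ennreal_mult)
  qed
  have "(\<integral>\<^sup>+s\<in>{0..T}. f s \<partial>lborel) + (\<integral>\<^sup>+s\<in>{0..T}. v s * f s \<partial>lborel) = (\<integral>\<^sup>+s\<in>{0..T}. w s * f s \<partial>lborel)"
    by (subst nn_integral_add[symmetric]) (auto intro!: nn_integral_cong simp: wv distrib_right indicator_def)
  also have "\<dots> \<le> (\<integral>\<^sup>+s\<in>{0..T}. w s * N s \<partial>lborel) + (\<integral>\<^sup>+s\<in>{0..T}. w s * (ennreal C * (\<integral>\<^sup>+u\<in>{0..s}. f u \<partial>lborel)) \<partial>lborel)"
  proof (subst nn_integral_add[symmetric])
    have "Measurable.pred (borel \<Otimes>\<^sub>M lborel) (\<lambda>z. snd z \<in> {0..fst z::real})" unfolding atLeastAtMost_iff by measurable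
    then have [measurable]: "(\<lambda>s. \<integral>\<^sup>+u\<in>{0..s}. f u \<partial>lborel) \<in> borel_measurable borel" by measurable
    show "(\<lambda>s. w s * (ennreal C * (\<integral>\<^sup>+u\<in>{0..s}. f u \<partial>lborel)) * indicator {0..T} s) \<in> borel_measurable lborel" by measurable
    show "(\<integral>\<^sup>+s\<in>{0..T}. w s * f s \<partial>lborel) \<le> (\<integral>\<^sup>+s. w s * N s * indicator {0..T} s + w s * (ennreal C * (\<integral>\<^sup>+u\<in>{0..s}. f u \<partial>lborel)) * indicator {0..T} s \<partial>lborel)"
      using le by (intro nn_integral_mono_AE) (auto simp: indicator_def distrib_left[symmetric] intro!: mult_left_mono)
  qed measurable
  \<comment> \<open>Fubini on the triangle \<open>u \<le> s \<le> T\<close>: the inner integral of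
    \<open>C * w\<close> collapses to \<open>v\<close>.\<close>
  also have "(\<integral>\<^sup>+s\<in>{0..T}. w s * (ennreal C * (\<integral>\<^sup>+u\<in>{0..s}. f u \<partial>lborel)) \<partial>lborel) = (\<integral>\<^sup>+s\<in>{0..T}. v s * f s \<partial>lborel)"
  proof -
    have [measurable]: "Measurable.pred (borel \<Otimes>\<^sub>M borel) (\<lambda>z. snd z \<in> {0..fst z::real})"
      "Measurable.pred (borel \<Otimes>\<^sub>M borel) (\<lambda>z. fst z \<in> {0..snd z::real})" unfolding atLeastAtMost_iff by measurable
    have "(\<integral>\<^sup>+s\<in>{0..T}. w s * (ennreal C * (\<integral>\<^sup>+u\<in>{0..s}. f u \<partial>lborel)) \<partial>lborel)
      = (\<integral>\<^sup>+s. \<integral>\<^sup>+u. w s * ennreal C * indicator {0..T} s * (f u * indicator {0..s} u) \<partial>lborel \<partial>lborel)"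
      by (intro nn_integral_cong, subst nn_integral_cmult) (measurable, simp add: mult_ac)
    also have "\<dots> = (\<integral>\<^sup>+u. \<integral>\<^sup>+s. w s * ennreal C * indicator {0..T} s * (f u * indicator {0..s} u) \<partial>lborel \<partial>lborel)"
      by (rule lborel_pair.Fubini') measurable
    also have "\<dots> = (\<integral>\<^sup>+u\<in>{0..T}. v u * f u \<partial>lborel)"
    proof (rule nn_integral_cong)
      fix u :: real
      show "(\<integral>\<^sup>+s. w s * ennreal C * indicator {0..T} s * (f u * indicator {0..s} u) \<partial>lborel) = v u * f u * indicator {0..T} u"
      proof (cases "u \<in> {0..T}")
        case True
        then have "(\<integral>\<^sup>+s. w s * ennreal C * indicator {0..T} s * (f u * indicator {0..s} u) \<partial>lborel)
          = (\<integral>\<^sup>+s. (ennreal C * w s * indicator {u..T} s) * f u \<partial>lborel)"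
          by (intro nn_integral_cong) (auto simp: indicator_def mult_ac)
        also have "\<dots> = v u * f u" by (subst nn_integral_multc) (auto simp: inner[OF True])
        finally show ?thesis using True by simp
      next
        case False
        then have "(\<integral>\<^sup>+s. w s * ennreal C * indicator {0..T} s * (f u * indicator {0..s} u) \<partial>lborel) = (\<integral>\<^sup>+(s::real). 0 \<partial>lborel)"
          by (intro nn_integral_cong) (auto simp: indicator_def)
        then show ?thesis using False by simp
      qed
    qed
    finally show ?thesis .
  qed
  finally have "(\<integral>\<^sup>+s\<in>{0..T}. v s * f s \<partial>lborel) + (\<integral>\<^sup>+s\<in>{0..T}. f s \<partial>lborel)
     \<le> (\<integral>\<^sup>+s\<in>{0..T}. v s * f s \<partial>lborel) + (\<integral>\<^sup>+s\<in>{0..T}. w s * N s \<partial>lborel)" by (simp add: add.commute)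
  \<comment> \<open>Cancelling in the extended reals needs this finiteness; it comes from
    \<open>fin\<close> because \<open>v\<close> is bounded on \<open>{0..T}\<close>.\<close>
  moreover have "(\<integral>\<^sup>+s\<in>{0..T}. v s * f s \<partial>lborel) < top"
  proof -
    have "(\<integral>\<^sup>+s\<in>{0..T}. v s * f s \<partial>lborel) \<le> (\<integral>\<^sup>+s. ennreal (exp (C * T)) * (f s * indicator {0..T} s) \<partial>lborel)"
      using vle by (intro nn_integral_mono) (auto simp: indicator_def intro: mult_right_mono)
    also have "\<dots> < top" using fin by (simp add: nn_integral_cmult ennreal_mult_less_top)
    finally show ?thesis .
  qed
  ultimately have "(\<integral>\<^sup>+s\<in>{0..T}. f s \<partial>lborel) \<le> (\<integral>\<^sup>+s\<in>{0..T}. w s * N s \<partial>lborel)"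
    by (auto simp: ennreal_add_left_cancel_le)
  also have "\<dots> \<le> (\<integral>\<^sup>+s. ennreal (exp (C * T)) * (N s * indicator {0..T} s) \<partial>lborel)"
    using wle by (intro nn_integral_mono) (auto simp: indicator_def intro: mult_right_mono)
  also have "\<dots> = ennreal (exp (C * T)) * (\<integral>\<^sup>+s\<in>{0..T}. N s \<partial>lborel)" by (rule nn_integral_cmult) measurable
  finally show ?thesis .
qed

text \<open>Integration by parts for an antiderivative that is only an integral: exchange the order
  over \<open>s \<le> t \<le> T\<close> and integrate the discount factor explicitly.\<close>

lemma discount_by_parts:
  fixes k :: "real \<Rightarrow> real"
  assumes T: "0 \<le> T" and k: "integrable lborel (\<lambda>s. indicator {0..T} s * k s)"
  shows "(\<integral>t. indicator {0..T} t * (\<rho> * exp (- \<rho> * t) * (\<integral>s. indicator {0..t} s * k s \<partial>lborel)) \<partial>lborel)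
      = (\<integral>s. (exp (- \<rho> * s) - exp (- \<rho> * T)) * (indicator {0..T} s * k s) \<partial>lborel)"
proof -
  define k' where "k' s = indicator {0..T} s * k s" for s
  define q where "q t = indicator {0..T} t * (\<rho> * exp (- \<rho> * t))" for t
  have [measurable]: "k' \<in> borel_measurable borel" using k unfolding k'_def[abs_def] by simp
  have [measurable]: "q \<in> borel_measurable borel" unfolding q_def[abs_def] by measurable
  have [measurable]: "Measurable.pred (borel \<Otimes>\<^sub>M borel) (\<lambda>z. snd z \<in> {0..fst z::real})" unfolding atLeastAtMost_iff by measurable
  \<comment> \<open>A bound on \<open>q\<close> that is valid for either sign of \<rho>; later
    \<rho> is \<open>r - \<delta>\<close>, which can be negative.\<close>
  define B where "B = \<bar>\<rho>\<bar> * exp (\<bar>\<rho>\<bar> * T)"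
  have qB: "\<bar>q t\<bar> \<le> B * indicator {0..T} t" for t
  proof (cases "t \<in> {0..T}")
    case True
    have "- \<rho> * t \<le> \<bar>\<rho>\<bar> * t" using True by (intro mult_right_mono) auto
    also have "\<dots> \<le> \<bar>\<rho>\<bar> * T" using True by (intro mult_left_mono) auto
    finally have "exp (- \<rho> * t) \<le> exp (\<bar>\<rho>\<bar> * T)" by simp
    then show ?thesis using True by (auto simp: q_def B_def abs_mult intro: mult_left_mono)
  qed (simp add: q_def)
  define \<Phi> where "\<Phi> t s = q t * (indicator {0..t} s * k' s)" for t s
  have m: "case_prod \<Phi> \<in> borel_measurable (lborel \<Otimes>\<^sub>M lborel)"
    unfolding \<Phi>_def[abs_def] by measurable
  have int: "integrable (lborel \<Otimes>\<^sub>M lborel) (case_prod \<Phi>)"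
  proof (rule integrableI_bounded[OF m])
    have "(\<integral>\<^sup>+z. ennreal (norm (case_prod \<Phi> z)) \<partial>(lborel \<Otimes>\<^sub>M lborel)) = (\<integral>\<^sup>+t. \<integral>\<^sup>+s. ennreal (norm (\<Phi> t s)) \<partial>lborel \<partial>lborel)"
      using m by (subst lborel.nn_integral_fst[symmetric]) auto
    also have "\<dots> \<le> (\<integral>\<^sup>+t. \<integral>\<^sup>+s. ennreal (B * indicator {0..T} t) * ennreal \<bar>k' s\<bar> \<partial>lborel \<partial>lborel)"
    proof (intro nn_integral_mono)
      fix t s :: real
      have "norm (\<Phi> t s) \<le> (B * indicator {0..T} t) * \<bar>k' s\<bar>"
        unfolding \<Phi>_def real_norm_def abs_mult by (intro mult_mono qB) (auto simp: indicator_def B_def)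
      then show "ennreal (norm (\<Phi> t s)) \<le> ennreal (B * indicator {0..T} t) * ennreal \<bar>k' s\<bar>"
        by (subst ennreal_mult[symmetric]) (auto simp: B_def)
    qed
    also have "\<dots> = (\<integral>\<^sup>+t. ennreal B * indicator {0..T} t \<partial>lborel) * (\<integral>\<^sup>+s. ennreal \<bar>k' s\<bar> \<partial>lborel)"
      by (simp add: nn_integral_cmult nn_integral_multc ennreal_mult'' ennreal_indicator)
    also have "\<dots> < \<infinity>"
      using k T unfolding k'_def[abs_def] integrable_iff_bounded
      by (simp add: nn_integral_cmult_indicator ennreal_mult_less_top)
    finally show "(\<integral>\<^sup>+z. ennreal (norm (case_prod \<Phi> z)) \<partial>(lborel \<Otimes>\<^sub>M lborel)) < \<infinity>" .
  qed
  have "(\<integral>t. indicator {0..T} t * (\<rho> * exp (- \<rho> * t) * (\<integral>s. indicator {0..t} s * k s \<partial>lborel)) \<partial>lborel) = (\<integral>t. \<integral>s. \<Phi> t s \<partial>lborel \<partial>lborel)"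
  proof (rule Bochner_Integration.integral_cong[OF refl])
    fix t :: real
    have "(\<integral>s. \<Phi> t s \<partial>lborel) = q t * (\<integral>s. indicator {0..t} s * k' s \<partial>lborel)" by (simp add: \<Phi>_def)
    also have "\<dots> = q t * (\<integral>s. indicator {0..t} s * k s \<partial>lborel)"
    proof (cases "t \<in> {0..T}")
      case True
      then have "(\<integral>s. indicator {0..t} s * k' s \<partial>lborel) = (\<integral>s. indicator {0..t} s * k s \<partial>lborel)"
        by (intro Bochner_Integration.integral_cong) (auto simp: k'_def indicator_def)
      then show ?thesis by simp
    qed (simp add: q_def)
    finally show "indicator {0..T} t * (\<rho> * exp (- \<rho> * t) * (\<integral>s. indicator {0..t} s * k s \<partial>lborel)) = (\<integral>s. \<Phi> t s \<partial>lborel)"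
      by (simp add: q_def)
  qed
  also have "\<dots> = (\<integral>s. \<integral>t. \<Phi> t s \<partial>lborel \<partial>lborel)"
    by (rule lborel_pair.Fubini_integral[OF int, symmetric])
  also have "\<dots> = (\<integral>s. (exp (- \<rho> * s) - exp (- \<rho> * T)) * (indicator {0..T} s * k s) \<partial>lborel)"
  proof (rule Bochner_Integration.integral_cong[OF refl])
    fix s :: real
    show "(\<integral>t. \<Phi> t s \<partial>lborel) = (exp (- \<rho> * s) - exp (- \<rho> * T)) * (indicator {0..T} s * k s)"
    proof (cases "s \<in> {0..T}")
      case True
      have "has_bochner_integral lborel (\<lambda>t. \<rho> * exp (- \<rho> * t) * indicator {s..T} t) ((- exp (- \<rho> * T)) - (- exp (- \<rho> * s)))"
        using True by (intro has_bochner_integral_FTC_Icc_real) (auto intro!: derivative_eq_intros continuous_intros)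
      then have "(\<integral>t. \<rho> * exp (- \<rho> * t) * indicator {s..T} t * k s \<partial>lborel) = (exp (- \<rho> * s) - exp (- \<rho> * T)) * k s"
        by (simp add: has_bochner_integral_iff)
      moreover have "(\<integral>t. \<Phi> t s \<partial>lborel) = (\<integral>t. \<rho> * exp (- \<rho> * t) * indicator {s..T} t * k s \<partial>lborel)"
        using True by (intro Bochner_Integration.integral_cong) (auto simp: \<Phi>_def q_def k'_def indicator_def)
      ultimately show ?thesis using True by simp
    next
      case False
      then show ?thesis by (simp add: \<Phi>_def k'_def)
    qed
  qed
  finally show ?thesis .
qed

text \<open>A finite integral means that \<open>f\<close> is finite almost everywhere, so passing to
  real values loses nothing. This allows subtraction in the discounting argument.\<close>

lemma nn_integral_enn2real_clip:
  fixes f :: "real \<Rightarrow> ennreal" and w :: "real \<Rightarrow> real"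
  assumes [measurable]: "f \<in> borel_measurable borel" "w \<in> borel_measurable borel"
    and fin: "(\<integral>\<^sup>+s\<in>{0..T}. f s \<partial>lborel) < \<infinity>" and w: "\<And>s. s \<in> {0..T} \<Longrightarrow> 0 \<le> w s \<and> w s \<le> B"
  shows "integrable lborel (\<lambda>s. w s * (indicator {0..T} s * enn2real (f s)))"
    and "(\<integral>\<^sup>+s\<in>{0..T}. ennreal (w s) * f s \<partial>lborel) = ennreal (\<integral>s. w s * (indicator {0..T} s * enn2real (f s)) \<partial>lborel)"
proof -
  have "AE s in lborel. f s * indicator {0..T} s \<noteq> \<infinity>"
    using fin by (intro nn_integral_PInf_AE) auto
  then have eq: "(\<integral>\<^sup>+s\<in>{0..T}. ennreal (w s) * f s \<partial>lborel) = (\<integral>\<^sup>+s. ennreal (w s * (indicator {0..T} s * enn2real (f s))) \<partial>lborel)"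
  proof (intro nn_integral_cong_AE, eventually_elim)
    case (elim s)
    then show "ennreal (w s) * f s * indicator {0..T} s = ennreal (w s * (indicator {0..T} s * enn2real (f s)))"
      using w[of s] by (auto simp: indicator_def ennreal_mult less_top split: if_splits)
  qed
  have "(\<integral>\<^sup>+s\<in>{0..T}. ennreal (w s) * f s \<partial>lborel) \<le> (\<integral>\<^sup>+s. ennreal B * (f s * indicator {0..T} s) \<partial>lborel)"
    using w by (intro nn_integral_mono) (auto simp: indicator_def intro!: mult_right_mono ennreal_leI)
  also have "\<dots> < \<infinity>" using fin by (simp add: nn_integral_cmult ennreal_mult_less_top)
  finally have lt: "(\<integral>\<^sup>+s\<in>{0..T}. ennreal (w s) * f s \<partial>lborel) < \<infinity>" .
  have nn: "0 \<le> w s * (indicator {0..T} s * enn2real (f s))" for s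
    using w[of s] by (auto simp: indicator_def)
  show i: "integrable lborel (\<lambda>s. w s * (indicator {0..T} s * enn2real (f s)))"
    using lt nn unfolding eq by (intro integrableI_bounded) (auto simp: abs_of_nonneg)
  show "(\<integral>\<^sup>+s\<in>{0..T}. ennreal (w s) * f s \<partial>lborel) = ennreal (\<integral>s. w s * (indicator {0..T} s * enn2real (f s)) \<partial>lborel)"
    unfolding eq using i nn by (intro nn_integral_eq_integral) auto
qed

text \<open>\<open>g\<close> and \<open>h\<close> stand for the tilted means of wealth and
  consumption. Formally \<open>exp (- \<rho> * t) * g t\<close> with
  \<open>\<rho> = r - \<delta>\<close> has derivative
  \<open>exp (- \<rho> * t) * (\<delta> * g t - h t)\<close>; integrating and dropping the
  nonnegative terminal value gives the claim. Discounting at \<open>r - \<delta>\<close> instead of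
  \<open>r\<close> is what creates the credit \<delta> on wealth.\<close>

lemma discounted_budget:
  fixes g h :: "real \<Rightarrow> ennreal"
  assumes [measurable]: "g \<in> borel_measurable borel" "h \<in> borel_measurable borel"
    and nn: "0 \<le> x" "0 \<le> r" "0 \<le> \<delta>" "0 \<le> T"
    and fin: "(\<integral>\<^sup>+s\<in>{0..T}. g s \<partial>lborel) < \<infinity>"
    and eq: "\<And>t. t \<in> {0..T} \<Longrightarrow> g t + (\<integral>\<^sup>+s\<in>{0..t}. h s \<partial>lborel) = ennreal x + ennreal r * (\<integral>\<^sup>+s\<in>{0..t}. g s \<partial>lborel)"
  shows "(\<integral>\<^sup>+s\<in>{0..T}. ennreal (exp (- (r - \<delta>) * s)) * h s \<partial>lborel)
     \<le> ennreal x + ennreal \<delta> * (\<integral>\<^sup>+s\<in>{0..T}. ennreal (exp (- (r - \<delta>) * s)) * g s \<partial>lborel)"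
    and "(\<integral>\<^sup>+s\<in>{0..T}. ennreal (exp (- (r - \<delta>) * s)) * g s \<partial>lborel) < \<infinity>"
proof -
  define \<rho> where "\<rho> = r - \<delta>"
  have sub: "(\<integral>\<^sup>+s\<in>{0..t}. f s \<partial>lborel) \<le> (\<integral>\<^sup>+s\<in>{0..T}. f s \<partial>lborel)" if "t \<in> {0..T}" for f :: "real \<Rightarrow> ennreal" and t
    using that by (intro nn_integral_mono) (auto simp: indicator_def)
  have rhs: "ennreal x + ennreal r * (\<integral>\<^sup>+s\<in>{0..t}. g s \<partial>lborel) < \<infinity>" if "t \<in> {0..T}" for t
    using le_less_trans[OF sub[OF that] fin] by (simp add: ennreal_mult_less_top)
  have gfin: "g t < \<infinity>" and hfin': "(\<integral>\<^sup>+s\<in>{0..t}. h s \<partial>lborel) < \<infinity>" if "t \<in> {0..T}" for t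
    using rhs[OF that] unfolding eq[OF that, symmetric] by auto
  have hfin: "(\<integral>\<^sup>+s\<in>{0..T}. h s \<partial>lborel) < \<infinity>" using nn by (intro hfin') auto
  define g' where "g' s = enn2real (g s)" for s
  define h' where "h' s = enn2real (h s)" for s
  have [measurable]: "g' \<in> borel_measurable borel" "h' \<in> borel_measurable borel"
    unfolding g'_def[abs_def] h'_def[abs_def] by measurable
  define B where "B = exp (\<bar>\<rho>\<bar> * T)"
  have wB: "0 \<le> exp (- \<rho> * s) \<and> exp (- \<rho> * s) \<le> B" if "s \<in> {0..T}" for s
  proof -
    have "- \<rho> * s \<le> \<bar>\<rho>\<bar> * s" using that by (intro mult_right_mono) auto
    also have "\<dots> \<le> \<bar>\<rho>\<bar> * T" using that by (intro mult_left_mono) auto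
    finally show ?thesis by (simp add: B_def)
  qed
  have gt: "integrable lborel (\<lambda>s. indicator {0..t} s * g' s)" "(\<integral>\<^sup>+s\<in>{0..t}. g s \<partial>lborel) = ennreal (\<integral>s. indicator {0..t} s * g' s \<partial>lborel)"
    if "t \<in> {0..T}" for t
    using nn_integral_enn2real_clip[of g "\<lambda>_. 1" t 1] le_less_trans[OF sub[OF that] fin] by (auto simp: g'_def)
  have ht: "integrable lborel (\<lambda>s. indicator {0..t} s * h' s)" "(\<integral>\<^sup>+s\<in>{0..t}. h s \<partial>lborel) = ennreal (\<integral>s. indicator {0..t} s * h' s \<partial>lborel)"
    if "t \<in> {0..T}" for t
    using nn_integral_enn2real_clip[of h "\<lambda>_. 1" t 1] le_less_trans[OF sub[OF that] hfin] by (auto simp: h'_def)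
  note gw = nn_integral_enn2real_clip[of g "\<lambda>s. exp (- \<rho> * s)" T B, OF _ _ fin wB, folded g'_def]
  note hw = nn_integral_enn2real_clip[of h "\<lambda>s. exp (- \<rho> * s)" T B, OF _ _ hfin wB, folded h'_def]
  define k where "k s = r * g' s - h' s" for s
  have keq: "g' t = x + (\<integral>s. indicator {0..t} s * k s \<partial>lborel)" if t: "t \<in> {0..T}" for t
  proof -
    have 0: "0 \<le> (\<integral>s. indicator {0..t} s * g' s \<partial>lborel)" "0 \<le> (\<integral>s. indicator {0..t} s * h' s \<partial>lborel)"
      by (auto intro!: integral_nonneg_AE simp: g'_def h'_def)
    have "ennreal (g' t) = g t" using gfin[OF t] by (simp add: g'_def less_top)
    then have "ennreal (g' t + (\<integral>s. indicator {0..t} s * h' s \<partial>lborel)) = ennreal (x + r * (\<integral>s. indicator {0..t} s * g' s \<partial>lborel))"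
      using eq[OF t] 0 nn unfolding gt(2)[OF t] ht(2)[OF t] by (simp add: ennreal_plus ennreal_mult g'_def)
    then have "g' t + (\<integral>s. indicator {0..t} s * h' s \<partial>lborel) = x + r * (\<integral>s. indicator {0..t} s * g' s \<partial>lborel)"
      using 0 nn by (subst (asm) ennreal_inj) (auto simp: g'_def)
    moreover have "(\<integral>s. indicator {0..t} s * k s \<partial>lborel) = (\<integral>s. r * (indicator {0..t} s * g' s) - indicator {0..t} s * h' s \<partial>lborel)"
      by (simp add: k_def algebra_simps)
    ultimately show ?thesis using gt(1)[OF t] ht(1)[OF t] by simp
  qed
  have T: "T \<in> {0..T}" using nn by simp
  have kint: "integrable lborel (\<lambda>s. indicator {0..T} s * k s)"
  proof -
    have "integrable lborel (\<lambda>s. r * (indicator {0..T} s * g' s) - indicator {0..T} s * h' s)"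
      using gt(1)[OF T] ht(1)[OF T] by auto
    then show ?thesis by (simp add: k_def algebra_simps)
  qed
  define Gw where "Gw = (\<integral>s. exp (- \<rho> * s) * (indicator {0..T} s * g' s) \<partial>lborel)"
  define Hw where "Hw = (\<integral>s. exp (- \<rho> * s) * (indicator {0..T} s * h' s) \<partial>lborel)"
  define KT where "KT = (\<integral>s. indicator {0..T} s * k s \<partial>lborel)"
  have i1: "has_bochner_integral lborel (\<lambda>t. \<rho> * exp (- \<rho> * t) * indicator {0..T} t) ((- exp (- \<rho> * T)) - (- exp (- \<rho> * 0)))"
    using nn by (intro has_bochner_integral_FTC_Icc_real) (auto intro!: derivative_eq_intros continuous_intros)
  have kw: "integrable lborel (\<lambda>s. exp (- \<rho> * s) * (indicator {0..T} s * k s))"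
    "(\<integral>s. exp (- \<rho> * s) * (indicator {0..T} s * k s) \<partial>lborel) = r * Gw - Hw"
  proof -
    have e: "(\<lambda>s. exp (- \<rho> * s) * (indicator {0..T} s * k s)) =
      (\<lambda>s. r * (exp (- \<rho> * s) * (indicator {0..T} s * g' s)) - exp (- \<rho> * s) * (indicator {0..T} s * h' s))"
      by (auto simp: k_def algebra_simps)
    show "integrable lborel (\<lambda>s. exp (- \<rho> * s) * (indicator {0..T} s * k s))"
      "(\<integral>s. exp (- \<rho> * s) * (indicator {0..T} s * k s) \<partial>lborel) = r * Gw - Hw"
      unfolding e Gw_def Hw_def using gw(1) hw(1) by simp_all
  qed
  \<comment> \<open>Starting from \<open>\<rho> * Gw\<close> avoids a division, so \<rho> = 0 needs
    no separate treatment. Solving for \<open>Hw\<close> leaves the coefficient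
    \<open>r - \<rho> = \<delta>\<close> on \<open>Gw\<close>.\<close>
  have "\<rho> * Gw = (\<integral>t. \<rho> * (exp (- \<rho> * t) * (indicator {0..T} t * g' t)) \<partial>lborel)" unfolding Gw_def by simp
  also have "\<dots> = (\<integral>t. \<rho> * (exp (- \<rho> * t) * (indicator {0..T} t * g' t)) - x * (\<rho> * exp (- \<rho> * t) * indicator {0..T} t) \<partial>lborel) + x * (1 - exp (- \<rho> * T))"
    using i1 gw(1) by (simp add: has_bochner_integral_iff)
  also have "(\<integral>t. \<rho> * (exp (- \<rho> * t) * (indicator {0..T} t * g' t)) - x * (\<rho> * exp (- \<rho> * t) * indicator {0..T} t) \<partial>lborel)
    = (\<integral>t. indicator {0..T} t * (\<rho> * exp (- \<rho> * t) * (\<integral>s. indicator {0..t} s * k s \<partial>lborel)) \<partial>lborel)"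
    by (rule Bochner_Integration.integral_cong[OF refl]) (auto simp: indicator_def keq algebra_simps)
  also have "\<dots> = (\<integral>s. (exp (- \<rho> * s) - exp (- \<rho> * T)) * (indicator {0..T} s * k s) \<partial>lborel)"
    using nn kint by (intro discount_by_parts) auto
  also have "\<dots> = r * Gw - Hw - exp (- \<rho> * T) * KT"
    using kw kint by (simp add: left_diff_distrib KT_def)
  finally have "Hw = x - exp (- \<rho> * T) * (x + KT) + \<delta> * Gw"
    by (simp add: \<rho>_def algebra_simps)
  \<comment> \<open>\<open>x + KT\<close> is the terminal value \<open>g' T\<close>; discarding it
    turns the identity into the inequality.\<close>
  moreover have "0 \<le> x + KT" unfolding KT_def keq[OF T, symmetric] g'_def by simp
  ultimately have "Hw \<le> x + \<delta> * Gw" by simp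
  moreover have "0 \<le> Gw" unfolding Gw_def by (auto intro!: integral_nonneg_AE simp: g'_def)
  ultimately have "ennreal Hw \<le> ennreal x + ennreal \<delta> * ennreal Gw"
    using nn by (simp add: ennreal_leI flip: ennreal_plus ennreal_mult)
  then show "(\<integral>\<^sup>+s\<in>{0..T}. ennreal (exp (- (r - \<delta>) * s)) * h s \<partial>lborel)
     \<le> ennreal x + ennreal \<delta> * (\<integral>\<^sup>+s\<in>{0..T}. ennreal (exp (- (r - \<delta>) * s)) * g s \<partial>lborel)"
    using gw(2) hw(2) unfolding Gw_def Hw_def \<rho>_def by simp
  show "(\<integral>\<^sup>+s\<in>{0..T}. ennreal (exp (- (r - \<delta>) * s)) * g s \<partial>lborel) < \<infinity>"
    using gw(2) unfolding \<rho>_def by simp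
qed

section \<open>The budget identity\<close>

context brownian
begin

text \<open>Admissibility gives sign conditions almost surely at each fixed time, with a null set
  that may depend on the time. Fubini converts this into a statement about almost every path at
  almost every time.\<close>

lemma AE_pair_from_sections:
  assumes "{z \<in> space (M \<Otimes>\<^sub>M lborel). Q z} \<in> sets (M \<Otimes>\<^sub>M lborel)" and "\<And>s. AE \<omega> in M. Q (\<omega>, s)"
  shows "AE \<omega> in M. AE s in lborel. Q (\<omega>, s)" "AE z in M \<Otimes>\<^sub>M lborel. Q z"
proof -
  have "(AE \<omega> in M. AE s in lborel. Q (\<omega>, s)) \<longleftrightarrow> (AE s in lborel. AE \<omega> in M. Q (\<omega>, s))"
    using assms(1) by (intro PL.AE_commute) simp
  then show 1: "AE \<omega> in M. AE s in lborel. Q (\<omega>, s)" using assms(2) by simp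
  show "AE z in M \<Otimes>\<^sub>M lborel. Q z" by (rule PL.AE_pair_measure[OF assms(1) 1])
qed

text \<open>The mean of the positive part of \<open>f s\<close> under the measure with density
  \<open>expm b s\<close>. The value 0 at negative times makes it a Borel function on the whole
  line.\<close>

definition tilted :: "real \<Rightarrow> (real \<Rightarrow> 'w \<Rightarrow> real) \<Rightarrow> real \<Rightarrow> ennreal" where
  "tilted b f s = (if 0 \<le> s then \<integral>\<^sup>+\<omega>. ennreal (f s \<omega>) * ennreal (expm b s \<omega>) \<partial>M else 0)"

lemma tilted_measurable:
  assumes "progressive M F f"
  shows "tilted b f \<in> borel_measurable borel"
proof -
  have [measurable]: "(\<lambda>z. if snd z \<in> {0..} then f (snd z) (fst z) else 0) \<in> borel_measurable (M \<Otimes>\<^sub>M lborel)"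
    "(\<lambda>z. if snd z \<in> {0..} then expm b (snd z) (fst z) else 0) \<in> borel_measurable (M \<Otimes>\<^sub>M lborel)"
    using assms progressive_expm by (auto intro!: progressive_joint' simp del: atLeast_iff)
  define q where "q z = ennreal (if snd z \<in> {0..} then f (snd z) (fst z) else 0) * ennreal (if snd z \<in> {0..} then expm b (snd z) (fst z) else 0)" for z
  have [measurable]: "q \<in> borel_measurable (M \<Otimes>\<^sub>M lborel)" unfolding q_def[abs_def] by measurable
  have "(\<lambda>s. \<integral>\<^sup>+\<omega>. q (\<omega>, s) \<partial>M) \<in> borel_measurable lborel"
    by (rule borel_measurable_nn_integral) measurable
  also have "(\<lambda>s. \<integral>\<^sup>+\<omega>. q (\<omega>, s) \<partial>M) = tilted b f"
    by (auto simp: q_def tilted_def)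
  finally show ?thesis by simp
qed

text \<open>Since \<open>f s\<close> is known at time \<open>s\<close>, the martingale property
  moves the weight from \<open>T\<close> back to \<open>s\<close>. One weight at the final time
  therefore serves the whole path integral.\<close>

lemma nn_integral_tilted:
  assumes f: "progressive M F f" and T: "0 \<le> T"
  shows "(\<integral>\<^sup>+\<omega>. ennreal (expm b T \<omega>) * (\<integral>\<^sup>+s. ennreal (clip T f (\<omega>, s)) \<partial>lborel) \<partial>M) = (\<integral>\<^sup>+s\<in>{0..T}. tilted b f s \<partial>lborel)"
proof -
  have [measurable]: "clip T f \<in> borel_measurable (M \<Otimes>\<^sub>M lborel)" "expm b T \<in> borel_measurable M"
    using f T by (auto intro: progressive_clip expm_M)
  have "(\<integral>\<^sup>+\<omega>. ennreal (expm b T \<omega>) * (\<integral>\<^sup>+s. ennreal (clip T f (\<omega>, s)) \<partial>lborel) \<partial>M)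
     = (\<integral>\<^sup>+\<omega>. \<integral>\<^sup>+s. ennreal (expm b T \<omega>) * ennreal (clip T f (\<omega>, s)) \<partial>lborel \<partial>M)"
    by (intro nn_integral_cong, subst nn_integral_cmult) (auto)
  also have "\<dots> = (\<integral>\<^sup>+s. \<integral>\<^sup>+\<omega>. ennreal (expm b T \<omega>) * ennreal (clip T f (\<omega>, s)) \<partial>M \<partial>lborel)"
    by (rule PL.Fubini'[symmetric]) measurable
  also have "\<dots> = (\<integral>\<^sup>+s\<in>{0..T}. tilted b f s \<partial>lborel)"
  proof (rule nn_integral_cong)
    fix s :: real
    show "(\<integral>\<^sup>+\<omega>. ennreal (expm b T \<omega>) * ennreal (clip T f (\<omega>, s)) \<partial>M) = tilted b f s * indicator {0..T} s"
    proof (cases "s \<in> {0..T}")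
      case True
      have "(\<lambda>\<omega>. ennreal (f s \<omega>)) \<in> borel_measurable (F s)"
        using progressive_section[OF f, of s] True by simp
      from nn_integral_expm[OF _ _ this, of T b] True show ?thesis
        by (simp add: clip_def tilted_def mult.commute)
    next
      case False
      then show ?thesis by (auto simp: clip_def)
    qed
  qed
  finally show ?thesis .
qed

lemma set_integral_clip:
  "set_integrable lborel {0..t} (\<lambda>s. f s \<omega>) \<longleftrightarrow> integrable lborel (\<lambda>s. clip t f (\<omega>, s))"
  "(LINT s:{0..t}|lborel. f s \<omega>) = (\<integral>s. clip t f (\<omega>, s) \<partial>lborel)"
proof -
  have "(\<lambda>s. indicator {0..t} s *\<^sub>R f s \<omega>) = (\<lambda>s. clip t f (\<omega>, s))" by (auto simp: clip_def indicator_def)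
  then show "set_integrable lborel {0..t} (\<lambda>s. f s \<omega>) \<longleftrightarrow> integrable lborel (\<lambda>s. clip t f (\<omega>, s))"
    "(LINT s:{0..t}|lborel. f s \<omega>) = (\<integral>s. clip t f (\<omega>, s) \<partial>lborel)"
    unfolding set_integrable_def set_lebesgue_integral_def by simp_all
qed

end

lemma ennreal_le_minus_add: "(a::ennreal) \<le> a - b + b"
  using ennreal_minus_le_iff[of a b "a - b"] by (simp add: add.commute)

text \<open>One admissible pair together with its wealth and Ito integral. Of the consumption
  constraint only the sign of \<open>c\<close> is recorded here; the lower bound proportional to
  wealth returns in the hypothesis \<open>constr\<close> of
  \<open>objective_dual_bound\<close>.\<close>

locale wealth = brownian M F W for M :: "'w measure" and F W +
  fixes r \<mu> \<sigma> x :: real and c \<pi> X I :: "real \<Rightarrow> 'w \<Rightarrow> real"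
  assumes r: "0 \<le> r" and \<mu>: "0 < \<mu>" and \<sigma>: "0 < \<sigma>" and x: "0 \<le> x"
    and prog: "progressive M F c" "progressive M F \<pi>" "progressive M F X"
    and ito: "ito_integral M F W \<pi> I"
    and weq: "wealth_eq M r \<mu> \<sigma> x c \<pi> X I"
    and fin: "\<And>t. 0 \<le> t \<Longrightarrow> (\<integral>\<^sup>+\<omega>. (\<integral>\<^sup>+s\<in>{0..t}. ennreal (c s \<omega> + (\<pi> s \<omega>)\<^sup>2) \<partial>lborel) \<partial>M) < \<infinity>"
    and nonneg: "\<And>t. 0 \<le> t \<Longrightarrow> AE \<omega> in M. 0 \<le> X t \<omega> \<and> 0 \<le> c t \<omega>"
begin

lemma clip_measurable: "0 \<le> T \<Longrightarrow> clip T c \<in> borel_measurable (M \<Otimes>\<^sub>M lborel)"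
  "0 \<le> T \<Longrightarrow> clip T \<pi> \<in> borel_measurable (M \<Otimes>\<^sub>M lborel)" "0 \<le> T \<Longrightarrow> clip T X \<in> borel_measurable (M \<Otimes>\<^sub>M lborel)"
  using prog by (auto intro: progressive_clip)

lemma clip_nonneg:
  assumes T: "0 \<le> T"
  shows "AE \<omega> in M. AE s in lborel. 0 \<le> clip T X (\<omega>, s) \<and> 0 \<le> clip T c (\<omega>, s)"
    "AE z in M \<Otimes>\<^sub>M lborel. 0 \<le> clip T X z \<and> 0 \<le> clip T c z"
proof -
  note clip_measurable[OF T, measurable]
  have 1: "{z \<in> space (M \<Otimes>\<^sub>M lborel). 0 \<le> clip T X z \<and> 0 \<le> clip T c z} \<in> sets (M \<Otimes>\<^sub>M lborel)" by measurable
  have 2: "AE \<omega> in M. 0 \<le> clip T X (\<omega>, s) \<and> 0 \<le> clip T c (\<omega>, s)" for s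
    using nonneg[of s] by (cases "s \<in> {0..T}") (auto simp: clip_def)
  show "AE \<omega> in M. AE s in lborel. 0 \<le> clip T X (\<omega>, s) \<and> 0 \<le> clip T c (\<omega>, s)"
    "AE z in M \<Otimes>\<^sub>M lborel. 0 \<le> clip T X z \<and> 0 \<le> clip T c z"
    using AE_pair_from_sections[OF 1 2] by auto
qed

lemma clip_integrable:
  assumes T: "0 \<le> T"
  shows "(\<integral>\<^sup>+z. ennreal ((clip T \<pi> z)\<^sup>2) \<partial>(M \<Otimes>\<^sub>M lborel)) < \<infinity>"
    "integrable (M \<Otimes>\<^sub>M lborel) (clip T c)" "integrable (M \<Otimes>\<^sub>M lborel) (clip T \<pi>)"
proof -
  let ?P = "M \<Otimes>\<^sub>M lborel"
  note clip_measurable[OF T, measurable]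
  have "(\<integral>\<^sup>+z. ennreal (clip T c z + (clip T \<pi> z)\<^sup>2) \<partial>?P) = (\<integral>\<^sup>+\<omega>. \<integral>\<^sup>+s. ennreal (clip T c (\<omega>, s) + (clip T \<pi> (\<omega>, s))\<^sup>2) \<partial>lborel \<partial>M)"
    by (subst lborel.nn_integral_fst) auto
  also have "\<dots> = (\<integral>\<^sup>+\<omega>. (\<integral>\<^sup>+s\<in>{0..T}. ennreal (c s \<omega> + (\<pi> s \<omega>)\<^sup>2) \<partial>lborel) \<partial>M)"
    by (intro nn_integral_cong) (auto simp: clip_def indicator_def)
  finally have S: "(\<integral>\<^sup>+z. ennreal (clip T c z + (clip T \<pi> z)\<^sup>2) \<partial>?P) < \<infinity>" using fin[OF T] by simp
  have "(\<integral>\<^sup>+z. ennreal ((clip T \<pi> z)\<^sup>2) \<partial>?P) \<le> (\<integral>\<^sup>+z. ennreal (clip T c z + (clip T \<pi> z)\<^sup>2) \<partial>?P)"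
    using clip_nonneg(2)[OF T] by (intro nn_integral_mono_AE) (auto intro: ennreal_leI)
  then show p: "(\<integral>\<^sup>+z. ennreal ((clip T \<pi> z)\<^sup>2) \<partial>?P) < \<infinity>" using S by (rule le_less_trans)
  have "(\<integral>\<^sup>+z. ennreal (norm (clip T c z)) \<partial>?P) \<le> (\<integral>\<^sup>+z. ennreal (clip T c z + (clip T \<pi> z)\<^sup>2) \<partial>?P)"
    using clip_nonneg(2)[OF T] by (intro nn_integral_mono_AE) (auto intro: ennreal_leI)
  then show "integrable ?P (clip T c)" using S by (intro integrableI_bounded) (auto intro: le_less_trans)
  show "integrable ?P (clip T \<pi>)" by (rule integrable_clip[OF T clip_measurable(2)[OF T] p])
qed

text \<open>The equation gives integrability of the whole drift only; as \<open>c\<close> and \<pi>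
  are integrable along almost every path, so is the remaining term. The factor \<open>r\<close>
  stays inside the integral because for \<open>r = 0\<close> nothing follows about \<open>X\<close>
  itself.\<close>

lemma wealth_path:
  assumes t: "0 \<le> t"
  shows "AE \<omega> in M. integrable lborel (\<lambda>s. r * clip t X (\<omega>, s)) \<and> integrable lborel (\<lambda>s. clip t c (\<omega>, s)) \<and>
    integrable lborel (\<lambda>s. clip t \<pi> (\<omega>, s)) \<and>
    X t \<omega> = x + (\<integral>s. r * clip t X (\<omega>, s) \<partial>lborel) - (\<integral>s. clip t c (\<omega>, s) \<partial>lborel) + \<mu> * (\<integral>s. clip t \<pi> (\<omega>, s) \<partial>lborel) + \<sigma> * I t \<omega>"
proof -
  let ?d = "\<lambda>s \<omega>. r * X s \<omega> - c s \<omega> + \<mu> * \<pi> s \<omega>"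
  have d: "clip t ?d z = r * clip t X z - clip t c z + \<mu> * clip t \<pi> z" for z by (simp add: clip_def)
  have "AE \<omega> in M. integrable lborel (\<lambda>s. clip t ?d (\<omega>, s)) \<and> X t \<omega> = x + (\<integral>s. clip t ?d (\<omega>, s) \<partial>lborel) + \<sigma> * I t \<omega>"
  proof -
    have e: "set_integrable lborel {0..t} (\<lambda>s. r * X s \<omega> - c s \<omega> + \<mu> * \<pi> s \<omega>) \<longleftrightarrow> integrable lborel (\<lambda>s. clip t ?d (\<omega>, s))"
      "(LINT s:{0..t}|lborel. r * X s \<omega> - c s \<omega> + \<mu> * \<pi> s \<omega>) = (\<integral>s. clip t ?d (\<omega>, s) \<partial>lborel)" for \<omega>
      by (rule set_integral_clip)+
    show ?thesis by (rule weq[unfolded wealth_eq_def, THEN spec, THEN mp, OF t, unfolded e])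
  qed
  moreover have "AE \<omega> in M. integrable lborel (\<lambda>s. clip t c (\<omega>, s))" "AE \<omega> in M. integrable lborel (\<lambda>s. clip t \<pi> (\<omega>, s))"
    using PL.AE_integrable_fst'[OF clip_integrable(2)[OF t]] PL.AE_integrable_fst'[OF clip_integrable(3)[OF t]] by auto
  ultimately show ?thesis
  proof eventually_elim
    case (elim \<omega>)
    have "integrable lborel (\<lambda>s. clip t ?d (\<omega>, s) + clip t c (\<omega>, s) - \<mu> * clip t \<pi> (\<omega>, s))" using elim by auto
    also have "(\<lambda>s. clip t ?d (\<omega>, s) + clip t c (\<omega>, s) - \<mu> * clip t \<pi> (\<omega>, s)) = (\<lambda>s. r * clip t X (\<omega>, s))" by (auto simp: d)
    finally have i: "integrable lborel (\<lambda>s. r * clip t X (\<omega>, s))" .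
    have "(\<integral>s. clip t ?d (\<omega>, s) \<partial>lborel) = (\<integral>s. r * clip t X (\<omega>, s) \<partial>lborel) - (\<integral>s. clip t c (\<omega>, s) \<partial>lborel) + \<mu> * (\<integral>s. clip t \<pi> (\<omega>, s) \<partial>lborel)"
      unfolding d using i elim(2,3) by simp
    then show ?case using i elim by auto
  qed
qed

text \<open>Dropping consumption, the wealth satisfies a linear inequality along each path, with a
  forcing term made of \<pi> and the Ito integral. Gronwall bounds its time integral by that of the
  forcing term, whose weighted mean is finite since \<pi> and the weight are square
  integrable.\<close>

lemma tilted_wealth_finite:
  assumes T: "0 \<le> T"
  shows "(\<integral>\<^sup>+\<omega>. ennreal (expm b T \<omega>) * (\<integral>\<^sup>+s. ennreal (clip T X (\<omega>, s)) \<partial>lborel) \<partial>M) < \<infinity>"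
proof -
  let ?P = "M \<Otimes>\<^sub>M lborel"
  note clip_measurable[OF T, measurable]
  have [measurable]: "expm b T \<in> borel_measurable M" using T by (rule expm_M)
  define A where "A \<omega> s = (\<integral>\<^sup>+u\<in>{0..s}. ennreal (clip T X (\<omega>, u)) \<partial>lborel)" for \<omega> s
  have [measurable]: "Measurable.pred (?P \<Otimes>\<^sub>M borel) (\<lambda>z. snd z \<in> {0..snd (fst z)::real})" unfolding atLeastAtMost_iff by measurable
  have [measurable]: "(\<lambda>z. A (fst z) (snd z)) \<in> borel_measurable ?P"
    unfolding A_def[abs_def] by measurable
  \<comment> \<open>The natural forcing term contains \<open>I s\<close>, which is not known to be
    measurable jointly in time and outcome. \<open>N\<close> is the truncated excess of
    \<open>X\<close> over \<open>r\<close> times its past integral: jointly measurable, good for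
    Gronwall along a path, and compared with \<open>n s\<close> only at fixed times.\<close>
  define N where "N \<omega> s = ennreal (clip T X (\<omega>, s)) - ennreal r * A \<omega> s" for \<omega> s
  have Nm [measurable]: "(\<lambda>z. N (fst z) (snd z)) \<in> borel_measurable ?P"
    unfolding N_def[abs_def] by measurable
  define n where "n s \<omega> = x + \<mu> * (\<integral>u. \<bar>clip T \<pi> (\<omega>, u)\<bar> \<partial>lborel) + \<sigma> * \<bar>I s \<omega>\<bar>" for s \<omega>
  have J: "ennreal r * A \<omega> s = ennreal (\<integral>u. r * clip s X (\<omega>, u) \<partial>lborel)" "0 \<le> (\<integral>u. r * clip s X (\<omega>, u) \<partial>lborel)"
    if s: "s \<in> {0..T}" and \<omega>: "\<omega> \<in> space M" and nn: "AE u in lborel. 0 \<le> clip T X (\<omega>, u)" and i: "integrable lborel (\<lambda>u. r * clip s X (\<omega>, u))" for s \<omega>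
  proof -
    have [measurable]: "(\<lambda>u. clip T X (\<omega>, u)) \<in> borel_measurable lborel" using \<omega> by measurable
    have nn': "AE u in lborel. 0 \<le> r * clip s X (\<omega>, u)"
      using nn by eventually_elim (use s r in \<open>auto simp: clip_def split: if_splits\<close>)
    have "ennreal r * A \<omega> s = (\<integral>\<^sup>+u. ennreal r * (ennreal (clip T X (\<omega>, u)) * indicator {0..s} u) \<partial>lborel)"
      unfolding A_def by (rule nn_integral_cmult[symmetric]) measurable
    also have "\<dots> = (\<integral>\<^sup>+u. ennreal (r * clip s X (\<omega>, u)) \<partial>lborel)"
      using s r by (intro nn_integral_cong) (auto simp: clip_def indicator_def ennreal_mult')
    also have "\<dots> = ennreal (\<integral>u. r * clip s X (\<omega>, u) \<partial>lborel)"
      using i nn' by (rule nn_integral_eq_integral)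
    finally show "ennreal r * A \<omega> s = ennreal (\<integral>u. r * clip s X (\<omega>, u) \<partial>lborel)" .
    show "0 \<le> (\<integral>u. r * clip s X (\<omega>, u) \<partial>lborel)" using nn' by (rule integral_nonneg_AE)
  qed
  have ip: "AE \<omega> in M. integrable lborel (\<lambda>u. clip T \<pi> (\<omega>, u))"
    using PL.AE_integrable_fst'[OF clip_integrable(3)[OF T]] .
  have Nle: "AE \<omega> in M. N \<omega> s \<le> ennreal (n s \<omega>)" if s: "s \<in> {0..T}" for s
  proof -
    have s0: "0 \<le> s" using s by simp
    show ?thesis
      using wealth_path[OF s0] clip_nonneg(1)[OF T] clip_nonneg(1)[OF s0] ip nonneg[OF s0] AE_space
    proof eventually_elim
      case (elim \<omega>)
      have nnu: "AE u in lborel. 0 \<le> clip T X (\<omega>, u)" using elim(2) by auto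
      note j = J[OF s elim(6) nnu conjunct1[OF elim(1)]]
      have n0: "0 \<le> n s \<omega>" using x \<mu> \<sigma> by (auto simp: n_def intro!: add_nonneg_nonneg mult_nonneg_nonneg integral_nonneg_AE)
      have c0: "0 \<le> (\<integral>u. clip s c (\<omega>, u) \<partial>lborel)" using elim(3) by (intro integral_nonneg_AE) auto
      have "(\<integral>u. clip s \<pi> (\<omega>, u) \<partial>lborel) \<le> (\<integral>u. \<bar>clip T \<pi> (\<omega>, u)\<bar> \<partial>lborel)"
        using elim(1,4) s by (intro integral_mono) (auto simp: clip_def)
      then have "\<mu> * (\<integral>u. clip s \<pi> (\<omega>, u) \<partial>lborel) \<le> \<mu> * (\<integral>u. \<bar>clip T \<pi> (\<omega>, u)\<bar> \<partial>lborel)"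
        using \<mu> by (intro mult_left_mono) auto
      moreover have "\<sigma> * I s \<omega> \<le> \<sigma> * \<bar>I s \<omega>\<bar>" using \<sigma> by (intro mult_left_mono) auto
      ultimately have "X s \<omega> \<le> (\<integral>u. r * clip s X (\<omega>, u) \<partial>lborel) + n s \<omega>"
        using elim(1) c0 unfolding n_def by linarith
      then have "ennreal (X s \<omega>) \<le> ennreal r * A \<omega> s + ennreal (n s \<omega>)"
        unfolding j(1) ennreal_plus[OF j(2) n0, symmetric] by (rule ennreal_leI)
      then show ?case
        using s by (auto simp: N_def clip_def ennreal_minus_le_iff)
    qed
  qed
  have gron: "AE \<omega> in M. (\<integral>\<^sup>+s. ennreal (clip T X (\<omega>, s)) \<partial>lborel) \<le> ennreal (exp (r * T)) * (\<integral>\<^sup>+s\<in>{0..T}. N \<omega> s \<partial>lborel)"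
    using wealth_path[OF T] clip_nonneg(1)[OF T] AE_space
  proof eventually_elim
    case (elim \<omega>)
    have [measurable]: "(\<lambda>u. clip T X (\<omega>, u)) \<in> borel_measurable borel" "N \<omega> \<in> borel_measurable borel"
      using elim(3) measurable_compose[OF measurable_Pair1'[OF elim(3), of lborel] Nm] by auto
    have clipT: "(\<integral>\<^sup>+s. ennreal (clip T X (\<omega>, s)) \<partial>lborel) = (\<integral>\<^sup>+s\<in>{0..T}. ennreal (clip T X (\<omega>, s)) \<partial>lborel)"
      by (intro nn_integral_cong) (auto simp: clip_def indicator_def)
    show ?case
    \<comment> \<open>For \<open>r = 0\<close> the wealth equation does not make \<open>A\<close>
      finite, as Gronwall would require; but then \<open>N\<close> is \<open>X\<close>
      itself.\<close>
    proof (cases "r = 0")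
      case True
      then show ?thesis unfolding clipT by (simp add: N_def)
    next
      case False
      then have r: "0 < r" using r by simp
      have nnu: "AE u in lborel. 0 \<le> clip T X (\<omega>, u)" using elim(2) by auto
      have "ennreal r * A \<omega> T < top"
        using J(1)[OF _ elim(3) nnu conjunct1[OF elim(1)]] T by simp
      then have "A \<omega> T < \<infinity>" using r by (auto simp: ennreal_mult_less_top)
      moreover have "ennreal (clip T X (\<omega>, s)) \<le> N \<omega> s + ennreal r * A \<omega> s" for s
        by (simp add: N_def ennreal_le_minus_add)
      ultimately show ?thesis
        unfolding clipT using r T by (intro gronwall_nn) (auto simp: A_def[symmetric])
    qed
  qed
  \<comment> \<open>\<open>C1\<close> collects the initial capital and the drift, \<open>C2\<close>
    the Ito integral through \<open>2 * a * b \<le> a * a + b * b\<close> and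
    \<open>ito_integral_square_bound\<close>. Their sum bounds the weighted mean of \<open>N\<close>
    uniformly in time.\<close>
  define C1 where "C1 = (\<integral>\<^sup>+\<omega>. ennreal (expm b T \<omega>) * ennreal (x + \<mu> * (\<integral>u. \<bar>clip T \<pi> (\<omega>, u)\<bar> \<partial>lborel)) \<partial>M)"
  define C2 where "C2 = (\<integral>\<^sup>+\<omega>. ennreal ((expm b T \<omega>)\<^sup>2) \<partial>M) + ennreal (\<sigma>\<^sup>2) * (9 * (\<integral>\<^sup>+z. ennreal ((clip T \<pi> z)\<^sup>2) \<partial>?P))"
  have C2: "C2 < \<infinity>"
    using clip_integrable(1)[OF T] nn_integral_expm_square[OF T, of b] by (auto simp: C2_def ennreal_mult_less_top)
  have pm [measurable]: "(\<lambda>\<omega>. \<integral>u. \<bar>clip T \<pi> (\<omega>, u)\<bar> \<partial>lborel) \<in> borel_measurable M" by measurable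
  have C1: "C1 < \<infinity>"
  proof -
    have i: "integrable ?P (\<lambda>z. \<bar>clip T (\<lambda>_. expm b T) z * clip T \<pi> z\<bar>)"
      using ito_integral_expm(2)[OF ito prog(2) T clip_integrable(1)[OF T], of b] by (rule integrable_abs)
    have eq: "(\<integral>u. \<bar>clip T (\<lambda>_. expm b T) (\<omega>, u) * clip T \<pi> (\<omega>, u)\<bar> \<partial>lborel) = expm b T \<omega> * (\<integral>u. \<bar>clip T \<pi> (\<omega>, u)\<bar> \<partial>lborel)" for \<omega>
      unfolding integral_mult_right_zero[symmetric]
      by (intro Bochner_Integration.integral_cong) (auto simp: clip_def abs_mult)
    have "integrable M (\<lambda>\<omega>. x * expm b T \<omega> + \<mu> * (expm b T \<omega> * (\<integral>u. \<bar>clip T \<pi> (\<omega>, u)\<bar> \<partial>lborel)))"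
      using PL.integrable_fst'[OF i] has_integral_expm_one[OF T, of b]
      unfolding eq by (auto simp: has_bochner_integral_iff)
    also have "(\<lambda>\<omega>. x * expm b T \<omega> + \<mu> * (expm b T \<omega> * (\<integral>u. \<bar>clip T \<pi> (\<omega>, u)\<bar> \<partial>lborel)))
      = (\<lambda>\<omega>. expm b T \<omega> * (x + \<mu> * (\<integral>u. \<bar>clip T \<pi> (\<omega>, u)\<bar> \<partial>lborel)))" by (auto simp: algebra_simps)
    finally have "integrable M (\<lambda>\<omega>. expm b T \<omega> * (x + \<mu> * (\<integral>u. \<bar>clip T \<pi> (\<omega>, u)\<bar> \<partial>lborel)))" .
    moreover have "0 \<le> expm b T \<omega> * (x + \<mu> * (\<integral>u. \<bar>clip T \<pi> (\<omega>, u)\<bar> \<partial>lborel))" for \<omega>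
      using x \<mu> by (auto intro!: mult_nonneg_nonneg add_nonneg_nonneg integral_nonneg_AE)
    ultimately show ?thesis
      unfolding C1_def integrable_iff_bounded by (simp add: ennreal_mult'[symmetric] abs_of_nonneg)
  qed
  have Cs: "(\<integral>\<^sup>+\<omega>. ennreal (expm b T \<omega>) * N \<omega> s \<partial>M) \<le> C1 + C2" if s: "s \<in> {0..T}" for s
  proof -
    have [measurable]: "I s \<in> borel_measurable M" using ito s by (auto intro: ito_integral_measurable)
    have "(\<integral>\<^sup>+\<omega>. ennreal (expm b T \<omega>) * N \<omega> s \<partial>M) \<le> (\<integral>\<^sup>+\<omega>. ennreal (expm b T \<omega>) * ennreal (x + \<mu> * (\<integral>u. \<bar>clip T \<pi> (\<omega>, u)\<bar> \<partial>lborel))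
        + (ennreal ((expm b T \<omega>)\<^sup>2) + ennreal (\<sigma>\<^sup>2) * ennreal ((I s \<omega>)\<^sup>2)) \<partial>M)"
      using Nle[OF s]
    proof (intro nn_integral_mono_AE, eventually_elim)
      case (elim \<omega>)
      have nn: "0 \<le> x + \<mu> * (\<integral>u. \<bar>clip T \<pi> (\<omega>, u)\<bar> \<partial>lborel)"
        using x \<mu> by (auto intro!: mult_nonneg_nonneg add_nonneg_nonneg integral_nonneg_AE)
      have "2 * (expm b T \<omega> * (\<sigma> * \<bar>I s \<omega>\<bar>)) \<le> (expm b T \<omega>)\<^sup>2 + (\<sigma> * \<bar>I s \<omega>\<bar>)\<^sup>2"
        using sum_squares_bound[of "expm b T \<omega>" "\<sigma> * \<bar>I s \<omega>\<bar>"] by (simp add: mult.assoc)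
      moreover have "0 \<le> expm b T \<omega> * (\<sigma> * \<bar>I s \<omega>\<bar>)" using \<sigma> by (auto intro!: mult_nonneg_nonneg)
      ultimately have 1: "expm b T \<omega> * (\<sigma> * \<bar>I s \<omega>\<bar>) \<le> (expm b T \<omega>)\<^sup>2 + \<sigma>\<^sup>2 * (I s \<omega>)\<^sup>2"
        by (simp add: power_mult_distrib)
      have "ennreal (expm b T \<omega>) * N \<omega> s \<le> ennreal (expm b T \<omega>) * ennreal (n s \<omega>)"
        using elim by (intro mult_left_mono) auto
      also have "\<dots> = ennreal (expm b T \<omega> * (x + \<mu> * (\<integral>u. \<bar>clip T \<pi> (\<omega>, u)\<bar> \<partial>lborel)) + expm b T \<omega> * (\<sigma> * \<bar>I s \<omega>\<bar>))"
        by (subst ennreal_mult'[symmetric]) (auto simp: n_def algebra_simps)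
      also have "\<dots> \<le> ennreal (expm b T \<omega> * (x + \<mu> * (\<integral>u. \<bar>clip T \<pi> (\<omega>, u)\<bar> \<partial>lborel)) + ((expm b T \<omega>)\<^sup>2 + \<sigma>\<^sup>2 * (I s \<omega>)\<^sup>2))"
        using 1 by (intro ennreal_leI) auto
      also have "\<dots> = ennreal (expm b T \<omega>) * ennreal (x + \<mu> * (\<integral>u. \<bar>clip T \<pi> (\<omega>, u)\<bar> \<partial>lborel))
        + (ennreal ((expm b T \<omega>)\<^sup>2) + ennreal (\<sigma>\<^sup>2) * ennreal ((I s \<omega>)\<^sup>2))"
        using nn by (simp add: ennreal_plus ennreal_mult)
      finally show ?case .
    qed
    also have "\<dots> = C1 + ((\<integral>\<^sup>+\<omega>. ennreal ((expm b T \<omega>)\<^sup>2) \<partial>M) + ennreal (\<sigma>\<^sup>2) * (\<integral>\<^sup>+\<omega>. ennreal ((I s \<omega>)\<^sup>2) \<partial>M))"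
      unfolding C1_def by (simp add: nn_integral_add nn_integral_cmult)
    also have "\<dots> \<le> C1 + C2"
    proof -
      have "(\<integral>\<^sup>+\<omega>. ennreal ((I s \<omega>)\<^sup>2) \<partial>M) \<le> 9 * (\<integral>\<^sup>+z. ennreal ((clip s \<pi> z)\<^sup>2) \<partial>?P)"
        using s by (intro ito_integral_square_bound[OF ito prog(2)]) auto
      also have "\<dots> \<le> 9 * (\<integral>\<^sup>+z. ennreal ((clip T \<pi> z)\<^sup>2) \<partial>?P)"
        using s by (intro mult_left_mono nn_integral_mono) (auto simp: clip_def)
      finally show ?thesis unfolding C2_def by (intro add_left_mono mult_left_mono) auto
    qed
    finally show ?thesis .
  qed
  have "(\<integral>\<^sup>+\<omega>. ennreal (expm b T \<omega>) * (\<integral>\<^sup>+s. ennreal (clip T X (\<omega>, s)) \<partial>lborel) \<partial>M)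
     \<le> (\<integral>\<^sup>+\<omega>. ennreal (expm b T \<omega>) * (ennreal (exp (r * T)) * (\<integral>\<^sup>+s\<in>{0..T}. N \<omega> s \<partial>lborel)) \<partial>M)"
    using gron by (intro nn_integral_mono_AE, eventually_elim) (rule mult_left_mono, auto)
  also have "\<dots> = (\<integral>\<^sup>+\<omega>. \<integral>\<^sup>+s. ennreal (exp (r * T)) * (ennreal (expm b T \<omega>) * N \<omega> s * indicator {0..T} s) \<partial>lborel \<partial>M)"
  proof (rule nn_integral_cong)
    fix \<omega> assume "\<omega> \<in> space M"
    then have [measurable]: "N \<omega> \<in> borel_measurable borel"
      using measurable_compose[OF measurable_Pair1'[of \<omega> M lborel] Nm] by auto
    have "(\<integral>\<^sup>+s. ennreal (exp (r * T)) * (ennreal (expm b T \<omega>) * N \<omega> s * indicator {0..T} s) \<partial>lborel)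
       = (\<integral>\<^sup>+s. ennreal (expm b T \<omega>) * ennreal (exp (r * T)) * (N \<omega> s * indicator {0..T} s) \<partial>lborel)"
      by (simp add: mult_ac)
    also have "\<dots> = ennreal (expm b T \<omega>) * ennreal (exp (r * T)) * (\<integral>\<^sup>+s\<in>{0..T}. N \<omega> s \<partial>lborel)"
      by (rule nn_integral_cmult) measurable
    finally show "ennreal (expm b T \<omega>) * (ennreal (exp (r * T)) * (\<integral>\<^sup>+s\<in>{0..T}. N \<omega> s \<partial>lborel)) =
       (\<integral>\<^sup>+s. ennreal (exp (r * T)) * (ennreal (expm b T \<omega>) * N \<omega> s * indicator {0..T} s) \<partial>lborel)" by (simp add: mult_ac)
  qed
  \<comment> \<open>Time is brought outside, because the bound of \<open>N\<close> by
    \<open>n\<close> holds almost surely for each fixed \<open>s\<close> only.\<close>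
  also have "\<dots> = (\<integral>\<^sup>+s. \<integral>\<^sup>+\<omega>. ennreal (exp (r * T)) * (ennreal (expm b T \<omega>) * N \<omega> s * indicator {0..T} s) \<partial>M \<partial>lborel)"
  proof (rule PL.Fubini'[symmetric])
    have "(\<lambda>z. ennreal (exp (r * T)) * (ennreal (expm b T (fst z)) * N (fst z) (snd z) * indicator {0..T} (snd z))) \<in> borel_measurable ?P"
      by measurable
    then show "(\<lambda>(\<omega>, s). ennreal (exp (r * T)) * (ennreal (expm b T \<omega>) * N \<omega> s * indicator {0..T} s)) \<in> borel_measurable ?P"
      by (simp add: case_prod_beta')
  qed
  also have "\<dots> \<le> (\<integral>\<^sup>+s. ennreal (exp (r * T)) * (C1 + C2) * indicator {0..T} s \<partial>lborel)"
  proof (rule nn_integral_mono)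
    fix s :: real
    have [measurable]: "(\<lambda>\<omega>. N \<omega> s) \<in> borel_measurable M"
      using measurable_compose[OF measurable_Pair2'[of s lborel M] Nm] by auto
    show "(\<integral>\<^sup>+\<omega>. ennreal (exp (r * T)) * (ennreal (expm b T \<omega>) * N \<omega> s * indicator {0..T} s) \<partial>M) \<le> ennreal (exp (r * T)) * (C1 + C2) * indicator {0..T} s"
    proof (cases "s \<in> {0..T}")
      case True
      have "(\<integral>\<^sup>+\<omega>. ennreal (exp (r * T)) * (ennreal (expm b T \<omega>) * N \<omega> s * indicator {0..T} s) \<partial>M) = ennreal (exp (r * T)) * (\<integral>\<^sup>+\<omega>. ennreal (expm b T \<omega>) * N \<omega> s \<partial>M)"
        using True by (simp add: nn_integral_cmult)
      also have "\<dots> \<le> ennreal (exp (r * T)) * (C1 + C2)" using Cs[OF True] by (intro mult_left_mono) auto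
      finally show ?thesis using True by simp
    qed simp
  qed
  also have "\<dots> < \<infinity>"
    using T C1 C2 by (simp add: nn_integral_cmult_indicator ennreal_mult_less_top)
  finally show ?thesis .
qed

end

section \<open>Duality: from the budget to a bound on the objective\<close>

lemma power_utility_fenchel:
  fixes c z p :: real
  assumes p: "0 < p" "p < 1" and c: "0 \<le> c" and z: "0 < z"
  shows "c powr p / p \<le> z * c + (1 - p) / p * z powr (- (p / (1 - p)))"
proof -
  \<comment> \<open>The maximiser of \<open>c powr p / p - z * c\<close>; the constant in the
    statement is the value of this expression there.\<close>
  define a where "a = z powr (- (1 / (1 - p)))"
  have a: "0 < a" using z by (simp add: a_def)
  have ap: "a powr p = z powr (- (p / (1 - p)))" by (simp add: a_def powr_powr)
  have za: "z * a = a powr p"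
  proof -
    have "z * a = z powr (1 + - (1 / (1 - p)))" using z by (simp add: a_def powr_add powr_one del: add_uminus_conv_diff)
    also have "1 + - (1 / (1 - p)) = - (p / (1 - p))" using p by (simp add: field_simps)
    finally show ?thesis by (simp add: ap)
  qed
  show ?thesis
  proof (cases "c = 0")
    case True
    then show ?thesis using p by simp
  next
    case False
    then have c: "0 < c" using c by simp
    \<comment> \<open>Weighted arithmetic-geometric mean of \<open>c / a\<close> and 1: concavity of
      the power, normalised at the maximiser.\<close>
    have "(c / a) powr p * 1 powr (1 - p) \<le> p * (c / a) + (1 - p) * 1"
      using p c a by (intro Youngs_inequality_0) auto
    then have "c powr p / a powr p \<le> p * (c / a) + (1 - p)" using c a by (simp add: powr_divide)
    then have "c powr p \<le> (p * (c / a) + (1 - p)) * a powr p"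
      using a by (simp add: pos_divide_le_eq)
    also have "\<dots> = p * (c / a) * (z * a) + (1 - p) * a powr p" by (simp add: za distrib_right)
    also have "\<dots> = p * (z * c) + (1 - p) * a powr p" using a by simp
    finally have "c powr p / p \<le> (p * (z * c) + (1 - p) * a powr p) / p" using p by (intro divide_right_mono) auto
    then show ?thesis using p by (simp add: add_divide_distrib ap)
  qed
qed

context wealth
begin

text \<open>Under the weight the Ito integral has drift \<open>b * \<pi>\<close>, and
  \<open>b = - (\<mu> / \<sigma>)\<close> is chosen so that \<sigma> times it cancels \<mu> * \<pi>.
  Consumption is moved to the left so that both sides are sums of nonnegative terms and hold in the
  extended reals.\<close>

lemma tilted_budget:
  assumes T: "0 \<le> T" and b: "b = - (\<mu> / \<sigma>)"
  shows "tilted b X T + (\<integral>\<^sup>+s\<in>{0..T}. tilted b c s \<partial>lborel) = ennreal x + ennreal r * (\<integral>\<^sup>+s\<in>{0..T}. tilted b X s \<partial>lborel)"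
proof -
  let ?P = "M \<Otimes>\<^sub>M lborel"
  note clip_measurable[OF T, measurable]
  have [measurable]: "expm b T \<in> borel_measurable M" "I T \<in> borel_measurable M" "X T \<in> borel_measurable M"
    using T ito prog by (auto intro: expm_M ito_integral_measurable progressive_section_M)
  define e where "e = expm b T"
  have e: "0 < e \<omega>" for \<omega> by (simp add: e_def)
  have [measurable]: "e \<in> borel_measurable M" by (simp add: e_def)
  define AX where "AX \<omega> = (\<integral>s. clip T X (\<omega>, s) \<partial>lborel)" for \<omega>
  define AC where "AC \<omega> = (\<integral>s. clip T c (\<omega>, s) \<partial>lborel)" for \<omega>
  define AP where "AP \<omega> = (\<integral>s. clip T \<pi> (\<omega>, s) \<partial>lborel)" for \<omega>
  have [measurable]: "AX \<in> borel_measurable M" "AC \<in> borel_measurable M" "AP \<in> borel_measurable M"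
    unfolding AX_def[abs_def] AC_def[abs_def] AP_def[abs_def] by measurable
  have finX: "(\<integral>\<^sup>+\<omega>. ennreal (e \<omega>) * (\<integral>\<^sup>+s. ennreal (clip T X (\<omega>, s)) \<partial>lborel) \<partial>M) < \<infinity>"
    unfolding e_def by (rule tilted_wealth_finite[OF T])
  \<comment> \<open>The weight is strictly positive, so a finite mean makes the path integral of
    \<open>X\<close> finite almost surely; this also covers \<open>r = 0\<close>.\<close>
  then have "AE \<omega> in M. ennreal (e \<omega>) * (\<integral>\<^sup>+s. ennreal (clip T X (\<omega>, s)) \<partial>lborel) \<noteq> \<infinity>"
    by (intro nn_integral_PInf_AE) auto
  then have iX: "AE \<omega> in M. integrable lborel (\<lambda>s. clip T X (\<omega>, s))"
    using clip_nonneg(1)[OF T] AE_space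
  proof eventually_elim
    case (elim \<omega>)
    have [measurable]: "(\<lambda>s. clip T X (\<omega>, s)) \<in> borel_measurable lborel" using elim(3) by measurable
    have "(\<integral>\<^sup>+s. ennreal (clip T X (\<omega>, s)) \<partial>lborel) < \<infinity>"
      using elim(1) e[of \<omega>] by (auto simp: ennreal_mult_eq_top_iff less_top)
    then show ?case using elim(2) by (intro integrableI_nonneg) auto
  qed
  have nnX: "AE \<omega> in M. (\<integral>\<^sup>+s. ennreal (clip T X (\<omega>, s)) \<partial>lborel) = ennreal (AX \<omega>) \<and> 0 \<le> AX \<omega>"
    using iX clip_nonneg(1)[OF T]
    by eventually_elim (auto simp: AX_def intro!: nn_integral_eq_integral integral_nonneg_AE)
  have iC: "AE \<omega> in M. integrable lborel (\<lambda>s. clip T c (\<omega>, s))"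
    using PL.AE_integrable_fst'[OF clip_integrable(2)[OF T]] .
  have nnC: "AE \<omega> in M. (\<integral>\<^sup>+s. ennreal (clip T c (\<omega>, s)) \<partial>lborel) = ennreal (AC \<omega>) \<and> 0 \<le> AC \<omega>"
    using iC clip_nonneg(1)[OF T]
    by eventually_elim (auto simp: AC_def intro!: nn_integral_eq_integral integral_nonneg_AE)
  have eqX: "(\<integral>\<^sup>+\<omega>. ennreal (e \<omega>) * (\<integral>\<^sup>+s. ennreal (clip T X (\<omega>, s)) \<partial>lborel) \<partial>M) = (\<integral>\<^sup>+\<omega>. ennreal (e \<omega> * AX \<omega>) \<partial>M)"
    using nnX by (intro nn_integral_cong_AE, eventually_elim) (auto simp: ennreal_mult' e less_imp_le)
  have nn: "AE \<omega> in M. 0 \<le> e \<omega> * AX \<omega>" using nnX by eventually_elim (auto simp: e less_imp_le)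
  have ieX: "integrable M (\<lambda>\<omega>. e \<omega> * AX \<omega>)"
    using finX nn unfolding eqX by (intro integrableI_nonneg) auto
  have eX: "(\<integral>\<^sup>+\<omega>. ennreal (e \<omega> * AX \<omega>) \<partial>M) = ennreal (\<integral>\<omega>. e \<omega> * AX \<omega> \<partial>M)" "0 \<le> (\<integral>\<omega>. e \<omega> * AX \<omega> \<partial>M)"
    using ieX nn by (auto intro: nn_integral_eq_integral integral_nonneg_AE)
  define J where "J = (\<integral>z. clip T (\<lambda>_. e) z * clip T \<pi> z \<partial>?P)"
  note ie = ito_integral_expm[OF ito prog(2) T clip_integrable(1)[OF T], of b, folded e_def]
  have inner: "(\<integral>s. clip T (\<lambda>_. e) (\<omega>, s) * clip T \<pi> (\<omega>, s) \<partial>lborel) = e \<omega> * AP \<omega>" for \<omega>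
    unfolding AP_def integral_mult_right_zero[symmetric]
    by (intro Bochner_Integration.integral_cong) (auto simp: clip_def)
  have ieP: "integrable M (\<lambda>\<omega>. e \<omega> * AP \<omega>)" "(\<integral>\<omega>. e \<omega> * AP \<omega> \<partial>M) = J"
    using PL.integrable_fst'[OF ie(2)] PL.integral_fst'[OF ie(2)] unfolding inner J_def by auto
  define R where "R \<omega> = e \<omega> * x + r * (e \<omega> * AX \<omega>) + \<mu> * (e \<omega> * AP \<omega>) + \<sigma> * (e \<omega> * I T \<omega>)" for \<omega>
  have e1: "integrable M e" "(\<integral>\<omega>. e \<omega> \<partial>M) = 1"
    using has_integral_expm_one[OF T, of b] by (auto simp: e_def has_bochner_integral_iff)
  have R: "integrable M R" "(\<integral>\<omega>. R \<omega> \<partial>M) = x + r * (\<integral>\<omega>. e \<omega> * AX \<omega> \<partial>M)"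
  proof -
    show "integrable M R" unfolding R_def[abs_def] using e1 ieX ieP ie(1) by auto
    have "(\<integral>\<omega>. R \<omega> \<partial>M) = x + r * (\<integral>\<omega>. e \<omega> * AX \<omega> \<partial>M) + (\<mu> * J + \<sigma> * (b * J))"
      unfolding R_def[abs_def] using e1 ieX ieP ie(1) ie(3) by (simp add: J_def)
    \<comment> \<open>The market price of risk at work: this is the only place where the value of
      \<open>b\<close> matters.\<close>
    also have "\<mu> * J + \<sigma> * (b * J) = 0" using \<sigma> by (simp add: b)
    finally show "(\<integral>\<omega>. R \<omega> \<partial>M) = x + r * (\<integral>\<omega>. e \<omega> * AX \<omega> \<partial>M)" using \<sigma> by (simp add: b)
  qed
  have key: "AE \<omega> in M. ennreal (X T \<omega>) * ennreal (e \<omega>) + ennreal (e \<omega>) * (\<integral>\<^sup>+s. ennreal (clip T c (\<omega>, s)) \<partial>lborel) = ennreal (R \<omega>) \<and> 0 \<le> R \<omega>"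
    using wealth_path[OF T] nnC nonneg[OF T]
  proof eventually_elim
    case (elim \<omega>)
    have xt: "X T \<omega> = x + r * AX \<omega> - AC \<omega> + \<mu> * AP \<omega> + \<sigma> * I T \<omega>" using elim(1) by (simp add: AX_def AC_def AP_def)
    have "X T \<omega> * e \<omega> + e \<omega> * AC \<omega> = R \<omega>" unfolding xt R_def by (simp add: algebra_simps)
    moreover have "0 \<le> X T \<omega> * e \<omega>" "0 \<le> e \<omega> * AC \<omega>" using elim e[of \<omega>] by auto
    moreover have "ennreal (X T \<omega>) * ennreal (e \<omega>) + ennreal (e \<omega>) * ennreal (AC \<omega>) = ennreal (X T \<omega> * e \<omega> + e \<omega> * AC \<omega>)"
      using elim e[of \<omega>] by (simp add: ennreal_plus ennreal_mult)
    ultimately show ?case using elim by auto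
  qed
  have "tilted b X T + (\<integral>\<^sup>+s\<in>{0..T}. tilted b c s \<partial>lborel) =
     (\<integral>\<^sup>+\<omega>. ennreal (X T \<omega>) * ennreal (e \<omega>) \<partial>M) + (\<integral>\<^sup>+\<omega>. ennreal (e \<omega>) * (\<integral>\<^sup>+s. ennreal (clip T c (\<omega>, s)) \<partial>lborel) \<partial>M)"
    using T nn_integral_tilted[OF prog(1) T, of b] by (simp add: tilted_def e_def)
  also have "\<dots> = (\<integral>\<^sup>+\<omega>. ennreal (X T \<omega>) * ennreal (e \<omega>) + ennreal (e \<omega>) * (\<integral>\<^sup>+s. ennreal (clip T c (\<omega>, s)) \<partial>lborel) \<partial>M)"
    by (rule nn_integral_add[symmetric]) measurable
  also have "\<dots> = (\<integral>\<^sup>+\<omega>. ennreal (R \<omega>) \<partial>M)"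
    using key by (intro nn_integral_cong_AE) auto
  also have "\<dots> = ennreal (x + r * (\<integral>\<omega>. e \<omega> * AX \<omega> \<partial>M))"
    unfolding R(2)[symmetric] using R(1) key by (intro nn_integral_eq_integral) auto
  also have "\<dots> = ennreal x + ennreal r * ennreal (\<integral>\<omega>. e \<omega> * AX \<omega> \<partial>M)"
    using x r eX(2) by (simp add: ennreal_plus ennreal_mult)
  also have "ennreal (\<integral>\<omega>. e \<omega> * AX \<omega> \<partial>M) = (\<integral>\<^sup>+s\<in>{0..T}. tilted b X s \<partial>lborel)"
    using nn_integral_tilted[OF prog(3) T, of b] unfolding eX(1)[symmetric] eqX[symmetric] by (simp add: e_def)
  finally show ?thesis .
qed

lemma tilted_wealth_finite':
  "0 \<le> T \<Longrightarrow> (\<integral>\<^sup>+s\<in>{0..T}. tilted b X s \<partial>lborel) < \<infinity>"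
  using tilted_wealth_finite[of T b] nn_integral_tilted[OF prog(3), of T b] by simp

end

context brownian
begin

lemma objective_eq:
  assumes c: "progressive M F c"
  shows "objective M \<beta> p c = (\<integral>\<^sup>+t\<in>{0..}. (\<integral>\<^sup>+\<omega>. ennreal (exp (- \<beta> * t) * (c t \<omega> powr p / p)) \<partial>M) \<partial>lborel)"
    and "(\<lambda>t. (\<integral>\<^sup>+\<omega>. ennreal (exp (- \<beta> * t) * (c t \<omega> powr p / p)) \<partial>M) * indicator {0..} t) \<in> borel_measurable borel"
proof -
  let ?P = "M \<Otimes>\<^sub>M lborel"
  have [measurable]: "(\<lambda>z. if snd z \<in> {0..} then c (snd z) (fst z) else 0) \<in> borel_measurable ?P"
    by (rule progressive_joint'[OF c])
  define q where "q z = ennreal (exp (- \<beta> * snd z) * ((if snd z \<in> {0..} then c (snd z) (fst z) else 0) powr p / p)) * indicator {0..} (snd z)" for z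
  have [measurable]: "q \<in> borel_measurable ?P" unfolding q_def[abs_def] by measurable
  have q1: "ennreal (exp (- \<beta> * t) * (c t \<omega> powr p / p)) * indicator {0..} t = q (\<omega>, t)" for \<omega> t
    by (auto simp: q_def)
  have q2: "(\<integral>\<^sup>+\<omega>. ennreal (exp (- \<beta> * t) * (c t \<omega> powr p / p)) \<partial>M) * indicator {0..} t = (\<integral>\<^sup>+\<omega>. q (\<omega>, t) \<partial>M)" for t
    by (auto simp: q_def indicator_def)
  show "objective M \<beta> p c = (\<integral>\<^sup>+t\<in>{0..}. (\<integral>\<^sup>+\<omega>. ennreal (exp (- \<beta> * t) * (c t \<omega> powr p / p)) \<partial>M) \<partial>lborel)"
    unfolding objective_def q1 q2 by (rule PL.Fubini'[symmetric]) measurable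
  have "(\<lambda>t. \<integral>\<^sup>+\<omega>. q (\<omega>, t) \<partial>M) \<in> borel_measurable lborel"
    by (rule borel_measurable_nn_integral) measurable
  then show "(\<lambda>t. (\<integral>\<^sup>+\<omega>. ennreal (exp (- \<beta> * t) * (c t \<omega> powr p / p)) \<partial>M) * indicator {0..} t) \<in> borel_measurable borel"
    unfolding q2 by simp
qed

end

lemma nn_integral_atLeast_le:
  assumes [measurable]: "(\<lambda>t. f t * indicator {0..} t) \<in> borel_measurable borel"
    and le: "\<And>T. 0 \<le> T \<Longrightarrow> (\<integral>\<^sup>+t\<in>{0..T}. f t \<partial>lborel) \<le> (B::ennreal)"
  shows "(\<integral>\<^sup>+(t::real)\<in>{0..}. f t \<partial>lborel) \<le> B"
proof -
  define g where "g n t = f t * indicator {0..} t * indicator {0..real n} t" for n t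
  have [measurable]: "g n \<in> borel_measurable lborel" for n unfolding g_def[abs_def] by measurable
  have inc: "incseq g" by (auto simp: incseq_def le_fun_def g_def indicator_def)
  have "(SUP n. g n t) = f t * indicator {0..} t" for t
  proof (rule antisym)
    show "(SUP n. g n t) \<le> f t * indicator {0..} t" by (rule SUP_least) (auto simp: g_def indicator_def)
    obtain n :: nat where "t \<le> real n" using real_arch_simple by blast
    then have "f t * indicator {0..} t = g n t" by (auto simp: g_def indicator_def)
    then show "f t * indicator {0..} t \<le> (SUP n. g n t)" by (auto intro: SUP_upper2)
  qed
  then have "(\<integral>\<^sup>+t\<in>{0..}. f t \<partial>lborel) = (\<integral>\<^sup>+t. (SUP n. g n t) \<partial>lborel)" by simp
  also have "\<dots> = (SUP n. \<integral>\<^sup>+t. g n t \<partial>lborel)" by (rule nn_integral_monotone_convergence_SUP[OF inc]) measurable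
  also have "\<dots> \<le> B"
  proof (rule SUP_least)
    fix n
    have "(\<integral>\<^sup>+t. g n t \<partial>lborel) = (\<integral>\<^sup>+t\<in>{0..real n}. f t \<partial>lborel)"
      by (intro nn_integral_cong) (auto simp: g_def indicator_def)
    then show "(\<integral>\<^sup>+t. g n t \<partial>lborel) \<le> B" using le[of "real n"] by simp
  qed
  finally show ?thesis .
qed

lemma nn_integral_exp_Icc_le:
  assumes "0 < D" "0 \<le> T"
  shows "(\<integral>\<^sup>+s\<in>{0..T}. ennreal (exp (- D * s)) \<partial>lborel) \<le> ennreal (1 / D)"
proof -
  have "(\<integral>\<^sup>+s. ennreal (exp (- D * s)) * indicator {0..T} s \<partial>lborel) = ennreal (- exp (- D * T) / D - (- exp (- D * 0) / D))"
    using assms by (intro nn_integral_FTC_Icc) (auto intro!: derivative_eq_intros)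
  also have "\<dots> \<le> ennreal (1 / D)" using assms by (intro ennreal_leI) simp
  finally show ?thesis .
qed

context wealth
begin

text \<open>Weak duality with multiplier \<open>y\<close>. The wealth term with coefficient \<delta>
  is kept as an addend on the utility side, so that all integrals are of nonnegative functions;
  after the budget inequality it stands on both sides and cancels because it is finite.\<close>

lemma objective_dual_bound:
  assumes p: "0 < p" "p < 1" and K: "0 < K" and D: "0 < D" and \<delta>: "0 \<le> \<delta>" and y: "0 < y"
    and constr: "\<And>t. 0 \<le> t \<Longrightarrow> AE \<omega> in M. D / K * c t \<omega> \<le> c t \<omega> - \<delta> * X t \<omega>"
    and q: "q = p / (1 - p)"
    and expo: "\<beta> * (1 + q) - q * (r - \<delta>) - q * (1 + q) * (\<mu> / \<sigma>)\<^sup>2 / 2 = D"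
  shows "objective M \<beta> p c \<le> ennreal ((1 - p) / p * (y * D / K) powr (- q) / D + y * x)"
proof -
  define b where "b = - (\<mu> / \<sigma>)"
  define \<rho> where "\<rho> = r - \<delta>"
  define C where "C = (1 - p) / p * (y * D / K) powr (- q)"
  have C: "0 \<le> C" using p by (simp add: C_def)
  define u where "u t = (\<integral>\<^sup>+\<omega>. ennreal (exp (- \<beta> * t) * (c t \<omega> powr p / p)) \<partial>M)" for t
  have um [measurable]: "(\<lambda>t. u t * indicator {0..} t) \<in> borel_measurable borel"
    unfolding u_def by (rule objective_eq(2)[OF prog(1)])
  \<comment> \<open>Fenchel's inequality prices \<open>D / K * cc\<close> by the state price, and
    \<open>ccX\<close> replaces that charge by consumption minus the credit on wealth.\<close>
  have pt: "exp (- \<beta> * s) * (cc powr p / p) + y * \<delta> * exp (- \<rho> * s) * (XX * expm b s \<omega>)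
      \<le> y * exp (- \<rho> * s) * (cc * expm b s \<omega>) + C * exp (- D * s) * expm (- q * b) s \<omega>"
    if cc: "0 \<le> cc" and ccX: "D / K * cc \<le> cc - \<delta> * XX" for s cc XX \<omega>
  proof -
    \<comment> \<open>\<open>y\<close> times the state price; the Fenchel variable is
      \<open>\<zeta> * exp (\<beta> * s) * (D / K)\<close>, the factor
      \<open>exp (\<beta> * s)\<close> undoing the utility discount.\<close>
    define \<zeta> where "\<zeta> = y * exp (- \<rho> * s) * expm b s \<omega>"
    have \<zeta>: "0 < \<zeta>" using y by (simp add: \<zeta>_def)
    have "cc powr p / p \<le> \<zeta> * exp (\<beta> * s) * (D / K) * cc + (1 - p) / p * (\<zeta> * exp (\<beta> * s) * (D / K)) powr (- (p / (1 - p)))"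
      using p cc \<zeta> D K by (intro power_utility_fenchel) auto
    then have "exp (- \<beta> * s) * (cc powr p / p) \<le> exp (- \<beta> * s) * (\<zeta> * exp (\<beta> * s) * (D / K) * cc + (1 - p) / p * (\<zeta> * exp (\<beta> * s) * (D / K)) powr (- q))"
      unfolding q by (rule mult_left_mono) simp
    also have "\<dots> = (exp (- \<beta> * s) * exp (\<beta> * s)) * (\<zeta> * (D / K * cc)) + exp (- \<beta> * s) * ((1 - p) / p * (\<zeta> * exp (\<beta> * s) * (D / K)) powr (- q))"
      by (simp add: algebra_simps)
    also have "exp (- \<beta> * s) * exp (\<beta> * s) = 1" by (simp add: exp_minus)
    also have "(\<zeta> * exp (\<beta> * s) * (D / K)) powr (- q) = (y * D / K) powr (- q) * (exp (\<beta> * s - \<rho> * s) powr (- q) * expm b s \<omega> powr (- q))"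
    proof -
      have eq: "\<zeta> * exp (\<beta> * s) * (D / K) = (y * D / K) * (exp (\<beta> * s - \<rho> * s) * expm b s \<omega>)"
        by (simp add: \<zeta>_def exp_diff exp_minus field_simps)
      have pw: "(A * (B * C)) powr (- q) = A powr (- q) * (B powr (- q) * C powr (- q))"
        if "0 \<le> A" "0 \<le> B" "0 \<le> C" for A B C :: real
        using that by (simp add: powr_mult)
      show ?thesis unfolding eq by (rule pw) (use y D K in auto)
    qed
    also have "exp (\<beta> * s - \<rho> * s) powr (- q) * expm b s \<omega> powr (- q)
      = exp (- q * (\<beta> * s - \<rho> * s) + (q\<^sup>2 + q) * b\<^sup>2 * s / 2) * expm (- q * b) s \<omega>"
      unfolding expm_powr exp_powr_real exp_add by (simp add: mult_ac)
    also have "exp (- \<beta> * s) * ((1 - p) / p * ((y * D / K) powr (- q) * (exp (- q * (\<beta> * s - \<rho> * s) + (q\<^sup>2 + q) * b\<^sup>2 * s / 2) * expm (- q * b) s \<omega>)))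
      = C * (exp (- \<beta> * s) * exp (- q * (\<beta> * s - \<rho> * s) + (q\<^sup>2 + q) * b\<^sup>2 * s / 2)) * expm (- q * b) s \<omega>"
      by (simp add: C_def mult_ac)
    \<comment> \<open>Hypothesis \<open>expo\<close> is exactly the collection of all deterministic
      exponents; the random factor left over is \<open>expm (- q * b)\<close>, with mean
      one.\<close>
    also have "exp (- \<beta> * s) * exp (- q * (\<beta> * s - \<rho> * s) + (q\<^sup>2 + q) * b\<^sup>2 * s / 2) = exp (- D * s)"
      unfolding exp_add[symmetric] expo[symmetric] b_def \<rho>_def power2_minus
      by (simp add: algebra_simps power2_eq_square add_divide_distrib diff_divide_distrib)
    finally have 1: "exp (- \<beta> * s) * (cc powr p / p) \<le> \<zeta> * (D / K * cc) + C * exp (- D * s) * expm (- q * b) s \<omega>" by simp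
    have "\<zeta> * (D / K * cc) \<le> \<zeta> * (cc - \<delta> * XX)" using ccX \<zeta> by (intro mult_left_mono) auto
    then have "\<zeta> * (D / K * cc) + y * \<delta> * exp (- \<rho> * s) * (XX * expm b s \<omega>) \<le> y * exp (- \<rho> * s) * (cc * expm b s \<omega>)"
      by (simp add: \<zeta>_def algebra_simps)
    with 1 show ?thesis by linarith
  qed
  have us: "u s + ennreal (y * \<delta>) * (ennreal (exp (- \<rho> * s)) * tilted b X s) \<le> ennreal y * (ennreal (exp (- \<rho> * s)) * tilted b c s) + ennreal C * ennreal (exp (- D * s))"
    if s: "0 \<le> s" for s
  proof -
    have [measurable]: "c s \<in> borel_measurable M" "X s \<in> borel_measurable M" "\<And>b. expm b s \<in> borel_measurable M"
      using s prog by (auto intro: expm_M progressive_section_M)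
    have "u s + ennreal (y * \<delta>) * (ennreal (exp (- \<rho> * s)) * tilted b X s)
      = (\<integral>\<^sup>+\<omega>. ennreal (exp (- \<beta> * s) * (c s \<omega> powr p / p)) + ennreal (y * \<delta>) * (ennreal (exp (- \<rho> * s)) * (ennreal (X s \<omega>) * ennreal (expm b s \<omega>))) \<partial>M)"
      using s by (simp add: u_def tilted_def nn_integral_add nn_integral_cmult)
    also have "\<dots> \<le> (\<integral>\<^sup>+\<omega>. ennreal y * (ennreal (exp (- \<rho> * s)) * (ennreal (c s \<omega>) * ennreal (expm b s \<omega>))) + ennreal C * ennreal (exp (- D * s)) * ennreal (expm (- q * b) s \<omega>) \<partial>M)"
      using nonneg[OF s] constr[OF s]
    proof (intro nn_integral_mono_AE, eventually_elim)
      case (elim \<omega>)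
      have "ennreal (exp (- \<beta> * s) * (c s \<omega> powr p / p)) + ennreal (y * \<delta>) * (ennreal (exp (- \<rho> * s)) * (ennreal (X s \<omega>) * ennreal (expm b s \<omega>)))
        = ennreal (exp (- \<beta> * s) * (c s \<omega> powr p / p) + y * \<delta> * exp (- \<rho> * s) * (X s \<omega> * expm b s \<omega>))"
        using elim y \<delta> p by (simp add: ennreal_plus ennreal_mult mult.assoc)
      also have "\<dots> \<le> ennreal (y * exp (- \<rho> * s) * (c s \<omega> * expm b s \<omega>) + C * exp (- D * s) * expm (- q * b) s \<omega>)"
        using elim by (intro ennreal_leI pt) auto
      also have "\<dots> = ennreal y * (ennreal (exp (- \<rho> * s)) * (ennreal (c s \<omega>) * ennreal (expm b s \<omega>))) + ennreal C * ennreal (exp (- D * s)) * ennreal (expm (- q * b) s \<omega>)"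
        using elim y C by (simp add: ennreal_plus ennreal_mult mult.assoc)
      finally show ?case .
    qed
    also have "\<dots> = ennreal y * (ennreal (exp (- \<rho> * s)) * tilted b c s) + ennreal C * ennreal (exp (- D * s))"
      using s by (simp add: tilted_def nn_integral_add nn_integral_cmult nn_integral_expm_one)
    finally show ?thesis .
  qed
  have "(\<integral>\<^sup>+t\<in>{0..T}. u t \<partial>lborel) \<le> ennreal (C / D + y * x)" if T: "0 \<le> T" for T
  proof -
    note [measurable] = tilted_measurable[OF prog(1), of b] tilted_measurable[OF prog(3), of b]
    define GX where "GX = (\<integral>\<^sup>+s\<in>{0..T}. ennreal (exp (- \<rho> * s)) * tilted b X s \<partial>lborel)"
    define GC where "GC = (\<integral>\<^sup>+s\<in>{0..T}. ennreal (exp (- \<rho> * s)) * tilted b c s \<partial>lborel)"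
    have bud: "GC \<le> ennreal x + ennreal \<delta> * GX" "GX < \<infinity>"
      unfolding GX_def GC_def \<rho>_def
      using tilted_budget[OF _ b_def]
      by (rule discounted_budget[OF tilted_measurable[OF prog(3)] tilted_measurable[OF prog(1)] x r \<delta> T tilted_wealth_finite'[OF T]]; simp)+
    have uT: "(\<lambda>t. u t * indicator {0..T} t) \<in> borel_measurable lborel"
    proof -
      have "(\<lambda>t. u t * indicator {0..} t * indicator {0..T} t) \<in> borel_measurable lborel" by measurable
      also have "(\<lambda>t. u t * indicator {0..} t * indicator {0..T} t) = (\<lambda>t. u t * indicator {0..T} t)" by (auto simp: indicator_def)
      finally show ?thesis .
    qed
    have "(\<integral>\<^sup>+t\<in>{0..T}. u t \<partial>lborel) + ennreal (y * \<delta>) * GX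
      = (\<integral>\<^sup>+s. u s * indicator {0..T} s + ennreal (y * \<delta>) * (ennreal (exp (- \<rho> * s)) * tilted b X s * indicator {0..T} s) \<partial>lborel)"
      unfolding GX_def using uT by (simp add: nn_integral_add nn_integral_cmult)
    also have "\<dots> \<le> (\<integral>\<^sup>+s. ennreal y * (ennreal (exp (- \<rho> * s)) * tilted b c s * indicator {0..T} s) + ennreal C * (ennreal (exp (- D * s)) * indicator {0..T} s) \<partial>lborel)"
      using us by (intro nn_integral_mono) (auto simp: indicator_def)
    also have "\<dots> = ennreal y * GC + ennreal C * (\<integral>\<^sup>+s\<in>{0..T}. ennreal (exp (- D * s)) \<partial>lborel)"
      unfolding GC_def by (simp add: nn_integral_add nn_integral_cmult)
    also have "\<dots> \<le> ennreal y * (ennreal x + ennreal \<delta> * GX) + ennreal C * ennreal (1 / D)"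
      using bud(1) nn_integral_exp_Icc_le[OF D T] by (intro add_mono mult_left_mono) auto
    also have "\<dots> = ennreal (y * \<delta>) * GX + ennreal (C / D + y * x)"
    proof -
      have 1: "ennreal (C / D + y * x) = ennreal C * ennreal (1 / D) + ennreal y * ennreal x"
        using y x C D by (simp add: ennreal_plus ennreal_mult[symmetric])
      have 2: "ennreal (y * \<delta>) = ennreal y * ennreal \<delta>" using y \<delta> by (simp add: ennreal_mult)
      show ?thesis unfolding 1 2 distrib_left by (simp only: add_ac mult_ac)
    qed
    \<comment> \<open>The credit on wealth now appears on both sides; \<open>bud(2)\<close> makes it
      finite, so it can be removed.\<close>
    finally have "ennreal (y * \<delta>) * GX + (\<integral>\<^sup>+t\<in>{0..T}. u t \<partial>lborel) \<le> ennreal (y * \<delta>) * GX + ennreal (C / D + y * x)"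
      by (simp add: add.commute)
    moreover have "ennreal (y * \<delta>) * GX < top" using bud(2) by (simp add: ennreal_mult_less_top)
    ultimately show ?thesis by (auto simp: ennreal_add_left_cancel_le)
  qed
  then have "(\<integral>\<^sup>+t\<in>{0..}. u t \<partial>lborel) \<le> ennreal (C / D + y * x)"
    by (rule nn_integral_atLeast_le[OF um])
  then show ?thesis unfolding objective_eq(1)[OF prog(1)] u_def C_def .
qed

end

section \<open>Geometric Brownian motion\<close>

lemma exp_minus_one_le: "exp v - 1 \<le> v * exp (v::real)"
proof -
  have "(1 - v) * exp v \<le> exp (- v) * exp v" using exp_ge_add_one_self[of "- v"] by (intro mult_right_mono) auto
  then show ?thesis by (simp add: exp_minus algebra_simps)
qed

lemma exp_minus_one_minus_le: "0 \<le> v \<Longrightarrow> exp v - 1 - v \<le> v\<^sup>2 * exp (v::real)"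
proof -
  assume v: "0 \<le> v"
  have "exp v - 1 - v \<le> v * (exp v - 1)" using exp_minus_one_le[of v] by (simp add: algebra_simps)
  also have "\<dots> \<le> v * (v * exp v)" using v exp_minus_one_le[of v] by (intro mult_left_mono)
  finally show ?thesis by (simp add: power2_eq_square mult.assoc)
qed

lemma exp_minus_one_square_le: "(exp v - 1)\<^sup>2 \<le> (v * exp \<bar>v\<bar>)\<^sup>2" for v :: real
proof -
  have "\<bar>exp v - 1\<bar> \<le> \<bar>v\<bar> * exp \<bar>v\<bar>"
  proof (cases "0 \<le> v")
    case True
    then show ?thesis using exp_minus_one_le[of v] by (simp add: abs_of_nonneg)
  next
    case False
    then have "1 - exp v \<le> - v" using exp_ge_add_one_self[of v] by linarith
    also have "\<dots> \<le> - v * exp \<bar>v\<bar>" using False by (simp add: mult_le_cancel_left1)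
    finally show ?thesis using False by simp
  qed
  then have "\<bar>exp v - 1\<bar> \<le> \<bar>v * exp \<bar>v\<bar>\<bar>" by (simp add: abs_mult)
  then show ?thesis by (simp add: abs_le_square_iff)
qed

lemma ennreal_integral_square_le:
  fixes f :: "real \<Rightarrow> real"
  assumes [measurable]: "f \<in> borel_measurable borel" and t: "0 \<le> t"
  shows "ennreal ((\<integral>s. indicator {0..t} s * f s \<partial>lborel)\<^sup>2) \<le> ennreal t * (\<integral>\<^sup>+s\<in>{0..t}. ennreal ((f s)\<^sup>2) \<partial>lborel)"
proof (cases "integrable lborel (\<lambda>s. indicator {0..t} s * f s)")
  case True
  have "ennreal ((\<integral>s. indicator {0..t} s * f s \<partial>lborel)\<^sup>2) = (ennreal (norm (\<integral>s. indicator {0..t} s * f s \<partial>lborel)))\<^sup>2"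
    by (simp add: ennreal_power)
  also have "\<dots> \<le> (\<integral>\<^sup>+s. ennreal (norm (indicator {0..t} s * f s)) \<partial>lborel)\<^sup>2"
    by (intro power_mono integral_norm_bound_ennreal True) simp
  also have "\<dots> = (\<integral>\<^sup>+s. indicator {0..t} s * ennreal \<bar>indicator {0..t} s * f s\<bar> \<partial>lborel)\<^sup>2"
    by (intro arg_cong[where f="\<lambda>x. x\<^sup>2"] nn_integral_cong) (auto simp: indicator_def)
  also have "\<dots> \<le> (\<integral>\<^sup>+s. (indicator {0..t} s)\<^sup>2 \<partial>lborel) * (\<integral>\<^sup>+s. (ennreal \<bar>indicator {0..t} s * f s\<bar>)\<^sup>2 \<partial>lborel)"
    by (rule Cauchy_Schwarz_nn_integral) measurable
  also have "(\<integral>\<^sup>+s. (indicator {0..t} s)\<^sup>2 \<partial>lborel) = (\<integral>\<^sup>+s. indicator {0..t} s \<partial>lborel)"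
    by (intro nn_integral_cong) (auto simp: indicator_def)
  also have "\<dots> = ennreal t" using t by simp
  also have "(\<integral>\<^sup>+s. (ennreal \<bar>indicator {0..t} s * f s\<bar>)\<^sup>2 \<partial>lborel) = (\<integral>\<^sup>+s\<in>{0..t}. ennreal ((f s)\<^sup>2) \<partial>lborel)"
    by (intro nn_integral_cong) (auto simp: indicator_def ennreal_power)
  finally show ?thesis .
next
  \<comment> \<open>The Bochner integral of a non-integrable function is 0, so the left side
    vanishes.\<close>
  case False
  then show ?thesis by (simp add: not_integrable_integral_eq)
qed

lemma nn_integral_square_orthogonal_sum:
  fixes d :: "nat \<Rightarrow> 'a \<Rightarrow> real"
  assumes m: "\<And>i. i < n \<Longrightarrow> d i \<in> borel_measurable N" and sq: "\<And>i. i < n \<Longrightarrow> integrable N (\<lambda>x. (d i x)\<^sup>2)"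
    and orth: "\<And>i j. i < j \<Longrightarrow> j < n \<Longrightarrow> (\<integral>x. d i x * d j x \<partial>N) = 0"
  shows "(\<integral>\<^sup>+x. ennreal ((\<Sum>i<n. d i x)\<^sup>2) \<partial>N) = (\<Sum>i<n. \<integral>\<^sup>+x. ennreal ((d i x)\<^sup>2) \<partial>N)"
proof -
  have int: "integrable N (\<lambda>x. d i x * d j x)" if "i < n" "j < n" for i j
    using that by (intro integrable_mult_square_integrable m sq)
  have eq: "(\<lambda>x. (\<Sum>i<n. d i x)\<^sup>2) = (\<lambda>x. \<Sum>i<n. \<Sum>j<n. d i x * d j x)"
    by (simp add: power2_eq_square sum_product)
  have i2: "integrable N (\<lambda>x. (\<Sum>i<n. d i x)\<^sup>2)" unfolding eq by (intro Bochner_Integration.integrable_sum int) auto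
  have z: "(\<integral>x. d i x * d j x \<partial>N) = (if i = j then (\<integral>x. (d i x)\<^sup>2 \<partial>N) else 0)" if "i < n" "j < n" for i j
    using orth[of i j] orth[of j i] that by (cases i j rule: linorder_cases) (auto simp: power2_eq_square mult.commute)
  have "(\<integral>x. (\<Sum>i<n. d i x)\<^sup>2 \<partial>N) = (\<Sum>i<n. \<Sum>j<n. \<integral>x. d i x * d j x \<partial>N)"
    unfolding eq by (subst Bochner_Integration.integral_sum, (intro Bochner_Integration.integrable_sum int; simp),
      intro sum.cong refl, subst Bochner_Integration.integral_sum, (intro int; simp), simp)
  also have "\<dots> = (\<Sum>i<n. \<Sum>j<n. if i = j then (\<integral>x. (d i x)\<^sup>2 \<partial>N) else 0)"
    by (intro sum.cong refl) (simp add: z)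
  also have "\<dots> = (\<Sum>i<n. \<integral>x. (d i x)\<^sup>2 \<partial>N)" by simp
  finally have "(\<integral>\<^sup>+x. ennreal ((\<Sum>i<n. d i x)\<^sup>2) \<partial>N) = ennreal (\<Sum>i<n. \<integral>x. (d i x)\<^sup>2 \<partial>N)"
    using i2 by (subst nn_integral_eq_integral) auto
  also have "\<dots> = (\<Sum>i<n. ennreal (\<integral>x. (d i x)\<^sup>2 \<partial>N))" by (rule sum_ennreal[symmetric]) auto
  also have "\<dots> = (\<Sum>i<n. \<integral>\<^sup>+x. ennreal ((d i x)\<^sup>2) \<partial>N)"
    by (intro sum.cong refl nn_integral_eq_integral[symmetric] sq) auto
  finally show ?thesis .
qed

context brownian
begin

definition gbm :: "real \<Rightarrow> real \<Rightarrow> real \<Rightarrow> real \<Rightarrow> 'w \<Rightarrow> real" where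
  "gbm x a b t \<omega> = x * exp (a * t) * expm b t \<omega>"

text \<open>The quotient of geometric Brownian motion at two times as a function of the elapsed time
  and of the increment of \<open>W\<close>; in this form it is independent of the past.\<close>

definition ratio :: "real \<Rightarrow> real \<Rightarrow> real \<Rightarrow> real \<Rightarrow> real" where
  "ratio a b \<tau> w = exp (a * \<tau> - b\<^sup>2 * \<tau> / 2 + b * w)"

lemma gbm_nonneg: "0 \<le> x \<Longrightarrow> 0 \<le> gbm x a b t \<omega>"
  by (simp add: gbm_def)

lemma gbm_0: "\<omega> \<in> space M \<Longrightarrow> gbm x a b 0 \<omega> = x"
  by (simp add: gbm_def expm_0)

lemma gbm_F: "0 \<le> s \<Longrightarrow> s \<le> t \<Longrightarrow> gbm x a b s \<in> borel_measurable (F t)"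
  using expm_F[of s t b] unfolding gbm_def[abs_def] by measurable

lemma gbm_M: "0 \<le> s \<Longrightarrow> gbm x a b s \<in> borel_measurable M"
  by (rule measurable_F_M[OF gbm_F[of s s]]) auto

lemma progressive_gbm: "progressive M F (gbm x a b)"
proof (rule progressive_continuous)
  fix \<omega> assume "\<omega> \<in> space M"
  then show "continuous_on {0..} (\<lambda>t. gbm x a b t \<omega>)"
    unfolding gbm_def expm_def by (intro continuous_intros W_continuous) auto
qed (auto intro: gbm_F)

lemma gbm_ratio: "gbm x a b u \<omega> = gbm x a b s \<omega> * ratio a b (u - s) (W u \<omega> - W s \<omega>)"
  unfolding gbm_def expm_def ratio_def by (simp add: mult.assoc exp_add[symmetric] algebra_simps diff_divide_distrib)

lemma gbm_powr:
  assumes "0 \<le> x"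
  shows "gbm x a b t \<omega> powr q = x powr q * exp ((q * a + (q\<^sup>2 - q) * b\<^sup>2 / 2) * t) * expm (q * b) t \<omega>"
proof -
  have "gbm x a b t \<omega> powr q = x powr q * exp (a * t) powr q * expm b t \<omega> powr q"
    using assms by (simp add: gbm_def powr_mult)
  then show ?thesis by (simp add: expm_powr exp_powr_real mult.assoc exp_add[symmetric] algebra_simps)
qed

lemma nn_integral_gbm_powr:
  assumes "0 \<le> x" "0 \<le> t"
  shows "(\<integral>\<^sup>+\<omega>. ennreal (gbm x a b t \<omega> powr q) \<partial>M) = ennreal (x powr q * exp ((q * a + (q\<^sup>2 - q) * b\<^sup>2 / 2) * t))"
  using expm_M[OF assms(2), of "q * b"] assms
  by (simp add: gbm_powr ennreal_mult nn_integral_cmult nn_integral_expm_one)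

text \<open>Used with exponents 2 and 4: the second moment controls the discretisation error, the
  fourth the truncation error. The growth rate may be negative, hence its absolute value in the
  constant.\<close>

lemma gbm_power_bound:
  assumes x: "0 \<le> x" and k: "0 < k"
  obtains C where "0 \<le> C" "\<And>s. s \<in> {0..t} \<Longrightarrow> (\<integral>\<^sup>+\<omega>. ennreal (gbm x a b s \<omega> ^ k) \<partial>M) \<le> ennreal C"
proof
  define v where "v = real k * a + ((real k)\<^sup>2 - real k) * b\<^sup>2 / 2"
  show "0 \<le> x powr real k * exp (\<bar>v\<bar> * t)" by simp
  fix s assume s: "s \<in> {0..t}"
  have "v * s \<le> \<bar>v\<bar> * s" using s by (intro mult_right_mono) auto
  also have "\<dots> \<le> \<bar>v\<bar> * t" using s by (intro mult_left_mono) auto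
  finally have vs: "v * s \<le> \<bar>v\<bar> * t" .
  have "(\<integral>\<^sup>+\<omega>. ennreal (gbm x a b s \<omega> ^ k) \<partial>M) = (\<integral>\<^sup>+\<omega>. ennreal (gbm x a b s \<omega> powr real k) \<partial>M)"
    using gbm_nonneg[OF x] k by (intro nn_integral_cong) (simp add: powr_realpow')
  also have "\<dots> = ennreal (x powr real k * exp (v * s))"
    using x s by (subst nn_integral_gbm_powr) (auto simp: v_def)
  also have "\<dots> \<le> ennreal (x powr real k * exp (\<bar>v\<bar> * t))"
    using vs by (intro ennreal_leI mult_left_mono) auto
  finally show "(\<integral>\<^sup>+\<omega>. ennreal (gbm x a b s \<omega> ^ k) \<partial>M) \<le> ennreal (x powr real k * exp (\<bar>v\<bar> * t))" .
qed

text \<open>The free coefficients serve three approximations of the ratio: the pair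
  \<open>(1, 0)\<close> for freezing the process, \<open>(exp (a * \<tau>), 0)\<close> for removing
  its mean growth, and \<open>(exp (a * \<tau>), b)\<close> for removing the first-order martingale
  part as well.\<close>

lemma ratio_moments:
  assumes "0 \<le> s" "s \<le> u"
  shows "has_bochner_integral M (\<lambda>\<omega>. ratio a b (u - s) (W u \<omega> - W s \<omega>)) (exp (a * (u - s)))"
    "has_bochner_integral M (\<lambda>\<omega>. (ratio a b (u - s) (W u \<omega> - W s \<omega>) - c0 - c1 * (W u \<omega> - W s \<omega>))\<^sup>2)
     (exp ((2 * a + b\<^sup>2) * (u - s)) + c0\<^sup>2 + c1\<^sup>2 * (u - s) - 2 * c0 * exp (a * (u - s)) - 2 * c1 * b * (u - s) * exp (a * (u - s)))"
proof -
  let ?t = "u - s" and ?D = "\<lambda>\<omega>. W u \<omega> - W s \<omega>"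
  have R: "ratio a b ?t w = exp (a * ?t - b\<^sup>2 * ?t / 2) * exp (b * w)" for w by (simp add: ratio_def exp_add)
  have e: "exp (a * ?t - b\<^sup>2 * ?t / 2) * exp (b\<^sup>2 * ?t / 2) = exp (a * ?t)" by (simp add: exp_add[symmetric])
  show 1: "has_bochner_integral M (\<lambda>\<omega>. ratio a b ?t (?D \<omega>)) (exp (a * ?t))"
    using has_bochner_integral_mult_right[OF has_integral_exp_increment[OF assms, of b], of "exp (a * ?t - b\<^sup>2 * ?t / 2)"]
    by (simp add: R e)
  have 2: "has_bochner_integral M (\<lambda>\<omega>. (ratio a b ?t (?D \<omega>))\<^sup>2) (exp ((2 * a + b\<^sup>2) * ?t))"
  proof -
    have "has_bochner_integral M (\<lambda>\<omega>. (exp (a * ?t - b\<^sup>2 * ?t / 2))\<^sup>2 * exp (2 * b * ?D \<omega>))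
      ((exp (a * ?t - b\<^sup>2 * ?t / 2))\<^sup>2 * exp ((2 * b)\<^sup>2 * ?t / 2))"
      by (intro has_bochner_integral_mult_right has_integral_exp_increment assms)
    moreover have "(exp (a * ?t - b\<^sup>2 * ?t / 2))\<^sup>2 * exp (2 * b * w) = (ratio a b ?t w)\<^sup>2" for w
      by (simp add: R power_mult_distrib exp_double mult.assoc)
    moreover have "(exp (a * ?t - b\<^sup>2 * ?t / 2))\<^sup>2 * exp ((2 * b)\<^sup>2 * ?t / 2) = exp ((2 * a + b\<^sup>2) * ?t)"
      unfolding exp_double[symmetric] exp_add[symmetric] by (simp add: field_simps)
    ultimately show ?thesis by simp
  qed
  have 3: "has_bochner_integral M (\<lambda>\<omega>. ratio a b ?t (?D \<omega>) * ?D \<omega>) (b * ?t * exp (a * ?t))"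
  proof -
    have "has_bochner_integral M (\<lambda>\<omega>. exp (a * ?t - b\<^sup>2 * ?t / 2) * (?D \<omega> * exp (b * ?D \<omega>))) (exp (a * ?t - b\<^sup>2 * ?t / 2) * (b * ?t * exp (b\<^sup>2 * ?t / 2)))"
      by (intro has_bochner_integral_mult_right has_integral_increment_exp_increment assms)
    moreover have "exp (a * ?t - b\<^sup>2 * ?t / 2) * (b * ?t * exp (b\<^sup>2 * ?t / 2)) = b * ?t * exp (a * ?t)"
      unfolding e[symmetric] by (simp only: mult_ac)
    moreover have "exp (a * ?t - b\<^sup>2 * ?t / 2) * (w * exp (b * w)) = ratio a b ?t w * w" for w
      unfolding R by (simp only: mult_ac)
    ultimately show ?thesis by (simp only:)
  qed
  have 4: "has_bochner_integral M (\<lambda>_. c0\<^sup>2) (c0\<^sup>2)" by (simp add: has_bochner_integral_iff prob_space)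
  have "has_bochner_integral M (\<lambda>\<omega>. (ratio a b ?t (?D \<omega>))\<^sup>2 + c0\<^sup>2 + c1\<^sup>2 * (?D \<omega>)\<^sup>2 - 2 * c0 * ratio a b ?t (?D \<omega>)
      - 2 * c1 * (ratio a b ?t (?D \<omega>) * ?D \<omega>) + 2 * c0 * c1 * ?D \<omega>)
    (exp ((2 * a + b\<^sup>2) * ?t) + c0\<^sup>2 + c1\<^sup>2 * ?t - 2 * c0 * exp (a * ?t) - 2 * c1 * (b * ?t * exp (a * ?t)) + 2 * c0 * c1 * 0)"
    by (intro has_bochner_integral_add has_bochner_integral_diff has_bochner_integral_mult_right 1 2 3 4
        has_integral_increment_sq has_integral_increment assms)
  then show "has_bochner_integral M (\<lambda>\<omega>. (ratio a b ?t (?D \<omega>) - c0 - c1 * ?D \<omega>)\<^sup>2)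
     (exp ((2 * a + b\<^sup>2) * ?t) + c0\<^sup>2 + c1\<^sup>2 * ?t - 2 * c0 * exp (a * ?t) - 2 * c1 * b * ?t * exp (a * ?t))"
    by (simp add: power2_eq_square algebra_simps)
qed

lemma gbm_increment_square:
  assumes su: "0 \<le> s" "s \<le> u"
    and v: "exp ((2 * a + b\<^sup>2) * (u - s)) + c0\<^sup>2 + c1\<^sup>2 * (u - s) - 2 * c0 * exp (a * (u - s)) - 2 * c1 * b * (u - s) * exp (a * (u - s)) \<le> v"
    and C: "(\<integral>\<^sup>+\<omega>. ennreal ((gbm x a b s \<omega>)\<^sup>2) \<partial>M) \<le> ennreal C" "0 \<le> C"
  shows "(\<integral>\<^sup>+\<omega>. ennreal ((gbm x a b u \<omega> - c0 * gbm x a b s \<omega> - c1 * (gbm x a b s \<omega> * (W u \<omega> - W s \<omega>)))\<^sup>2) \<partial>M) \<le> ennreal (C * v)"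
proof -
  let ?g = "\<lambda>w. (ratio a b (u - s) w - c0 - c1 * w)\<^sup>2"
  have [measurable]: "gbm x a b s \<in> borel_measurable (F s)" using su by (intro gbm_F) auto
  have "gbm x a b u \<omega> - c0 * gbm x a b s \<omega> - c1 * (gbm x a b s \<omega> * (W u \<omega> - W s \<omega>)) = gbm x a b s \<omega> * (ratio a b (u - s) (W u \<omega> - W s \<omega>) - c0 - c1 * (W u \<omega> - W s \<omega>))" for \<omega>
    unfolding gbm_ratio[of x a b u \<omega> s] by (simp add: algebra_simps)
  then have "(\<integral>\<^sup>+\<omega>. ennreal ((gbm x a b u \<omega> - c0 * gbm x a b s \<omega> - c1 * (gbm x a b s \<omega> * (W u \<omega> - W s \<omega>)))\<^sup>2) \<partial>M)
     = (\<integral>\<^sup>+\<omega>. ennreal ((gbm x a b s \<omega>)\<^sup>2) * ennreal (?g (W u \<omega> - W s \<omega>)) \<partial>M)"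
    by (simp add: power_mult_distrib ennreal_mult)
  also have "\<dots> = (\<integral>\<^sup>+\<omega>. ennreal ((gbm x a b s \<omega>)\<^sup>2) \<partial>M) * (\<integral>\<^sup>+\<omega>. ennreal (?g (W u \<omega> - W s \<omega>)) \<partial>M)"
    unfolding ratio_def by (rule nn_integral_increment[OF su]) measurable
  also have "\<dots> \<le> ennreal C * ennreal v"
  proof (intro mult_mono C)
    show "(\<integral>\<^sup>+\<omega>. ennreal (?g (W u \<omega> - W s \<omega>)) \<partial>M) \<le> ennreal v"
      using ratio_moments(2)[OF su, of a b c0 c1] v
      by (subst nn_integral_eq_integral) (auto simp: has_bochner_integral_iff intro!: ennreal_leI)
  qed auto
  also have "\<dots> = ennreal (C * v)" using C(2) by (simp add: ennreal_mult')
  finally show ?thesis .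
qed

end

section \<open>Riemann sums for geometric Brownian motion and their mean-square error\<close>

lemma step_sum_eq:
  fixes f :: "nat \<Rightarrow> real"
  assumes h: "0 < h" and j: "j < n" "real j * h \<le> s" "s < real (Suc j) * h"
  shows "(\<Sum>i<n. if real i * h \<le> s \<and> s < real (Suc i) * h then f i else 0) = f j"
proof -
  have "(if real i * h \<le> s \<and> s < real (Suc i) * h then f i else 0) = (if i = j then f i else 0)" for i
  proof (cases "i = j")
    case False
    then consider "Suc i \<le> j" | "Suc j \<le> i" by linarith
    then have "real (Suc i) * h \<le> real j * h \<or> real (Suc j) * h \<le> real i * h"
      using h by cases (auto intro!: mult_right_mono simp del: of_nat_Suc)
    then show ?thesis using j False by auto
  qed (use j in auto)
  then show ?thesis using j(1) by simp
qed

lemma step_index: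
  assumes h: "0 < h" and s: "0 \<le> s" "s < real n * h"
  obtains j where "j < n" "real j * h \<le> s" "s < real (Suc j) * h"
proof
  let ?j = "nat \<lfloor>s / h\<rfloor>"
  have 0: "0 \<le> s / h" using h s by simp
  have 1: "real ?j \<le> s / h" "s / h < real (Suc ?j)" using 0 by (auto simp: of_nat_nat) linarith+
  show "real ?j * h \<le> s" "s < real (Suc ?j) * h" using 1 h by (auto simp: field_simps)
  have "s / h < real n" using s h by (simp add: field_simps)
  then show "?j < n" using 1 by linarith
qed

text \<open>The three expressions are the second moments in \<open>ratio_moments\<close> for its
  three choices of coefficients. The first two are of order \<tau>; the third is of order \<tau>
  squared, which is what lets \<open>n\<close> orthogonal errors of step length \<open>t / n\<close>
  sum to order \<open>1 / n\<close>.\<close>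

lemma gbm_moment_bounds:
  fixes a b t :: real
  assumes t: "0 \<le> t"
  obtains C where "0 \<le> C"
    "\<And>\<tau>. \<tau> \<in> {0..t} \<Longrightarrow> exp ((2 * a + b\<^sup>2) * \<tau>) + 1 - 2 * exp (a * \<tau>) \<le> C * \<tau>"
    "\<And>\<tau>. \<tau> \<in> {0..t} \<Longrightarrow> exp ((2 * a + b\<^sup>2) * \<tau>) + (exp (a * \<tau>))\<^sup>2 - 2 * exp (a * \<tau>) * exp (a * \<tau>) \<le> C * \<tau>"
    "\<And>\<tau>. \<tau> \<in> {0..t} \<Longrightarrow> exp ((2 * a + b\<^sup>2) * \<tau>) + (exp (a * \<tau>))\<^sup>2 + b\<^sup>2 * \<tau> - 2 * exp (a * \<tau>) * exp (a * \<tau>) - 2 * b * b * \<tau> * exp (a * \<tau>) \<le> C * \<tau>\<^sup>2"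
proof
  define u where "u = 2 * a + b\<^sup>2"
  define A1 where "A1 = \<bar>u\<bar> * exp (\<bar>u\<bar> * t) + 2 * \<bar>a\<bar>"
  define A2 where "A2 = exp (2 * \<bar>a\<bar> * t) * (b\<^sup>2 * exp (b\<^sup>2 * t))"
  define A3 where "A3 = exp (2 * \<bar>a\<bar> * t) * ((b\<^sup>2)\<^sup>2 * exp (b\<^sup>2 * t)) + b\<^sup>2 * t * (\<bar>a\<bar> * exp (\<bar>a\<bar> * t))\<^sup>2"
  have A: "0 \<le> A1" "0 \<le> A2" "0 \<le> A3" using t by (auto simp: A1_def A2_def A3_def)
  show "0 \<le> A1 + A2 + A3" using A by simp
  fix \<tau> assume \<tau>: "\<tau> \<in> {0..t}"
  have le: "v * \<tau> \<le> \<bar>v\<bar> * t" for v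
  proof -
    have "v * \<tau> \<le> \<bar>v\<bar> * \<tau>" using \<tau> by (intro mult_right_mono) auto
    also have "\<dots> \<le> \<bar>v\<bar> * t" using \<tau> by (intro mult_left_mono) auto
    finally show ?thesis .
  qed
  have Ale: "A1 * \<tau> \<le> (A1 + A2 + A3) * \<tau>" "A2 * \<tau> \<le> (A1 + A2 + A3) * \<tau>" "A3 * \<tau>\<^sup>2 \<le> (A1 + A2 + A3) * \<tau>\<^sup>2"
    using A \<tau> by (auto intro!: mult_right_mono)
  have "exp (u * \<tau>) - 1 \<le> u * \<tau> * exp (u * \<tau>)" by (rule exp_minus_one_le)
  also have "\<dots> \<le> \<bar>u\<bar> * \<tau> * exp (\<bar>u\<bar> * t)" using \<tau> le[of u] by (intro mult_mono) (auto intro!: mult_right_mono)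
  finally have 1: "exp (u * \<tau>) - 1 \<le> \<bar>u\<bar> * exp (\<bar>u\<bar> * t) * \<tau>" by (simp add: mult_ac)
  have "- (a * \<tau>) \<le> \<bar>a\<bar> * \<tau>" using \<tau> by (auto simp: abs_if intro: mult_nonneg_nonneg)
  then have 2: "2 - 2 * exp (a * \<tau>) \<le> 2 * \<bar>a\<bar> * \<tau>" using exp_ge_add_one_self[of "a * \<tau>"] by linarith
  have "exp (u * \<tau>) + 1 - 2 * exp (a * \<tau>) \<le> A1 * \<tau>" using 1 2 by (simp add: A1_def distrib_right)
  then show "exp ((2 * a + b\<^sup>2) * \<tau>) + 1 - 2 * exp (a * \<tau>) \<le> (A1 + A2 + A3) * \<tau>" using Ale unfolding u_def by linarith
  have eu: "exp (u * \<tau>) = (exp (a * \<tau>))\<^sup>2 * exp (b\<^sup>2 * \<tau>)"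
    unfolding u_def exp_double[symmetric] exp_add[symmetric] by (simp add: algebra_simps)
  have ea: "(exp (a * \<tau>))\<^sup>2 \<le> exp (2 * \<bar>a\<bar> * t)"
    unfolding exp_double[symmetric] using le[of a] by simp
  have eb: "exp (b\<^sup>2 * \<tau>) \<le> exp (b\<^sup>2 * t)" using \<tau> by (auto intro: mult_left_mono)
  have "exp (b\<^sup>2 * \<tau>) - 1 \<le> b\<^sup>2 * \<tau> * exp (b\<^sup>2 * \<tau>)" by (rule exp_minus_one_le)
  also have "\<dots> \<le> b\<^sup>2 * \<tau> * exp (b\<^sup>2 * t)" using \<tau> eb by (intro mult_left_mono) auto
  finally have "(exp (a * \<tau>))\<^sup>2 * (exp (b\<^sup>2 * \<tau>) - 1) \<le> exp (2 * \<bar>a\<bar> * t) * (b\<^sup>2 * \<tau> * exp (b\<^sup>2 * t))"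
    using ea \<tau> by (intro mult_mono) auto
  then have "exp (u * \<tau>) + (exp (a * \<tau>))\<^sup>2 - 2 * exp (a * \<tau>) * exp (a * \<tau>) \<le> A2 * \<tau>"
    unfolding eu A2_def by (simp add: algebra_simps power2_eq_square)
  then show "exp ((2 * a + b\<^sup>2) * \<tau>) + (exp (a * \<tau>))\<^sup>2 - 2 * exp (a * \<tau>) * exp (a * \<tau>) \<le> (A1 + A2 + A3) * \<tau>"
    using Ale unfolding u_def by linarith
  have "exp (b\<^sup>2 * \<tau>) - 1 - b\<^sup>2 * \<tau> \<le> (b\<^sup>2 * \<tau>)\<^sup>2 * exp (b\<^sup>2 * \<tau>)" using \<tau> by (intro exp_minus_one_minus_le) auto
  also have "\<dots> \<le> (b\<^sup>2 * \<tau>)\<^sup>2 * exp (b\<^sup>2 * t)" using eb by (intro mult_left_mono) auto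
  finally have e1: "exp (b\<^sup>2 * \<tau>) - 1 - b\<^sup>2 * \<tau> \<le> (b\<^sup>2 * \<tau>)\<^sup>2 * exp (b\<^sup>2 * t)" .
  have e0: "0 \<le> exp (b\<^sup>2 * \<tau>) - 1 - b\<^sup>2 * \<tau>" using exp_ge_add_one_self[of "b\<^sup>2 * \<tau>"] by linarith
  have 3: "(exp (a * \<tau>))\<^sup>2 * (exp (b\<^sup>2 * \<tau>) - 1 - b\<^sup>2 * \<tau>) \<le> exp (2 * \<bar>a\<bar> * t) * ((b\<^sup>2 * \<tau>)\<^sup>2 * exp (b\<^sup>2 * t))"
    by (rule mult_mono[OF ea e1 _ e0]) simp
  have "(exp (a * \<tau>) - 1)\<^sup>2 \<le> (a * \<tau> * exp \<bar>a * \<tau>\<bar>)\<^sup>2" by (rule exp_minus_one_square_le)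
  also have "\<dots> = (\<bar>a\<bar> * \<tau> * exp (\<bar>a\<bar> * \<tau>))\<^sup>2" using \<tau> by (simp add: power_mult_distrib abs_mult)
  also have "\<dots> \<le> (\<bar>a\<bar> * \<tau> * exp (\<bar>a\<bar> * t))\<^sup>2" using \<tau> by (intro power_mono mult_left_mono) (auto intro!: mult_left_mono)
  finally have "b\<^sup>2 * \<tau> * (exp (a * \<tau>) - 1)\<^sup>2 \<le> b\<^sup>2 * t * (\<bar>a\<bar> * \<tau> * exp (\<bar>a\<bar> * t))\<^sup>2"
    using \<tau> by (intro mult_mono) (auto intro!: mult_left_mono)
  \<comment> \<open>The third expression equals this sum, both of whose terms are of second order:
    an exponential minus its linear part, and \<tau> times the square of a first-order term.\<close>
  with 3 have "(exp (a * \<tau>))\<^sup>2 * (exp (b\<^sup>2 * \<tau>) - 1 - b\<^sup>2 * \<tau>) + b\<^sup>2 * \<tau> * (exp (a * \<tau>) - 1)\<^sup>2 \<le> A3 * \<tau>\<^sup>2"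
    by (simp add: A3_def power_mult_distrib algebra_simps)
  then have "exp (u * \<tau>) + (exp (a * \<tau>))\<^sup>2 + b\<^sup>2 * \<tau> - 2 * exp (a * \<tau>) * exp (a * \<tau>) - 2 * b * b * \<tau> * exp (a * \<tau>) \<le> A3 * \<tau>\<^sup>2"
    unfolding eu by (simp add: algebra_simps power2_eq_square)
  then show "exp ((2 * a + b\<^sup>2) * \<tau>) + (exp (a * \<tau>))\<^sup>2 + b\<^sup>2 * \<tau> - 2 * exp (a * \<tau>) * exp (a * \<tau>) - 2 * b * b * \<tau> * exp (a * \<tau>) \<le> (A1 + A2 + A3) * \<tau>\<^sup>2"
    using Ale unfolding u_def by linarith
qed

context brownian
begin

text \<open>Above the level \<open>B\<close> the square of \<open>y\<close> is at most the fourth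
  power of \<open>y\<close> divided by the square of \<open>B\<close>, a Chebyshev-type
  estimate.\<close>

lemma gbm_truncation:
  assumes x: "0 \<le> x" and B: "0 < B" and C4: "(\<integral>\<^sup>+\<omega>. ennreal (gbm x a b s \<omega> ^ 4) \<partial>M) \<le> ennreal C4" "0 \<le> C4" and s: "0 \<le> s"
  shows "(\<integral>\<^sup>+\<omega>. ennreal ((gbm x a b s \<omega> - min (gbm x a b s \<omega>) B)\<^sup>2) \<partial>M) \<le> ennreal (C4 / B\<^sup>2)"
proof -
  have [measurable]: "gbm x a b s \<in> borel_measurable M" using s by (rule gbm_M)
  have pt: "(y - min y B)\<^sup>2 \<le> 1 / B\<^sup>2 * y ^ 4" if y: "0 \<le> y" for y
  proof (cases "y \<le> B")
    case False
    then have "(y - min y B)\<^sup>2 \<le> y\<^sup>2" using B by (intro power_mono) auto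
    also have "\<dots> = 1 / B\<^sup>2 * (B\<^sup>2 * y\<^sup>2)" using B by simp
    also have "\<dots> \<le> 1 / B\<^sup>2 * (y\<^sup>2 * y\<^sup>2)" using False B by (intro mult_left_mono mult_right_mono power_mono) auto
    finally show ?thesis by (simp add: power2_eq_square power4_eq_xxxx mult.assoc)
  qed (use y in simp)
  have "(\<integral>\<^sup>+\<omega>. ennreal ((gbm x a b s \<omega> - min (gbm x a b s \<omega>) B)\<^sup>2) \<partial>M) \<le> (\<integral>\<^sup>+\<omega>. ennreal (1 / B\<^sup>2) * ennreal (gbm x a b s \<omega> ^ 4) \<partial>M)"
    using pt gbm_nonneg[OF x] by (intro nn_integral_mono) (auto simp: ennreal_mult[symmetric] intro!: ennreal_leI simp del: times_divide_eq_left)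
  also have "\<dots> = ennreal (1 / B\<^sup>2) * (\<integral>\<^sup>+\<omega>. ennreal (gbm x a b s \<omega> ^ 4) \<partial>M)" by (rule nn_integral_cmult) measurable
  also have "\<dots> \<le> ennreal (1 / B\<^sup>2) * ennreal C4" by (intro mult_left_mono C4) simp
  also have "\<dots> = ennreal (C4 / B\<^sup>2)" using C4 by (simp flip: ennreal_mult)
  finally show ?thesis .
qed

text \<open>Coefficients of simple integrands must be bounded, so the left-point values are cut off
  at level \<open>n\<close>, the number of steps. Freezing costs order \<open>1 / n\<close> by
  \<open>Ca\<close>, and truncation costs no more by the fourth moment.\<close>

lemma gbm_simple_approx:
  fixes x a b m t C2 C4 C :: real and n :: nat
  assumes x: "0 \<le> x" and t: "0 < t" and n: "0 < n" and C: "0 \<le> C" "0 \<le> C2" "0 \<le> C4"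
    and C2: "\<And>s. s \<in> {0..t} \<Longrightarrow> (\<integral>\<^sup>+\<omega>. ennreal ((gbm x a b s \<omega>)\<^sup>2) \<partial>M) \<le> ennreal C2"
    and C4: "\<And>s. s \<in> {0..t} \<Longrightarrow> (\<integral>\<^sup>+\<omega>. ennreal (gbm x a b s \<omega> ^ 4) \<partial>M) \<le> ennreal C4"
    and Ca: "\<And>\<tau>. \<tau> \<in> {0..t} \<Longrightarrow> exp ((2 * a + b\<^sup>2) * \<tau>) + 1 - 2 * exp (a * \<tau>) \<le> C * \<tau>"
  defines "h \<equiv> t / real n"
  defines "ts \<equiv> \<lambda>i. real i * h"
  defines "\<xi> \<equiv> \<lambda>i \<omega>. m * min (gbm x a b (ts i) \<omega>) (real n)"
  shows "simple_adapted M F n ts \<xi>"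
    and "(\<integral>\<^sup>+\<omega>. (\<integral>\<^sup>+s\<in>{0..t}. ennreal ((simple_val n ts \<xi> s \<omega> - m * gbm x a b s \<omega>)\<^sup>2) \<partial>lborel) \<partial>M)
       \<le> ennreal (3 * t * m\<^sup>2 * (C4 + C2 * C * t) / real n)"
proof -
  let ?P = "M \<Otimes>\<^sub>M lborel"
  have h: "0 < h" "real n * h = t" using t n by (auto simp: h_def)
  have ts0: "0 \<le> ts i" for i using h by (simp add: ts_def)
  have tst: "ts i \<le> t" if "i \<le> n" for i
    using that h unfolding ts_def h(2)[symmetric] by (intro mult_right_mono) auto
  show S: "simple_adapted M F n ts \<xi>"
    unfolding simple_adapted_def
  proof (intro conjI allI impI)
    show "ts 0 = 0" by (simp add: ts_def)
    fix i assume "i < n"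
    show "ts i < ts (Suc i)" using h by (simp add: ts_def distrib_right)
    have [measurable]: "gbm x a b (ts i) \<in> borel_measurable (F (ts i))" using ts0 by (intro gbm_F) auto
    show "\<xi> i \<in> borel_measurable (F (ts i))" unfolding \<xi>_def by measurable
    have "\<bar>\<xi> i \<omega>\<bar> \<le> \<bar>m\<bar> * real n" for \<omega>
      using gbm_nonneg[OF x, of a b "ts i" \<omega>] unfolding \<xi>_def abs_mult by (intro mult_left_mono) auto
    then show "\<exists>B. \<forall>\<omega>\<in>space M. \<bar>\<xi> i \<omega>\<bar> \<le> B" by blast
  qed
  let ?Y = "\<lambda>s \<omega>. m * gbm x a b s \<omega>"
  have pY: "progressive M F ?Y" by (intro progressive_const_mult progressive_gbm)
  have [measurable]: "clip t (simple_val n ts \<xi>) \<in> borel_measurable ?P" "clip t ?Y \<in> borel_measurable ?P"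
    using t by (auto intro: clip_simple_val S progressive_clip pY)
  define V where "V = 3 * m\<^sup>2 * (C4 + C2 * C * t) / real n"
  have V: "0 \<le> V" using C t by (simp add: V_def)
  have point: "(\<integral>\<^sup>+\<omega>. ennreal ((simple_val n ts \<xi> s \<omega> - ?Y s \<omega>)\<^sup>2) \<partial>M) \<le> ennreal V" if s: "0 \<le> s" "s < t" for s
  proof -
    obtain j where j: "j < n" "real j * h \<le> s" "s < real (Suc j) * h"
      using s step_index[OF h(1), of s n] unfolding h(2) by blast
    then have "ts j \<le> s" "s - ts j \<le> h" by (auto simp: ts_def distrib_right)
    then have j': "0 \<le> ts j" "ts j \<le> s" "ts j \<in> {0..t}" "s - ts j \<in> {0..t}" "s - ts j \<le> h"
      using s ts0[of j] tst[of j] j(1) by auto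
    have sv: "simple_val n ts \<xi> s \<omega> = \<xi> j \<omega>" for \<omega>
      unfolding simple_val_def ts_def by (rule step_sum_eq[OF h(1) j])
    let ?G = "gbm x a b (ts j)"
    have [measurable]: "gbm x a b s \<in> borel_measurable M" "?G \<in> borel_measurable M" using s j' by (auto intro: gbm_M)
    have 1: "(\<integral>\<^sup>+\<omega>. ennreal ((m * (?G \<omega> - min (?G \<omega>) (real n)))\<^sup>2) \<partial>M) \<le> ennreal (m\<^sup>2 * (C4 / real n))"
    proof -
      have "(\<integral>\<^sup>+\<omega>. ennreal ((m * (?G \<omega> - min (?G \<omega>) (real n)))\<^sup>2) \<partial>M) = ennreal (m\<^sup>2) * (\<integral>\<^sup>+\<omega>. ennreal ((?G \<omega> - min (?G \<omega>) (real n))\<^sup>2) \<partial>M)"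
        by (simp add: power_mult_distrib ennreal_mult nn_integral_cmult)
      also have "\<dots> \<le> ennreal (m\<^sup>2) * ennreal (C4 / (real n)\<^sup>2)"
        using x n C4[OF j'(3)] C j' by (intro mult_left_mono gbm_truncation) auto
      also have "\<dots> = ennreal (m\<^sup>2 * (C4 / (real n)\<^sup>2))" using C by (simp add: ennreal_mult[symmetric])
      also have "\<dots> \<le> ennreal (m\<^sup>2 * (C4 / real n))"
        using C n by (intro ennreal_leI mult_left_mono divide_left_mono) (auto simp: power2_eq_square)
      finally show ?thesis .
    qed
    have 2: "(\<integral>\<^sup>+\<omega>. ennreal ((m * (gbm x a b s \<omega> - ?G \<omega>))\<^sup>2) \<partial>M) \<le> ennreal (m\<^sup>2 * (C2 * (C * (t / real n))))"
    proof -
      have "(\<integral>\<^sup>+\<omega>. ennreal ((m * (gbm x a b s \<omega> - ?G \<omega>))\<^sup>2) \<partial>M) = ennreal (m\<^sup>2) * (\<integral>\<^sup>+\<omega>. ennreal ((gbm x a b s \<omega> - 1 * ?G \<omega> - 0 * (?G \<omega> * (W s \<omega> - W (ts j) \<omega>)))\<^sup>2) \<partial>M)"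
        by (simp add: power_mult_distrib ennreal_mult nn_integral_cmult)
      also have "\<dots> \<le> ennreal (m\<^sup>2) * ennreal (C2 * (C * (s - ts j)))"
        using Ca[OF j'(4)] C2[OF j'(3)] C j' by (intro mult_left_mono gbm_increment_square) auto
      also have "\<dots> = ennreal (m\<^sup>2 * (C2 * (C * (s - ts j))))" using C j' by (simp add: ennreal_mult)
      also have "\<dots> \<le> ennreal (m\<^sup>2 * (C2 * (C * (t / real n))))"
        using C j'(5) unfolding h_def by (intro ennreal_leI mult_left_mono) auto
      finally show ?thesis .
    qed
    have "(\<integral>\<^sup>+\<omega>. ennreal ((simple_val n ts \<xi> s \<omega> - ?Y s \<omega>)\<^sup>2) \<partial>M)
      = (\<integral>\<^sup>+\<omega>. ennreal ((m * (?G \<omega> - min (?G \<omega>) (real n)) + m * (gbm x a b s \<omega> - ?G \<omega>) + 0)\<^sup>2) \<partial>M)"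
      unfolding sv unfolding \<xi>_def by (intro nn_integral_cong arg_cong[where f=ennreal]) (simp add: algebra_simps power2_eq_square)
    also have "\<dots> \<le> 3 * ((\<integral>\<^sup>+\<omega>. ennreal ((m * (?G \<omega> - min (?G \<omega>) (real n)))\<^sup>2) \<partial>M) + (\<integral>\<^sup>+\<omega>. ennreal ((m * (gbm x a b s \<omega> - ?G \<omega>))\<^sup>2) \<partial>M) + (\<integral>\<^sup>+\<omega>. ennreal (0\<^sup>2) \<partial>M))"
      by (rule nn_integral_square_sum3) measurable
    also have "\<dots> \<le> 3 * (ennreal (m\<^sup>2 * (C4 / real n)) + ennreal (m\<^sup>2 * (C2 * (C * (t / real n)))) + 0)"
      using 1 2 by (intro mult_left_mono add_mono) auto
    also have "\<dots> = ennreal (3 * (m\<^sup>2 * (C4 / real n) + m\<^sup>2 * (C2 * (C * (t / real n)))))"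
      using C t by (subst ennreal_mult) (auto simp: ennreal_plus)
    also have "3 * (m\<^sup>2 * (C4 / real n) + m\<^sup>2 * (C2 * (C * (t / real n)))) = V"
      by (simp add: V_def algebra_simps add_divide_distrib)
    finally show ?thesis .
  qed
  have "(\<integral>\<^sup>+\<omega>. (\<integral>\<^sup>+s\<in>{0..t}. ennreal ((simple_val n ts \<xi> s \<omega> - ?Y s \<omega>)\<^sup>2) \<partial>lborel) \<partial>M)
     = (\<integral>\<^sup>+\<omega>. \<integral>\<^sup>+s. ennreal ((clip t (simple_val n ts \<xi>) (\<omega>, s) - clip t ?Y (\<omega>, s))\<^sup>2) \<partial>lborel \<partial>M)"
    by (intro nn_integral_cong) (auto simp: clip_def indicator_def)
  also have "\<dots> = (\<integral>\<^sup>+s. \<integral>\<^sup>+\<omega>. ennreal ((clip t (simple_val n ts \<xi>) (\<omega>, s) - clip t ?Y (\<omega>, s))\<^sup>2) \<partial>M \<partial>lborel)"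
    by (rule PL.Fubini'[symmetric]) measurable
  \<comment> \<open>The right endpoint \<open>t\<close> lies in none of the half-open steps; it is
    discarded as a null set.\<close>
  also have "\<dots> \<le> (\<integral>\<^sup>+s. ennreal V * indicator {0..t} s \<partial>lborel)"
    using AE_lborel_singleton[of t]
  proof (intro nn_integral_mono_AE, eventually_elim)
    case (elim s)
    show ?case using point[of s] elim by (cases "s \<in> {0..t}") (auto simp: clip_def)
  qed
  also have "\<dots> = ennreal (V * t)" using V t by (simp add: nn_integral_cmult_indicator ennreal_mult)
  also have "V * t = 3 * t * m\<^sup>2 * (C4 + C2 * C * t) / real n" by (simp add: V_def)
  finally show "(\<integral>\<^sup>+\<omega>. (\<integral>\<^sup>+s\<in>{0..t}. ennreal ((simple_val n ts \<xi> s \<omega> - m * gbm x a b s \<omega>)\<^sup>2) \<partial>lborel) \<partial>M)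
       \<le> ennreal (3 * t * m\<^sup>2 * (C4 + C2 * C * t) / real n)" .
qed

text \<open>\<open>I\<close> is what the integral of \<open>m\<close> times the process must be if
  the process solves its linear equation. The difference from the Riemann sum splits into pairwise
  orthogonal errors \<open>d i\<close>, whose squares add up, and a time-integral remainder
  \<open>R\<close>, for which Cauchy-Schwarz suffices.\<close>

lemma gbm_stoch_int_error:
  fixes x a b m t C2 C4 C :: real and n :: nat
  assumes x: "0 \<le> x" and b: "b \<noteq> 0" and t: "0 < t" and n: "0 < n" and C: "0 \<le> C" "0 \<le> C2" "0 \<le> C4"
    and C2: "\<And>s. s \<in> {0..t} \<Longrightarrow> (\<integral>\<^sup>+\<omega>. ennreal ((gbm x a b s \<omega>)\<^sup>2) \<partial>M) \<le> ennreal C2"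
    and C4: "\<And>s. s \<in> {0..t} \<Longrightarrow> (\<integral>\<^sup>+\<omega>. ennreal (gbm x a b s \<omega> ^ 4) \<partial>M) \<le> ennreal C4"
    and Cb: "\<And>\<tau>. \<tau> \<in> {0..t} \<Longrightarrow> exp ((2 * a + b\<^sup>2) * \<tau>) + (exp (a * \<tau>))\<^sup>2 - 2 * exp (a * \<tau>) * exp (a * \<tau>) \<le> C * \<tau>"
    and Cc: "\<And>\<tau>. \<tau> \<in> {0..t} \<Longrightarrow> exp ((2 * a + b\<^sup>2) * \<tau>) + (exp (a * \<tau>))\<^sup>2 + b\<^sup>2 * \<tau> - 2 * exp (a * \<tau>) * exp (a * \<tau>) - 2 * b * b * \<tau> * exp (a * \<tau>) \<le> C * \<tau>\<^sup>2"
  defines "h \<equiv> t / real n"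
  defines "ts \<equiv> \<lambda>i. real i * h"
  defines "\<xi> \<equiv> \<lambda>i \<omega>. m * min (gbm x a b (ts i) \<omega>) (real n)"
  defines "I \<equiv> \<lambda>\<omega>. m / b * (gbm x a b t \<omega> - x - a * (\<integral>s. clip t (gbm x a b) (\<omega>, s) \<partial>lborel))"
  defines "Q \<equiv> 3 * ((m / b)\<^sup>2 * (3 * (C2 * C * t\<^sup>2 + b\<^sup>2 * C4 * t)) + (m * a / b)\<^sup>2 * (t * (C2 * C * t\<^sup>2)))"
  shows "(\<integral>\<^sup>+\<omega>. ennreal ((I \<omega> - simple_stoch_int W n ts \<xi> t \<omega>)\<^sup>2) \<partial>M) \<le> ennreal (Q / real n)"
proof -
  let ?P = "M \<Otimes>\<^sub>M lborel"
  have h: "0 < h" "real n * h = t" using t n by (auto simp: h_def)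
  have ts0: "0 \<le> ts i" for i using h by (simp add: ts_def)
  have tsS: "ts (Suc i) - ts i = h" for i by (simp add: ts_def distrib_right)
  have ts_mono: "ts i \<le> ts j" if "i \<le> j" for i j
    using that h unfolding ts_def by (intro mult_right_mono) auto
  have tsn: "ts n = t" by (simp add: ts_def h)
  have tst: "ts i \<in> {0..t}" if "i \<le> n" for i using ts_mono[OF that] ts0[of i] tsn by simp
  have ht: "h \<in> {0..t}" using tst[of 1] n h by (simp add: ts_def)
  define Y where "Y = gbm x a b"
  have Y0: "0 \<le> Y s \<omega>" for s \<omega> using gbm_nonneg[OF x] by (simp add: Y_def)
  have YM [measurable]: "Y (ts i) \<in> borel_measurable M" for i unfolding Y_def using ts0 by (rule gbm_M)
  have WM [measurable]: "W (ts i) \<in> borel_measurable M" for i using ts0 by (rule W_M)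
  have Ysq: "integrable M (\<lambda>\<omega>. (Y (ts i) \<omega>)\<^sup>2)" if "i \<le> n" for i
    using C2[OF tst[OF that]] unfolding Y_def[symmetric] by (intro integrableI_bounded) (auto intro: le_less_trans)
  define \<Delta> where "\<Delta> i \<omega> = W (ts (Suc i)) \<omega> - W (ts i) \<omega>" for i \<omega>
  define k where "k i \<omega> = Y (ts i) \<omega> - min (Y (ts i) \<omega>) (real n)" for i \<omega>
  have k0: "0 \<le> k i \<omega>" "k i \<omega> \<le> Y (ts i) \<omega>" for i \<omega> using Y0[of "ts i" \<omega>] by (auto simp: k_def min_def)
  have [measurable]: "k i \<in> borel_measurable M" "\<Delta> i \<in> borel_measurable M" for i unfolding k_def[abs_def] \<Delta>_def[abs_def] by measurable
  \<comment> \<open>Subtracting \<open>exp (a * h)\<close> times the left value, rather than the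
    left value plus its linear drift, gives \<open>d i\<close> conditional mean exactly zero;
    orthogonality is then exact.\<close>
  define d where "d i \<omega> = Y (ts (Suc i)) \<omega> - exp (a * h) * Y (ts i) \<omega> - b * (min (Y (ts i) \<omega>) (real n) * \<Delta> i \<omega>)" for i \<omega>
  define A where "A i \<omega> = Y (ts (Suc i)) \<omega> - exp (a * h) * Y (ts i) \<omega> - b * (Y (ts i) \<omega> * \<Delta> i \<omega>)" for i \<omega>
  have [measurable]: "d i \<in> borel_measurable M" "A i \<in> borel_measurable M" for i unfolding d_def[abs_def] A_def[abs_def] by measurable
  \<comment> \<open>The error without truncation, of second order in \<open>h\<close> in mean
    square, plus the contribution of the truncated excess \<open>k\<close>.\<close>
  have dA: "d i \<omega> = A i \<omega> + b * (k i \<omega> * \<Delta> i \<omega>) + 0" for i \<omega> by (simp add: d_def A_def k_def algebra_simps)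
  define v where "v = 3 * (C2 * (C * h\<^sup>2) + b\<^sup>2 * (C4 / (real n)\<^sup>2 * h))"
  have v0: "0 \<le> v" using C h by (auto simp: v_def)
  have dsq: "(\<integral>\<^sup>+\<omega>. ennreal ((d i \<omega>)\<^sup>2) \<partial>M) \<le> ennreal v" if i: "i < n" for i
  proof -
    have ti: "ts i \<in> {0..t}" using i by (intro tst) simp
    have "(\<integral>\<^sup>+\<omega>. ennreal ((A i \<omega>)\<^sup>2) \<partial>M) \<le> ennreal (C2 * (C * h\<^sup>2))"
      unfolding A_def \<Delta>_def Y_def
      by (rule gbm_increment_square) (use ts0 ts_mono[of i "Suc i"] Cc[OF ht] C2[OF ti] C in \<open>auto simp: tsS\<close>)
    moreover have "(\<integral>\<^sup>+\<omega>. ennreal ((b * (k i \<omega> * \<Delta> i \<omega>))\<^sup>2) \<partial>M) \<le> ennreal (b\<^sup>2 * (C4 / (real n)\<^sup>2 * h))"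
    proof -
      have [measurable]: "Y (ts i) \<in> borel_measurable (F (ts i))" unfolding Y_def using ts0 by (intro gbm_F) auto
      have "(\<integral>\<^sup>+\<omega>. ennreal ((b * (k i \<omega> * \<Delta> i \<omega>))\<^sup>2) \<partial>M) = ennreal (b\<^sup>2) * (\<integral>\<^sup>+\<omega>. ennreal ((k i \<omega>)\<^sup>2) * ennreal ((\<Delta> i \<omega>)\<^sup>2) \<partial>M)"
        by (simp add: power_mult_distrib ennreal_mult nn_integral_cmult)
      also have "(\<integral>\<^sup>+\<omega>. ennreal ((k i \<omega>)\<^sup>2) * ennreal ((\<Delta> i \<omega>)\<^sup>2) \<partial>M) = (\<integral>\<^sup>+\<omega>. ennreal ((k i \<omega>)\<^sup>2) \<partial>M) * (\<integral>\<^sup>+\<omega>. ennreal ((\<Delta> i \<omega>)\<^sup>2) \<partial>M)"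
        unfolding \<Delta>_def by (rule nn_integral_increment[where g="\<lambda>w. ennreal (w\<^sup>2)", OF ts0 ts_mono]) (auto simp: k_def)
      also have "(\<integral>\<^sup>+\<omega>. ennreal ((\<Delta> i \<omega>)\<^sup>2) \<partial>M) = ennreal h"
        using has_integral_increment_sq[OF ts0 ts_mono[of i "Suc i"]] unfolding \<Delta>_def tsS
        by (subst nn_integral_eq_integral) (auto simp: has_bochner_integral_iff)
      also have "(\<integral>\<^sup>+\<omega>. ennreal ((k i \<omega>)\<^sup>2) \<partial>M) * ennreal h \<le> ennreal (C4 / (real n)\<^sup>2) * ennreal h"
        unfolding k_def Y_def using x n C4[OF ti] C ts0 by (intro mult_right_mono gbm_truncation) auto
      finally have "(\<integral>\<^sup>+\<omega>. ennreal ((b * (k i \<omega> * \<Delta> i \<omega>))\<^sup>2) \<partial>M) \<le> ennreal (b\<^sup>2) * (ennreal (C4 / (real n)\<^sup>2) * ennreal h)"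
        by (simp add: mult_left_mono)
      also have "\<dots> = ennreal (b\<^sup>2 * (C4 / (real n)\<^sup>2 * h))" using C h by (simp add: ennreal_mult[symmetric])
      finally show ?thesis .
    qed
    moreover have "(\<integral>\<^sup>+\<omega>. ennreal ((d i \<omega>)\<^sup>2) \<partial>M) \<le> 3 * ((\<integral>\<^sup>+\<omega>. ennreal ((A i \<omega>)\<^sup>2) \<partial>M) + (\<integral>\<^sup>+\<omega>. ennreal ((b * (k i \<omega> * \<Delta> i \<omega>))\<^sup>2) \<partial>M) + (\<integral>\<^sup>+\<omega>. ennreal (0\<^sup>2) \<partial>M))"
      unfolding dA by (rule nn_integral_square_sum3) measurable
    ultimately have "(\<integral>\<^sup>+\<omega>. ennreal ((d i \<omega>)\<^sup>2) \<partial>M) \<le> 3 * (ennreal (C2 * (C * h\<^sup>2)) + ennreal (b\<^sup>2 * (C4 / (real n)\<^sup>2 * h)) + 0)"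
      by (elim order_trans) (auto intro!: mult_left_mono add_mono)
    also have "\<dots> = ennreal v" unfolding v_def using C h by (subst ennreal_mult) (auto simp: ennreal_plus)
    finally show ?thesis .
  qed
  have dint: "integrable M (\<lambda>\<omega>. (d i \<omega>)\<^sup>2)" if "i < n" for i
    using dsq[OF that] by (intro integrableI_bounded) (auto intro: le_less_trans)
  have orth: "(\<integral>\<omega>. d i \<omega> * d j \<omega> \<partial>M) = 0" if ij: "i < j" "j < n" for i j
  proof -
    have [measurable]: "d i \<in> borel_measurable (F (ts j))" "Y (ts j) \<in> borel_measurable (F (ts j))"
    proof -
      have [measurable]: "Y (ts i) \<in> borel_measurable (F (ts j))" "Y (ts (Suc i)) \<in> borel_measurable (F (ts j))"
        "W (ts i) \<in> borel_measurable (F (ts j))" "W (ts (Suc i)) \<in> borel_measurable (F (ts j))"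
        unfolding Y_def using ij ts0 ts_mono by (auto intro!: gbm_F W_F)
      show "d i \<in> borel_measurable (F (ts j))" unfolding d_def[abs_def] \<Delta>_def by measurable
      show "Y (ts j) \<in> borel_measurable (F (ts j))" unfolding Y_def using ts0 by (intro gbm_F) auto
    qed
    have [measurable]: "k j \<in> borel_measurable (F (ts j))" unfolding k_def[abs_def] by measurable
    have ksq: "integrable M (\<lambda>\<omega>. (k j \<omega>)\<^sup>2)"
      using k0[of j] by (intro Bochner_Integration.integrable_bound[OF Ysq[of j]]) (use ij in \<open>auto intro!: power_mono\<close>)
    have i1: "integrable M (\<lambda>\<omega>. d i \<omega> * Y (ts j) \<omega>)" and i2: "integrable M (\<lambda>\<omega>. d i \<omega> * k j \<omega>)"
      using ij ksq by (auto intro!: integrable_mult_square_integrable dint Ysq)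
    let ?g = "\<lambda>w. ratio a b h w - exp (a * h) - b * w"
    have gm [measurable]: "?g \<in> borel_measurable borel" unfolding ratio_def[abs_def] by measurable
    have rm: "has_bochner_integral M (\<lambda>\<omega>. ?g (\<Delta> j \<omega>)) 0"
    proof -
      have "has_bochner_integral M (\<lambda>\<omega>. ratio a b h (\<Delta> j \<omega>) - exp (a * h) - b * \<Delta> j \<omega>) (exp (a * h) - exp (a * h) - b * 0)"
        using ratio_moments(1)[OF ts0 ts_mono[of j "Suc j"], of a b] has_integral_increment[OF ts0 ts_mono[of j "Suc j"]]
        unfolding \<Delta>_def[symmetric] tsS
        by (intro has_bochner_integral_diff has_bochner_integral_mult_right) (auto simp: has_bochner_integral_iff prob_space)
      then show ?thesis by simp
    qed
    have 1: "has_bochner_integral M (\<lambda>\<omega>. d i \<omega> * Y (ts j) \<omega> * ?g (\<Delta> j \<omega>)) 0"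
      using integrable_increment[OF ts0 ts_mono[of j "Suc j"] _ i1 gm] integral_increment[OF ts0 ts_mono[of j "Suc j"] _ i1 gm] rm
      unfolding \<Delta>_def[symmetric] by (simp add: has_bochner_integral_iff)
    have 2: "has_bochner_integral M (\<lambda>\<omega>. d i \<omega> * k j \<omega> * \<Delta> j \<omega>) 0"
      unfolding \<Delta>_def using i2 by (intro increment_mean_zero ts0 ts_mono) auto
    \<comment> \<open>For \<open>i < j\<close> the earlier error is known at \<open>ts j\<close>,
      while both parts of the later one contain a mean-zero function of the increment after
      \<open>ts j\<close>.\<close>
    have "d i \<omega> * d j \<omega> = d i \<omega> * Y (ts j) \<omega> * ?g (\<Delta> j \<omega>) + b * (d i \<omega> * k j \<omega> * \<Delta> j \<omega>)" for \<omega>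
    proof -
      have "Y (ts (Suc j)) \<omega> = Y (ts j) \<omega> * ratio a b h (\<Delta> j \<omega>)"
        unfolding Y_def \<Delta>_def tsS[of j, symmetric] by (rule gbm_ratio)
      then have dj: "d j \<omega> = Y (ts j) \<omega> * ?g (\<Delta> j \<omega>) + b * (k j \<omega> * \<Delta> j \<omega>)" by (simp add: d_def k_def algebra_simps)
      show ?thesis unfolding dj by (simp add: algebra_simps)
    qed
    then show ?thesis using has_bochner_integral_add[OF 1 has_bochner_integral_mult_right[OF 2, of b]]
      by (simp add: has_bochner_integral_iff)
  qed
  have sumd: "(\<integral>\<^sup>+\<omega>. ennreal ((\<Sum>i<n. d i \<omega>)\<^sup>2) \<partial>M) \<le> ennreal (3 * (C2 * C * t\<^sup>2 + b\<^sup>2 * C4 * t) / real n)"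
  proof -
    have "(\<integral>\<^sup>+\<omega>. ennreal ((\<Sum>i<n. d i \<omega>)\<^sup>2) \<partial>M) = (\<Sum>i<n. \<integral>\<^sup>+\<omega>. ennreal ((d i \<omega>)\<^sup>2) \<partial>M)"
      by (rule nn_integral_square_orthogonal_sum) (use dint orth in auto)
    also have "\<dots> \<le> of_nat (card {..<n}) * ennreal v" by (intro sum_bounded_above dsq) auto
    also have "\<dots> = ennreal (real n * v)" using v0 by (simp add: ennreal_mult ennreal_of_nat_eq_real_of_nat)
    also have "real n * v = 3 * (C2 * C * t\<^sup>2) / real n + 3 * (b\<^sup>2 * C4 * t) / (real n)\<^sup>2"
      using n by (simp add: v_def h_def field_simps power2_eq_square)
    also have "ennreal \<dots> \<le> ennreal (3 * (C2 * C * t\<^sup>2) / real n + 3 * (b\<^sup>2 * C4 * t) / real n)"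
      using C t n by (intro ennreal_leI add_left_mono divide_left_mono) (auto simp: power2_eq_square)
    finally show ?thesis by (simp add: add_divide_distrib distrib_left)
  qed
  \<comment> \<open>On each step the left value is grown deterministically at rate \<open>a\<close>.
    The integral of \<open>a * Z\<close> over a step is then exactly
    \<open>(exp (a * h) - 1)\<close> times the left value, matching the mean growth subtracted in
    \<open>d\<close>.\<close>
  define Z where "Z s \<omega> = (\<Sum>i<n. if ts i \<le> s \<and> s < ts (Suc i) then exp (a * (s - ts i)) * Y (ts i) \<omega> else 0)" for s \<omega>
  define R where "R \<omega> = (\<integral>s. indicator {0..t} s * (Y s \<omega> - Z s \<omega>) \<partial>lborel)" for \<omega>
  have [measurable]: "(\<lambda>z. Z (snd z) (fst z)) \<in> borel_measurable ?P"
    unfolding Z_def[abs_def] by measurable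
  have clipZ [measurable]: "clip t Z \<in> borel_measurable ?P" unfolding clip_def[abs_def] by measurable
  have clipY [measurable]: "clip t Y \<in> borel_measurable ?P" unfolding Y_def using t by (intro progressive_clip progressive_gbm) auto
  have RYZ: "R \<omega> = (\<integral>s. indicator {0..t} s * (clip t Y (\<omega>, s) - clip t Z (\<omega>, s)) \<partial>lborel)" for \<omega>
    unfolding R_def by (intro Bochner_Integration.integral_cong) (auto simp: clip_def indicator_def)
  have [measurable]: "R \<in> borel_measurable M" unfolding RYZ[abs_def] by measurable
  have intYZ: "integrable lborel (\<lambda>s. indicator {0..t} s * Y s \<omega>)" "integrable lborel (\<lambda>s. indicator {0..t} s * (a * Z s \<omega>))"
      "(\<integral>s. indicator {0..t} s * (a * Z s \<omega>) \<partial>lborel) = (\<Sum>i<n. (exp (a * h) - 1) * Y (ts i) \<omega>)"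
    if \<omega>: "\<omega> \<in> space M" for \<omega>
  proof -
    have "continuous_on {0..t} (\<lambda>s. Y s \<omega>)"
      unfolding Y_def gbm_def expm_def
      by (intro continuous_intros continuous_on_subset[OF W_continuous[OF \<omega>]]) auto
    from borel_integrable_atLeastAtMost'[OF this] show "integrable lborel (\<lambda>s. indicator {0..t} s * Y s \<omega>)"
      by (simp add: set_integrable_def)
    have "has_bochner_integral lborel (\<lambda>s. \<Sum>i<n. indicator {0..t} s * (a * (if ts i \<le> s \<and> s < ts (Suc i) then exp (a * (s - ts i)) * Y (ts i) \<omega> else 0)))
        (\<Sum>i<n. (exp (a * h) - 1) * Y (ts i) \<omega>)"
    proof (rule has_bochner_integral_sum)
      fix i assume "i \<in> {..<n}"
      then have i: "Suc i \<le> n" by simp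
      have "has_bochner_integral lborel (\<lambda>s. a * exp (a * (s - ts i)) * indicator {ts i..ts (Suc i)} s) (exp (a * (ts (Suc i) - ts i)) - exp (a * (ts i - ts i)))"
        using ts_mono[of i "Suc i"] by (intro has_bochner_integral_FTC_Icc_real) (auto intro!: derivative_eq_intros continuous_intros)
      from has_bochner_integral_mult_left[OF this, of "Y (ts i) \<omega>"]
      have hb: "has_bochner_integral lborel (\<lambda>s. a * exp (a * (s - ts i)) * indicator {ts i..ts (Suc i)} s * Y (ts i) \<omega>) ((exp (a * h) - 1) * Y (ts i) \<omega>)"
        unfolding tsS by simp
      \<comment> \<open>The closed interval from the fundamental theorem and the half-open step
        differ at the right endpoint only.\<close>
      have eq: "AE s in lborel. a * exp (a * (s - ts i)) * indicator {ts i..ts (Suc i)} s * Y (ts i) \<omega> =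
          indicator {0..t} s * (a * (if ts i \<le> s \<and> s < ts (Suc i) then exp (a * (s - ts i)) * Y (ts i) \<omega> else 0))"
        using AE_lborel_singleton[of "ts (Suc i)"]
        by eventually_elim (use ts0[of i] tst[OF i] in \<open>auto simp: indicator_def\<close>)
      show "has_bochner_integral lborel (\<lambda>s. indicator {0..t} s * (a * (if ts i \<le> s \<and> s < ts (Suc i) then exp (a * (s - ts i)) * Y (ts i) \<omega> else 0))) ((exp (a * h) - 1) * Y (ts i) \<omega>)"
        by (rule has_bochner_integral_cong_AE[THEN iffD1, OF _ _ eq hb]) measurable
    qed
    then have "has_bochner_integral lborel (\<lambda>s. indicator {0..t} s * (a * Z s \<omega>)) (\<Sum>i<n. (exp (a * h) - 1) * Y (ts i) \<omega>)"
      by (simp add: Z_def sum_distrib_left)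
    then show "integrable lborel (\<lambda>s. indicator {0..t} s * (a * Z s \<omega>))"
      "(\<integral>s. indicator {0..t} s * (a * Z s \<omega>) \<partial>lborel) = (\<Sum>i<n. (exp (a * h) - 1) * Y (ts i) \<omega>)"
      by (auto simp: has_bochner_integral_iff)
  qed
  have Zpoint: "(\<integral>\<^sup>+\<omega>. ennreal ((Y s \<omega> - Z s \<omega>)\<^sup>2) \<partial>M) \<le> ennreal (C2 * (C * h))" if s: "0 \<le> s" "s < t" for s
  proof -
    obtain j where j: "j < n" "real j * h \<le> s" "s < real (Suc j) * h"
      using s step_index[OF h(1), of s n] unfolding h(2) by blast
    then have "ts j \<le> s" "s - ts j \<le> h" by (auto simp: ts_def distrib_right)
    then have j': "0 \<le> ts j" "ts j \<le> s" "ts j \<in> {0..t}" "s - ts j \<in> {0..t}" "s - ts j \<le> h"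
      using s ts0[of j] tst[of j] j(1) by auto
    have Zs: "Z s \<omega> = exp (a * (s - ts j)) * Y (ts j) \<omega>" for \<omega>
      unfolding Z_def ts_def by (rule step_sum_eq[OF h(1) j])
    have "(\<integral>\<^sup>+\<omega>. ennreal ((Y s \<omega> - Z s \<omega>)\<^sup>2) \<partial>M) = (\<integral>\<^sup>+\<omega>. ennreal ((gbm x a b s \<omega> - exp (a * (s - ts j)) * gbm x a b (ts j) \<omega> - 0 * (gbm x a b (ts j) \<omega> * (W s \<omega> - W (ts j) \<omega>)))\<^sup>2) \<partial>M)"
      unfolding Zs Y_def by simp
    also have "\<dots> \<le> ennreal (C2 * (C * (s - ts j)))"
      by (rule gbm_increment_square) (use j' Cb[OF j'(4)] C2[OF j'(3)] C in auto)
    also have "\<dots> \<le> ennreal (C2 * (C * h))" using C j'(5) by (intro ennreal_leI mult_left_mono) auto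
    finally show ?thesis .
  qed
  have Rsq: "(\<integral>\<^sup>+\<omega>. ennreal ((R \<omega>)\<^sup>2) \<partial>M) \<le> ennreal (t * (C2 * C * t\<^sup>2) / real n)"
  proof -
    have "(\<integral>\<^sup>+\<omega>. ennreal ((R \<omega>)\<^sup>2) \<partial>M) \<le> (\<integral>\<^sup>+\<omega>. ennreal t * (\<integral>\<^sup>+s\<in>{0..t}. ennreal ((clip t Y (\<omega>, s) - clip t Z (\<omega>, s))\<^sup>2) \<partial>lborel) \<partial>M)"
    proof (rule nn_integral_mono)
      fix \<omega> assume "\<omega> \<in> space M"
      then have "(\<lambda>s. clip t Y (\<omega>, s) - clip t Z (\<omega>, s)) \<in> borel_measurable lborel" by measurable
      then show "ennreal ((R \<omega>)\<^sup>2) \<le> ennreal t * (\<integral>\<^sup>+s\<in>{0..t}. ennreal ((clip t Y (\<omega>, s) - clip t Z (\<omega>, s))\<^sup>2) \<partial>lborel)"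
        unfolding RYZ using t by (intro ennreal_integral_square_le) auto
    qed
    also have "\<dots> = ennreal t * (\<integral>\<^sup>+\<omega>. (\<integral>\<^sup>+s\<in>{0..t}. ennreal ((clip t Y (\<omega>, s) - clip t Z (\<omega>, s))\<^sup>2) \<partial>lborel) \<partial>M)"
      by (rule nn_integral_cmult) measurable
    also have "(\<integral>\<^sup>+\<omega>. (\<integral>\<^sup>+s\<in>{0..t}. ennreal ((clip t Y (\<omega>, s) - clip t Z (\<omega>, s))\<^sup>2) \<partial>lborel) \<partial>M)
      = (\<integral>\<^sup>+s. (\<integral>\<^sup>+\<omega>. ennreal ((clip t Y (\<omega>, s) - clip t Z (\<omega>, s))\<^sup>2) * indicator {0..t} s \<partial>M) \<partial>lborel)"
      by (rule PL.Fubini'[symmetric]) measurable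
    also have "\<dots> \<le> (\<integral>\<^sup>+s. ennreal (C2 * (C * h)) * indicator {0..t} s \<partial>lborel)"
      using AE_lborel_singleton[of t]
    proof (intro nn_integral_mono_AE, eventually_elim)
      case (elim s)
      show ?case using Zpoint[of s] elim by (cases "s \<in> {0..t}") (auto simp: clip_def)
    qed
    also have "\<dots> = ennreal (C2 * (C * h) * t)" using C h t by (simp add: nn_integral_cmult_indicator ennreal_mult)
    also have "ennreal t * ennreal (C2 * (C * h) * t) = ennreal (t * (C2 * C * t\<^sup>2) / real n)"
      using C h t by (subst ennreal_mult[symmetric]) (auto simp: h_def power2_eq_square mult_ac)
    finally show ?thesis by (simp add: mult_left_mono)
  qed
  \<comment> \<open>Telescoping the process and inserting the exact step integrals of
    \<open>a * Z\<close> leaves the errors \<open>d i\<close> and the integral of the process minus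
    \<open>Z\<close>; the zero summand fits the three-term estimate.\<close>
  have err: "I \<omega> - simple_stoch_int W n ts \<xi> t \<omega> = m / b * (\<Sum>i<n. d i \<omega>) + (- (m * a / b)) * R \<omega> + 0" if \<omega>: "\<omega> \<in> space M" for \<omega>
  proof -
    have S: "simple_stoch_int W n ts \<xi> t \<omega> = (\<Sum>i<n. m * (min (Y (ts i) \<omega>) (real n) * \<Delta> i \<omega>))"
      unfolding simple_stoch_int_def
    proof (rule sum.cong[OF refl])
      fix i assume "i \<in> {..<n}"
      then have "min t (ts (Suc i)) = ts (Suc i)" "min t (ts i) = ts i" using tst[of i] tst[of "Suc i"] by auto
      then show "\<xi> i \<omega> * (W (min t (ts (Suc i))) \<omega> - W (min t (ts i)) \<omega>) = m * (min (Y (ts i) \<omega>) (real n) * \<Delta> i \<omega>)"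
        by (simp add: \<xi>_def \<Delta>_def Y_def)
    qed
    have tel: "Y t \<omega> - x = (\<Sum>i<n. Y (ts (Suc i)) \<omega> - Y (ts i) \<omega>)"
      using sum_lessThan_telescope[of "\<lambda>i. Y (ts i) \<omega>" n] gbm_0[OF \<omega>, of x a b] by (simp add: tsn ts_def Y_def h(2))
    have "(\<integral>s. clip t Y (\<omega>, s) \<partial>lborel) = (\<integral>s. indicator {0..t} s * Y s \<omega> \<partial>lborel)"
      by (intro Bochner_Integration.integral_cong) (auto simp: clip_def indicator_def)
    then have "a * (\<integral>s. clip t Y (\<omega>, s) \<partial>lborel) = (\<integral>s. a * (indicator {0..t} s * Y s \<omega>) \<partial>lborel)" by simp
    also have "\<dots> = (\<integral>s. (a * (indicator {0..t} s * Y s \<omega>) - indicator {0..t} s * (a * Z s \<omega>)) + indicator {0..t} s * (a * Z s \<omega>) \<partial>lborel)" by simp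
    also have "\<dots> = (\<integral>s. a * (indicator {0..t} s * Y s \<omega>) - indicator {0..t} s * (a * Z s \<omega>) \<partial>lborel) + (\<Sum>i<n. (exp (a * h) - 1) * Y (ts i) \<omega>)"
      unfolding intYZ(3)[OF \<omega>, symmetric]
      by (rule Bochner_Integration.integral_add) (use intYZ(1,2)[OF \<omega>] in auto)
    also have "(\<integral>s. a * (indicator {0..t} s * Y s \<omega>) - indicator {0..t} s * (a * Z s \<omega>) \<partial>lborel) = a * R \<omega>"
      unfolding R_def integral_mult_right_zero[symmetric] by (intro Bochner_Integration.integral_cong) (auto simp: algebra_simps)
    finally have aint: "a * (\<integral>s. clip t Y (\<omega>, s) \<partial>lborel) = a * R \<omega> + (\<Sum>i<n. (exp (a * h) - 1) * Y (ts i) \<omega>)" .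
    have sd: "(\<Sum>i<n. d i \<omega>) = (\<Sum>i<n. Y (ts (Suc i)) \<omega> - Y (ts i) \<omega>) - (\<Sum>i<n. (exp (a * h) - 1) * Y (ts i) \<omega>) - b * (\<Sum>i<n. min (Y (ts i) \<omega>) (real n) * \<Delta> i \<omega>)"
      unfolding sum_distrib_left[of b] sum_subtractf[symmetric] by (intro sum.cong refl) (simp add: d_def algebra_simps)
    have "I \<omega> = m / b * ((\<Sum>i<n. d i \<omega>) - a * R \<omega> + b * (\<Sum>i<n. min (Y (ts i) \<omega>) (real n) * \<Delta> i \<omega>))"
      unfolding I_def Y_def[symmetric] aint tel sd by simp
    then show ?thesis
      unfolding S sum_distrib_left[of m, symmetric] using b by (simp add: algebra_simps add_divide_distrib diff_divide_distrib)
  qed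
  have "(\<integral>\<^sup>+\<omega>. ennreal ((I \<omega> - simple_stoch_int W n ts \<xi> t \<omega>)\<^sup>2) \<partial>M) = (\<integral>\<^sup>+\<omega>. ennreal ((m / b * (\<Sum>i<n. d i \<omega>) + (- (m * a / b)) * R \<omega> + 0)\<^sup>2) \<partial>M)"
    by (intro nn_integral_cong) (simp only: err)
  also have "\<dots> \<le> 3 * ((\<integral>\<^sup>+\<omega>. ennreal ((m / b * (\<Sum>i<n. d i \<omega>))\<^sup>2) \<partial>M) + (\<integral>\<^sup>+\<omega>. ennreal ((- (m * a / b) * R \<omega>)\<^sup>2) \<partial>M) + (\<integral>\<^sup>+\<omega>. ennreal (0\<^sup>2) \<partial>M))"
    by (rule nn_integral_square_sum3) measurable
  also have "(\<integral>\<^sup>+\<omega>. ennreal ((m / b * (\<Sum>i<n. d i \<omega>))\<^sup>2) \<partial>M) = ennreal ((m / b)\<^sup>2) * (\<integral>\<^sup>+\<omega>. ennreal ((\<Sum>i<n. d i \<omega>)\<^sup>2) \<partial>M)"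
    unfolding power_mult_distrib by (subst ennreal_mult) (auto intro!: nn_integral_cmult)
  also have "(\<integral>\<^sup>+\<omega>. ennreal ((- (m * a / b) * R \<omega>)\<^sup>2) \<partial>M) = ennreal ((m * a / b)\<^sup>2) * (\<integral>\<^sup>+\<omega>. ennreal ((R \<omega>)\<^sup>2) \<partial>M)"
    unfolding power_mult_distrib power2_minus by (subst ennreal_mult) (auto intro!: nn_integral_cmult)
  also have "3 * (ennreal ((m / b)\<^sup>2) * (\<integral>\<^sup>+\<omega>. ennreal ((\<Sum>i<n. d i \<omega>)\<^sup>2) \<partial>M) + ennreal ((m * a / b)\<^sup>2) * (\<integral>\<^sup>+\<omega>. ennreal ((R \<omega>)\<^sup>2) \<partial>M) + (\<integral>\<^sup>+\<omega>. ennreal (0\<^sup>2) \<partial>M))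
     \<le> 3 * (ennreal ((m / b)\<^sup>2) * ennreal (3 * (C2 * C * t\<^sup>2 + b\<^sup>2 * C4 * t) / real n) + ennreal ((m * a / b)\<^sup>2) * ennreal (t * (C2 * C * t\<^sup>2) / real n) + 0)"
    using sumd Rsq by (intro mult_left_mono add_mono) auto
  also have "\<dots> = ennreal (3 * ((m / b)\<^sup>2 * (3 * (C2 * C * t\<^sup>2 + b\<^sup>2 * C4 * t) / real n) + (m * a / b)\<^sup>2 * (t * (C2 * C * t\<^sup>2) / real n)))"
  proof -
    have nn: "0 \<le> (m / b)\<^sup>2 * (3 * (C2 * C * t\<^sup>2 + b\<^sup>2 * C4 * t) / real n)" "0 \<le> (m * a / b)\<^sup>2 * (t * (C2 * C * t\<^sup>2) / real n)"
      using C t by (auto intro!: mult_nonneg_nonneg divide_nonneg_nonneg add_nonneg_nonneg)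
    show ?thesis
      by (simp only: ennreal_mult'[OF zero_le_numeral[of _]] ennreal_plus[OF nn] ennreal_mult'[OF zero_le_power2] ennreal_numeral add_0_right)
  qed
  also have "3 * ((m / b)\<^sup>2 * (3 * (C2 * C * t\<^sup>2 + b\<^sup>2 * C4 * t) / real n) + (m * a / b)\<^sup>2 * (t * (C2 * C * t\<^sup>2) / real n)) = Q / real n"
    unfolding Q_def by (simp add: divide_inverse algebra_simps)
  finally show ?thesis .
qed

text \<open>The integral is written as the linear equation solved for it, and the two preceding
  error estimates, both of order \<open>1 / n\<close>, show that this guess is the mean-square
  limit. No Ito formula enters.\<close>

lemma ito_integral_gbm:
  assumes x: "0 \<le> x" and b: "b \<noteq> 0"
  shows "ito_integral M F W (\<lambda>t \<omega>. m * gbm x a b t \<omega>)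
    (\<lambda>t \<omega>. m / b * (gbm x a b t \<omega> - x - a * (\<integral>s. clip t (gbm x a b) (\<omega>, s) \<partial>lborel)))"
  unfolding ito_integral_def
proof (intro allI impI conjI)
  fix t :: real assume t: "0 \<le> t"
  let ?I = "\<lambda>\<omega>. m / b * (gbm x a b t \<omega> - x - a * (\<integral>s. clip t (gbm x a b) (\<omega>, s) \<partial>lborel))"
  have [measurable]: "clip t (gbm x a b) \<in> borel_measurable (M \<Otimes>\<^sub>M lborel)" "gbm x a b t \<in> borel_measurable M"
    using t by (auto intro: progressive_clip progressive_gbm gbm_M)
  show "?I \<in> borel_measurable M" by measurable
  show "\<exists>N TS \<Xi>. (\<forall>j. simple_adapted M F (N j) (TS j) (\<Xi> j)) \<and>
     ((\<lambda>j. \<integral>\<^sup>+\<omega>. (\<integral>\<^sup>+s\<in>{0..t}. ennreal ((simple_val (N j) (TS j) (\<Xi> j) s \<omega> - m * gbm x a b s \<omega>)\<^sup>2) \<partial>lborel) \<partial>M) \<longlonglongrightarrow> 0) \<and>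
     ((\<lambda>j. \<integral>\<^sup>+\<omega>. ennreal ((?I \<omega> - simple_stoch_int W (N j) (TS j) (\<Xi> j) t \<omega>)\<^sup>2) \<partial>M) \<longlonglongrightarrow> 0)"
  \<comment> \<open>At \<open>t = 0\<close> the equidistant partition would not be strictly
    increasing, as \<open>simple_adapted\<close> demands; the empty simple integrand serves
    instead.\<close>
  proof (cases "t = 0")
    case True
    have "(\<integral>s. clip 0 (gbm x a b) (\<omega>, s) \<partial>lborel) = 0" for \<omega>
    proof (rule integral_eq_zero_AE)
      show "AE s in lborel. clip 0 (gbm x a b) (\<omega>, s) = 0"
        using AE_lborel_singleton[of "0::real"] by eventually_elim (auto simp: clip_def)
    qed
    then have I0: "(\<integral>\<^sup>+\<omega>. ennreal ((?I \<omega>)\<^sup>2) \<partial>M) = (\<integral>\<^sup>+\<omega>. 0 \<partial>M)"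
      unfolding True by (intro nn_integral_cong) (simp add: gbm_0)
    have s0: "(\<integral>\<^sup>+s\<in>{0..0}. f s \<partial>lborel) = 0" for f :: "real \<Rightarrow> ennreal"
    proof -
      have "(\<integral>\<^sup>+s\<in>{0..0}. f s \<partial>lborel) = (\<integral>\<^sup>+(s::real). 0 \<partial>lborel)"
        using AE_lborel_singleton[of "0::real"] by (intro nn_integral_cong_AE) (auto elim: eventually_mono)
      then show ?thesis by simp
    qed
    show ?thesis
      by (intro exI[of _ "\<lambda>_. 0"] exI[of _ "\<lambda>_ _. 0"] exI[of _ "\<lambda>_ _ _. 0"])
         (use I0 in \<open>simp add: True s0 simple_adapted_def simple_stoch_int_def del: atLeastAtMost_singleton\<close>)
  next
    case False
    then have t: "0 < t" using t by simp
    obtain C2 where C2: "0 \<le> C2" "\<And>s. s \<in> {0..t} \<Longrightarrow> (\<integral>\<^sup>+\<omega>. ennreal (gbm x a b s \<omega> ^ 2) \<partial>M) \<le> ennreal C2"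
      using gbm_power_bound[OF x, of 2 t a b] by auto
    obtain C4 where C4: "0 \<le> C4" "\<And>s. s \<in> {0..t} \<Longrightarrow> (\<integral>\<^sup>+\<omega>. ennreal (gbm x a b s \<omega> ^ 4) \<partial>M) \<le> ennreal C4"
      using gbm_power_bound[OF x, of 4 t a b] by auto
    obtain C where C: "0 \<le> C"
      "\<And>\<tau>. \<tau> \<in> {0..t} \<Longrightarrow> exp ((2 * a + b\<^sup>2) * \<tau>) + 1 - 2 * exp (a * \<tau>) \<le> C * \<tau>"
      "\<And>\<tau>. \<tau> \<in> {0..t} \<Longrightarrow> exp ((2 * a + b\<^sup>2) * \<tau>) + (exp (a * \<tau>))\<^sup>2 - 2 * exp (a * \<tau>) * exp (a * \<tau>) \<le> C * \<tau>"
      "\<And>\<tau>. \<tau> \<in> {0..t} \<Longrightarrow> exp ((2 * a + b\<^sup>2) * \<tau>) + (exp (a * \<tau>))\<^sup>2 + b\<^sup>2 * \<tau> - 2 * exp (a * \<tau>) * exp (a * \<tau>) - 2 * b * b * \<tau> * exp (a * \<tau>) \<le> C * \<tau>\<^sup>2"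
      using gbm_moment_bounds[of t a b] t by (metis less_imp_le)
    define TS where "TS j i = real i * (t / real (Suc j))" for j i :: nat
    define \<Xi> where "\<Xi> j i \<omega> = m * min (gbm x a b (TS j i) \<omega>) (real (Suc j))" for j i :: nat and \<omega>
    note A = gbm_simple_approx[OF x t _ C(1) C2(1) C4(1) C2(2) C4(2) C(2), of "Suc _" m, folded TS_def \<Xi>_def]
    note B = gbm_stoch_int_error[OF x b t _ C(1) C2(1) C4(1) C2(2) C4(2) C(3,4), of "Suc _" m, folded TS_def \<Xi>_def]
    have lim: "(\<lambda>j. ennreal (q / real (Suc j))) \<longlonglongrightarrow> 0" for q
    proof -
      have "(\<lambda>j. q / real (Suc j)) \<longlonglongrightarrow> 0" by (rule LIMSEQ_Suc[OF lim_const_over_n])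
      then have "(\<lambda>j. ennreal (q / real (Suc j))) \<longlonglongrightarrow> ennreal 0" by (rule tendsto_ennrealI)
      then show ?thesis by simp
    qed
    show ?thesis
    proof (intro exI[of _ Suc] exI[of _ TS] exI[of _ \<Xi>] conjI allI)
      show "simple_adapted M F (Suc j) (TS j) (\<Xi> j)" for j
        using A(1)[of j] unfolding TS_def[abs_def] \<Xi>_def[abs_def] by simp
      show "(\<lambda>j. \<integral>\<^sup>+\<omega>. (\<integral>\<^sup>+s\<in>{0..t}. ennreal ((simple_val (Suc j) (TS j) (\<Xi> j) s \<omega> - m * gbm x a b s \<omega>)\<^sup>2) \<partial>lborel) \<partial>M) \<longlonglongrightarrow> 0"
        by (rule tendsto_sandwich[OF _ _ tendsto_const lim[of "3 * t * m\<^sup>2 * (C4 + C2 * C * t)"]])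
           (use A(2) in \<open>auto simp: TS_def[abs_def] \<Xi>_def[abs_def]\<close>)
      show "(\<lambda>j. \<integral>\<^sup>+\<omega>. ennreal ((?I \<omega> - simple_stoch_int W (Suc j) (TS j) (\<Xi> j) t \<omega>)\<^sup>2) \<partial>M) \<longlonglongrightarrow> 0"
        by (rule tendsto_sandwich[OF _ _ tendsto_const lim[of "3 * ((m / b)\<^sup>2 * (3 * (C2 * C * t\<^sup>2 + b\<^sup>2 * C4 * t)) + (m * a / b)\<^sup>2 * (t * (C2 * C * t\<^sup>2)))"]])
           (use B in \<open>auto simp: TS_def[abs_def] \<Xi>_def[abs_def]\<close>)
    qed
  qed
qed

section \<open>The closed-loop equation\<close>

text \<open>Under the feedback rule the wealth equation is linear with drift rate
  \<open>r - K + \<mu> * m\<close> and volatility \<open>\<sigma> * m\<close>. With the Ito integral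
  from \<open>ito_integral_gbm\<close> it becomes an identity along every path, since
  \<open>\<sigma> * m / b = 1\<close>.\<close>

lemma closed_loop_gbm:
  assumes x: "0 \<le> x" and m: "m \<noteq> 0" and \<sigma>: "0 < \<sigma>"
  shows "closed_loop M F W r \<mu> \<sigma> x K m (gbm x (r - K + \<mu> * m) (\<sigma> * m))"
proof -
  define a where "a = r - K + \<mu> * m"
  define b where "b = \<sigma> * m"
  have b: "b \<noteq> 0" using m \<sigma> by (simp add: b_def)
  let ?Y = "gbm x a b"
  let ?I = "\<lambda>t \<omega>. m / b * (?Y t \<omega> - x - a * (\<integral>s. clip t ?Y (\<omega>, s) \<partial>lborel))"
  have "wealth_eq M r \<mu> \<sigma> x (\<lambda>t \<omega>. K * ?Y t \<omega>) (\<lambda>t \<omega>. m * ?Y t \<omega>) ?Y ?I"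
    unfolding wealth_eq_def
  proof (intro allI impI AE_I2)
    fix t \<omega> assume t: "0 \<le> (t::real)" and \<omega>: "\<omega> \<in> space M"
    have "continuous_on {0..t} (\<lambda>s. a * ?Y s \<omega>)"
      unfolding gbm_def expm_def by (intro continuous_intros continuous_on_subset[OF W_continuous[OF \<omega>]]) auto
    then have i: "set_integrable lborel {0..t} (\<lambda>s. a * ?Y s \<omega>)" by (rule borel_integrable_atLeastAtMost')
    have e: "r * ?Y s \<omega> - K * ?Y s \<omega> + \<mu> * (m * ?Y s \<omega>) = a * ?Y s \<omega>" for s by (simp add: a_def algebra_simps)
    have "(LINT s:{0..t}|lborel. a * ?Y s \<omega>) = a * (\<integral>s. clip t ?Y (\<omega>, s) \<partial>lborel)"
      unfolding set_integral_clip(2)[symmetric] by simp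
    then show "set_integrable lborel {0..t} (\<lambda>s. r * ?Y s \<omega> - K * ?Y s \<omega> + \<mu> * (m * ?Y s \<omega>)) \<and>
       ?Y t \<omega> = x + (LINT s:{0..t}|lborel. r * ?Y s \<omega> - K * ?Y s \<omega> + \<mu> * (m * ?Y s \<omega>)) + \<sigma> * ?I t \<omega>"
      unfolding e using i m \<sigma> by (simp add: b_def)
  qed
  then show ?thesis
    unfolding closed_loop_def a_def[symmetric] b_def[symmetric]
    using progressive_gbm ito_integral_gbm[OF x b] by blast
qed

text \<open>An integrand of an Ito integral is at finite mean-square distance from some simple one,
  which is itself square integrable. This provides second moments for an arbitrary solution of the
  closed-loop equation.\<close>

lemma ito_integrand_finite:
  assumes "ito_integral M F W \<pi> I" "progressive M F \<pi>" "0 \<le> t"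
  shows "(\<integral>\<^sup>+z. ennreal ((clip t \<pi> z)\<^sup>2) \<partial>(M \<Otimes>\<^sub>M lborel)) < \<infinity>"
proof -
  let ?P = "M \<Otimes>\<^sub>M lborel"
  obtain N TS \<Xi> where S: "\<And>j. simple_adapted M F (N j) (TS j) (\<Xi> j)"
    and 1: "(\<lambda>j. \<integral>\<^sup>+z. ennreal ((clip t (simple_val (N j) (TS j) (\<Xi> j)) z - clip t \<pi> z)\<^sup>2) \<partial>?P) \<longlonglongrightarrow> 0"
    by (rule ito_integral_approx[OF assms]) blast
  from order_tendstoD(2)[OF 1, of 1] obtain j where j: "(\<integral>\<^sup>+z. ennreal ((clip t (simple_val (N j) (TS j) (\<Xi> j)) z - clip t \<pi> z)\<^sup>2) \<partial>?P) < 1"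
    by (auto simp: eventually_sequentially)
  define f where "f = clip t (simple_val (N j) (TS j) (\<Xi> j))"
  have [measurable]: "f \<in> borel_measurable ?P" "clip t \<pi> \<in> borel_measurable ?P"
    unfolding f_def using assms by (auto intro: clip_simple_val S progressive_clip)
  have S0: "simple_adapted M F 0 (\<lambda>_. 0) (\<lambda>_ _. 0)" by (simp add: simple_adapted_def)
  have "(\<integral>\<^sup>+\<omega>. (\<integral>\<^sup>+s\<in>{0..t}. ennreal ((simple_val (N j) (TS j) (\<Xi> j) s \<omega>)\<^sup>2) \<partial>lborel) \<partial>M) < \<infinity>"
    using simple_isometry[OF S S0 assms(3), of j] by (auto simp: simple_val_def[of 0])
  then have fsq: "(\<integral>\<^sup>+z. ennreal ((f z)\<^sup>2) \<partial>?P) < \<infinity>"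
    unfolding f_def using clip_simple_val[OF S] by (simp add: nn_integral_clip_square)
  have "(\<integral>\<^sup>+z. ennreal ((clip t \<pi> z)\<^sup>2) \<partial>?P) = (\<integral>\<^sup>+z. ennreal ((f z + (- (f z - clip t \<pi> z)) + 0)\<^sup>2) \<partial>?P)" by simp
  also have "\<dots> \<le> 3 * ((\<integral>\<^sup>+z. ennreal ((f z)\<^sup>2) \<partial>?P) + (\<integral>\<^sup>+z. ennreal ((- (f z - clip t \<pi> z))\<^sup>2) \<partial>?P) + (\<integral>\<^sup>+(z::'w \<times> real). ennreal (0\<^sup>2) \<partial>?P))"
    by (rule nn_integral_square_sum3) measurable
  also have "\<dots> < \<infinity>"
    using fsq j unfolding f_def[symmetric] power2_minus
    by (auto simp: ennreal_mult_less_top intro: less_trans[OF _ ennreal_one_less_top])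
  finally show ?thesis .
qed

lemma clip_const_mult: "clip t (\<lambda>s \<omega>. m * f s \<omega>) z = m * clip t f z"
  by (simp add: clip_def)

lemma closed_loop_square_integrable:
  assumes cl: "closed_loop M F W r \<mu> \<sigma> x K m X" and m: "m \<noteq> 0" and t: "0 \<le> t"
  shows "(\<integral>\<^sup>+z. ennreal ((clip t X z)\<^sup>2) \<partial>(M \<Otimes>\<^sub>M lborel)) < \<infinity>"
proof -
  obtain I where p: "progressive M F X" and I: "ito_integral M F W (\<lambda>t \<omega>. m * X t \<omega>) I"
    using cl by (auto simp: closed_loop_def)
  have [measurable]: "clip t X \<in> borel_measurable (M \<Otimes>\<^sub>M lborel)" using p t by (rule progressive_clip)
  have "(\<integral>\<^sup>+z. ennreal ((m * clip t X z)\<^sup>2) \<partial>(M \<Otimes>\<^sub>M lborel)) < \<infinity>"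
    using ito_integrand_finite[OF I progressive_const_mult[OF p] t] unfolding clip_const_mult .
  then have "ennreal (m\<^sup>2) * (\<integral>\<^sup>+z. ennreal ((clip t X z)\<^sup>2) \<partial>(M \<Otimes>\<^sub>M lborel)) < \<infinity>"
    by (simp add: power_mult_distrib ennreal_mult nn_integral_cmult)
  then show ?thesis using m by (auto simp: ennreal_mult_less_top)
qed

lemma closed_loop_path:
  assumes cl: "closed_loop M F W r \<mu> \<sigma> x K m X" and I: "wealth_eq M r \<mu> \<sigma> x (\<lambda>t \<omega>. K * X t \<omega>) (\<lambda>t \<omega>. m * X t \<omega>) X I"
    and m: "m \<noteq> 0" and t: "0 \<le> t"
  shows "AE \<omega> in M. integrable lborel (\<lambda>s. clip t X (\<omega>, s)) \<and>
     X t \<omega> = x + (r - K + \<mu> * m) * (\<integral>s. clip t X (\<omega>, s) \<partial>lborel) + \<sigma> * I t \<omega>"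
proof -
  let ?P = "M \<Otimes>\<^sub>M lborel"
  have p: "progressive M F X" using cl by (simp add: closed_loop_def)
  have [measurable]: "clip t X \<in> borel_measurable ?P" using p t by (rule progressive_clip)
  have "integrable ?P (clip t X)"
    using t closed_loop_square_integrable[OF cl m t] by (intro integrable_clip) auto
  then have "AE \<omega> in M. integrable lborel (\<lambda>s. clip t X (\<omega>, s))" by (rule PL.AE_integrable_fst')
  moreover have "AE \<omega> in M. set_integrable lborel {0..t} (\<lambda>s. r * X s \<omega> - K * X s \<omega> + \<mu> * (m * X s \<omega>)) \<and>
        X t \<omega> = x + (LINT s:{0..t}|lborel. r * X s \<omega> - K * X s \<omega> + \<mu> * (m * X s \<omega>)) + \<sigma> * I t \<omega>"
    by (rule I[unfolded wealth_eq_def, THEN spec, THEN mp, OF t])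
  ultimately show ?thesis
  proof eventually_elim
    case (elim \<omega>)
    have e: "r * X s \<omega> - K * X s \<omega> + \<mu> * (m * X s \<omega>) = (r - K + \<mu> * m) * X s \<omega>" for s by (simp add: algebra_simps)
    have "(LINT s:{0..t}|lborel. (r - K + \<mu> * m) * X s \<omega>) = (r - K + \<mu> * m) * (\<integral>s. clip t X (\<omega>, s) \<partial>lborel)"
      unfolding set_integral_clip(2)[symmetric] by simp
    then show ?case using elim unfolding e by simp
  qed
qed

text \<open>The mean square \<open>g\<close> of the difference of two solutions satisfies a
  homogeneous Gronwall inequality: Cauchy-Schwarz handles the drift and
  \<open>ito_integral_diff_bound\<close> the noise. Finiteness comes from
  \<open>closed_loop_square_integrable\<close>.\<close>

lemma closed_loop_unique:
  assumes cl: "closed_loop M F W r \<mu> \<sigma> x K m X" "closed_loop M F W r \<mu> \<sigma> x K m X'" and m: "m \<noteq> 0" and T: "0 \<le> T"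
  shows "AE \<omega> in M. X T \<omega> = X' T \<omega>"
proof -
  let ?P = "M \<Otimes>\<^sub>M lborel"
  obtain I where p: "progressive M F X" and I: "ito_integral M F W (\<lambda>t \<omega>. m * X t \<omega>) I"
    "wealth_eq M r \<mu> \<sigma> x (\<lambda>t \<omega>. K * X t \<omega>) (\<lambda>t \<omega>. m * X t \<omega>) X I"
    using cl(1) by (auto simp: closed_loop_def)
  obtain I' where p': "progressive M F X'" and I': "ito_integral M F W (\<lambda>t \<omega>. m * X' t \<omega>) I'"
    "wealth_eq M r \<mu> \<sigma> x (\<lambda>t \<omega>. K * X' t \<omega>) (\<lambda>t \<omega>. m * X' t \<omega>) X' I'"
    using cl(2) by (auto simp: closed_loop_def)
  define a where "a = r - K + \<mu> * m"
  define D where "D t \<omega> = X t \<omega> - X' t \<omega>" for t \<omega>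
  have pD: "progressive M F D"
    using p p' unfolding progressive_def D_def case_prod_beta' by (auto intro!: borel_measurable_diff)
  define g where "g s = (if 0 \<le> s then \<integral>\<^sup>+\<omega>. ennreal ((D s \<omega>)\<^sup>2) \<partial>M else 0)" for s
  have gm [measurable]: "g \<in> borel_measurable borel"
  proof -
    have [measurable]: "(\<lambda>z. if snd z \<in> {0..} then D (snd z) (fst z) else 0) \<in> borel_measurable ?P"
      by (rule progressive_joint'[OF pD])
    define q where "q z = (if snd z \<in> {0..} then D (snd z) (fst z) else 0)" for z
    have [measurable]: "q \<in> borel_measurable ?P" unfolding q_def[abs_def] by measurable
    have "(\<lambda>s. \<integral>\<^sup>+\<omega>. ennreal ((q (\<omega>, s))\<^sup>2) \<partial>M) \<in> borel_measurable lborel"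
      by (rule borel_measurable_nn_integral) measurable
    also have "(\<lambda>s. \<integral>\<^sup>+\<omega>. ennreal ((q (\<omega>, s))\<^sup>2) \<partial>M) = g" by (auto simp: q_def g_def)
    finally show ?thesis by simp
  qed
  have gP: "(\<integral>\<^sup>+z. ennreal ((clip t D z)\<^sup>2) \<partial>?P) = (\<integral>\<^sup>+s\<in>{0..t}. g s \<partial>lborel)" if t: "0 \<le> t" for t
  proof -
    have [measurable]: "clip t D \<in> borel_measurable ?P" using pD t by (rule progressive_clip)
    have "(\<integral>\<^sup>+z. ennreal ((clip t D z)\<^sup>2) \<partial>?P) = (\<integral>\<^sup>+s. \<integral>\<^sup>+\<omega>. ennreal ((clip t D (\<omega>, s))\<^sup>2) \<partial>M \<partial>lborel)"
      by (rule PL.nn_integral_snd[symmetric]) measurable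
    also have "\<dots> = (\<integral>\<^sup>+s\<in>{0..t}. g s \<partial>lborel)"
      by (intro nn_integral_cong) (auto simp: clip_def g_def indicator_def)
    finally show ?thesis .
  qed
  have Dclip: "clip t D z = clip t X z - clip t X' z" for t z unfolding D_def by (rule clip_diff)
  have gfin: "(\<integral>\<^sup>+s\<in>{0..T}. g s \<partial>lborel) < \<infinity>"
  proof -
    have [measurable]: "clip T X \<in> borel_measurable ?P" "clip T X' \<in> borel_measurable ?P"
      using p p' T by (auto intro: progressive_clip)
    have "(\<integral>\<^sup>+z. ennreal ((clip T D z)\<^sup>2) \<partial>?P) = (\<integral>\<^sup>+z. ennreal ((clip T X z + - clip T X' z + 0)\<^sup>2) \<partial>?P)" by (simp add: Dclip)
    also have "\<dots> \<le> 3 * ((\<integral>\<^sup>+z. ennreal ((clip T X z)\<^sup>2) \<partial>?P) + (\<integral>\<^sup>+z. ennreal ((- clip T X' z)\<^sup>2) \<partial>?P) + (\<integral>\<^sup>+(z::'w \<times> real). ennreal (0\<^sup>2) \<partial>?P))"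
      by (rule nn_integral_square_sum3) measurable
    also have "\<dots> < \<infinity>"
      using closed_loop_square_integrable[OF cl(1) m T] closed_loop_square_integrable[OF cl(2) m T]
      by (auto simp: ennreal_mult_less_top)
    finally show ?thesis unfolding gP[OF T] .
  qed
  \<comment> \<open>The 3 comes from the three-term square, \<open>T\<close> from Cauchy-Schwarz in
    time, and the 9 from \<open>ito_integral_diff_bound\<close>.\<close>
  define C where "C = 3 * (a\<^sup>2 * T + \<sigma>\<^sup>2 * (9 * m\<^sup>2))"
  have C0: "0 \<le> C" using T by (simp add: C_def)
  have gle: "g t \<le> ennreal C * (\<integral>\<^sup>+s\<in>{0..t}. g s \<partial>lborel)" if t: "t \<in> {0..T}" for t
  proof -
    have t0: "0 \<le> t" using t by simp
    have [measurable]: "clip t D \<in> borel_measurable ?P" using pD t0 by (rule progressive_clip)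
    have [measurable]: "I t \<in> borel_measurable M" "I' t \<in> borel_measurable M"
      using I I' t0 by (auto intro: ito_integral_measurable)
    define J where "J \<omega> = (\<integral>s. indicator {0..t} s * clip t D (\<omega>, s) \<partial>lborel)" for \<omega>
    have [measurable]: "J \<in> borel_measurable M" unfolding J_def[abs_def] by measurable
    have "AE \<omega> in M. D t \<omega> = a * J \<omega> + \<sigma> * (I t \<omega> - I' t \<omega>) + 0"
      using closed_loop_path[OF cl(1) I(2) m t0] closed_loop_path[OF cl(2) I'(2) m t0]
    proof eventually_elim
      case (elim \<omega>)
      have "J \<omega> = (\<integral>s. clip t X (\<omega>, s) - clip t X' (\<omega>, s) \<partial>lborel)"
        unfolding J_def Dclip by (intro Bochner_Integration.integral_cong) (auto simp: clip_def indicator_def)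
      also have "\<dots> = (\<integral>s. clip t X (\<omega>, s) \<partial>lborel) - (\<integral>s. clip t X' (\<omega>, s) \<partial>lborel)"
        using elim by (intro Bochner_Integration.integral_diff) auto
      finally have J: "J \<omega> = (\<integral>s. clip t X (\<omega>, s) \<partial>lborel) - (\<integral>s. clip t X' (\<omega>, s) \<partial>lborel)" .
      have "X t \<omega> = x + a * (\<integral>s. clip t X (\<omega>, s) \<partial>lborel) + \<sigma> * I t \<omega>"
        "X' t \<omega> = x + a * (\<integral>s. clip t X' (\<omega>, s) \<partial>lborel) + \<sigma> * I' t \<omega>"
        using elim unfolding a_def by auto
      then show ?case unfolding D_def J by (simp add: algebra_simps)
    qed
    then have "g t = (\<integral>\<^sup>+\<omega>. ennreal ((a * J \<omega> + \<sigma> * (I t \<omega> - I' t \<omega>) + 0)\<^sup>2) \<partial>M)"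
      using t0 unfolding g_def by (auto intro!: nn_integral_cong_AE elim: eventually_mono)
    also have "\<dots> \<le> 3 * ((\<integral>\<^sup>+\<omega>. ennreal ((a * J \<omega>)\<^sup>2) \<partial>M) + (\<integral>\<^sup>+\<omega>. ennreal ((\<sigma> * (I t \<omega> - I' t \<omega>))\<^sup>2) \<partial>M) + (\<integral>\<^sup>+\<omega>. ennreal (0\<^sup>2) \<partial>M))"
      by (rule nn_integral_square_sum3) measurable
    also have "(\<integral>\<^sup>+\<omega>. ennreal ((a * J \<omega>)\<^sup>2) \<partial>M) = ennreal (a\<^sup>2) * (\<integral>\<^sup>+\<omega>. ennreal ((J \<omega>)\<^sup>2) \<partial>M)"
      by (simp add: power_mult_distrib ennreal_mult nn_integral_cmult)
    also have "(\<integral>\<^sup>+\<omega>. ennreal ((\<sigma> * (I t \<omega> - I' t \<omega>))\<^sup>2) \<partial>M) = ennreal (\<sigma>\<^sup>2) * (\<integral>\<^sup>+\<omega>. ennreal ((I t \<omega> - I' t \<omega>)\<^sup>2) \<partial>M)"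
      by (simp add: power_mult_distrib ennreal_mult nn_integral_cmult)
    also have "3 * (ennreal (a\<^sup>2) * (\<integral>\<^sup>+\<omega>. ennreal ((J \<omega>)\<^sup>2) \<partial>M) + ennreal (\<sigma>\<^sup>2) * (\<integral>\<^sup>+\<omega>. ennreal ((I t \<omega> - I' t \<omega>)\<^sup>2) \<partial>M) + (\<integral>\<^sup>+\<omega>. ennreal (0\<^sup>2) \<partial>M))
      \<le> 3 * (ennreal (a\<^sup>2) * (ennreal T * (\<integral>\<^sup>+s\<in>{0..t}. g s \<partial>lborel)) + ennreal (\<sigma>\<^sup>2) * (9 * (ennreal (m\<^sup>2) * (\<integral>\<^sup>+s\<in>{0..t}. g s \<partial>lborel))) + 0)"
    proof (intro mult_left_mono add_mono)
      have "(\<integral>\<^sup>+\<omega>. ennreal ((J \<omega>)\<^sup>2) \<partial>M) \<le> (\<integral>\<^sup>+\<omega>. ennreal t * (\<integral>\<^sup>+s\<in>{0..t}. ennreal ((clip t D (\<omega>, s))\<^sup>2) \<partial>lborel) \<partial>M)"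
        unfolding J_def using t0 by (intro nn_integral_mono ennreal_integral_square_le) auto
      also have "\<dots> = ennreal t * (\<integral>\<^sup>+\<omega>. (\<integral>\<^sup>+s\<in>{0..t}. ennreal ((clip t D (\<omega>, s))\<^sup>2) \<partial>lborel) \<partial>M)"
        by (rule nn_integral_cmult) measurable
      also have "(\<integral>\<^sup>+\<omega>. (\<integral>\<^sup>+s\<in>{0..t}. ennreal ((clip t D (\<omega>, s))\<^sup>2) \<partial>lborel) \<partial>M) = (\<integral>\<^sup>+\<omega>. (\<integral>\<^sup>+s\<in>{0..t}. ennreal ((D s \<omega>)\<^sup>2) \<partial>lborel) \<partial>M)"
        by (intro nn_integral_cong) (auto simp: clip_def indicator_def)
      also have "\<dots> = (\<integral>\<^sup>+s\<in>{0..t}. g s \<partial>lborel)" unfolding gP[OF t0, symmetric] by (rule nn_integral_clip_square) measurable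
      also have "ennreal t * (\<integral>\<^sup>+s\<in>{0..t}. g s \<partial>lborel) \<le> ennreal T * (\<integral>\<^sup>+s\<in>{0..t}. g s \<partial>lborel)"
        using t by (intro mult_right_mono ennreal_leI) auto
      finally show "(\<integral>\<^sup>+\<omega>. ennreal ((J \<omega>)\<^sup>2) \<partial>M) \<le> ennreal T * (\<integral>\<^sup>+s\<in>{0..t}. g s \<partial>lborel)" .
      have "(\<integral>\<^sup>+\<omega>. ennreal ((I t \<omega> - I' t \<omega>)\<^sup>2) \<partial>M) \<le> 9 * (\<integral>\<^sup>+z. ennreal ((clip t (\<lambda>s \<omega>. m * X s \<omega>) z - clip t (\<lambda>s \<omega>. m * X' s \<omega>) z)\<^sup>2) \<partial>?P)"
        by (intro ito_integral_diff_bound I I' progressive_const_mult p p' t0)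
      also have "(\<integral>\<^sup>+z. ennreal ((clip t (\<lambda>s \<omega>. m * X s \<omega>) z - clip t (\<lambda>s \<omega>. m * X' s \<omega>) z)\<^sup>2) \<partial>?P) = (\<integral>\<^sup>+z. ennreal (m\<^sup>2) * ennreal ((clip t D z)\<^sup>2) \<partial>?P)"
        by (simp add: clip_const_mult Dclip right_diff_distrib[symmetric] power_mult_distrib ennreal_mult)
      also have "\<dots> = ennreal (m\<^sup>2) * (\<integral>\<^sup>+s\<in>{0..t}. g s \<partial>lborel)"
        unfolding gP[OF t0, symmetric] by (rule nn_integral_cmult) measurable
      finally show "(\<integral>\<^sup>+\<omega>. ennreal ((I t \<omega> - I' t \<omega>)\<^sup>2) \<partial>M) \<le> 9 * (ennreal (m\<^sup>2) * (\<integral>\<^sup>+s\<in>{0..t}. g s \<partial>lborel))" .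
    qed auto
    also have "\<dots> = ennreal C * (\<integral>\<^sup>+s\<in>{0..t}. g s \<partial>lborel)"
    proof -
      have "ennreal C = 3 * (ennreal (a\<^sup>2) * ennreal T + ennreal (\<sigma>\<^sup>2) * (9 * ennreal (m\<^sup>2)))"
        unfolding C_def using T by (simp add: ennreal_mult ennreal_plus distrib_left mult.left_commute[of "ennreal (\<sigma>\<^sup>2)" 9])
      then show ?thesis by (simp add: distrib_left distrib_right mult.assoc)
    qed
    finally show ?thesis .
  qed
  have "(\<integral>\<^sup>+s\<in>{0..T}. g s \<partial>lborel) \<le> ennreal (exp (C * T)) * (\<integral>\<^sup>+s\<in>{0..T}. 0 \<partial>lborel)"
    using gle by (intro gronwall_nn C0 T gfin) auto
  \<comment> \<open>Gronwall annihilates only the time integral of \<open>g\<close>; the pointwise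
    inequality at \<open>T\<close> then gives the value itself.\<close>
  then have "g T = 0" using gle[of T] T by simp
  moreover have "D T \<in> borel_measurable M" using pD T by (rule progressive_section_M)
  ultimately have "AE \<omega> in M. ennreal ((D T \<omega>)\<^sup>2) = 0" using T by (simp add: g_def nn_integral_0_iff_AE)
  then show ?thesis by eventually_elim (simp add: D_def)
qed

end

section \<open>Optimality\<close>

context brownian
begin

text \<open>Nonnegativity is not built into \<open>closed_loop\<close>; it is inherited from
  geometric Brownian motion, with which every solution agrees almost surely at each time. The
  constraint is then just \<open>k \<le> K\<close>.\<close>

lemma closed_loop_admissible:
  assumes cl: "closed_loop M F W r \<mu> \<sigma> x K m X" and x: "0 \<le> x" and m: "m \<noteq> 0" and \<sigma>: "0 < \<sigma>" and K: "0 \<le> K" "k \<le> K"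
  shows "admissible M F W r \<mu> \<sigma> k 0 x (\<lambda>t \<omega>. K * X t \<omega>) (\<lambda>t \<omega>. m * X t \<omega>)"
proof -
  obtain I where p: "progressive M F X" and I: "ito_integral M F W (\<lambda>t \<omega>. m * X t \<omega>) I"
    "wealth_eq M r \<mu> \<sigma> x (\<lambda>t \<omega>. K * X t \<omega>) (\<lambda>t \<omega>. m * X t \<omega>) X I"
    using cl by (auto simp: closed_loop_def)
  have fin: "(\<integral>\<^sup>+\<omega>. (\<integral>\<^sup>+s\<in>{0..t}. ennreal (K * X s \<omega> + (m * X s \<omega>)\<^sup>2) \<partial>lborel) \<partial>M) < \<infinity>" if t: "0 \<le> t" for t
  proof -
    have [measurable]: "clip t X \<in> borel_measurable (M \<Otimes>\<^sub>M lborel)" using p t by (rule progressive_clip)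
    \<comment> \<open>Linear consumption is dominated by a constant plus a square, so the second
      moment of \<open>X\<close> controls the whole integrand.\<close>
    have le: "K * y + (m * y)\<^sup>2 \<le> K + (K + m\<^sup>2) * y\<^sup>2" for y
    proof -
      have "2 * y \<le> y\<^sup>2 + 1" "0 \<le> y\<^sup>2" using sum_squares_bound[of y 1] by simp_all
      then have "y \<le> 1 + y\<^sup>2" by linarith
      then have "K * y \<le> K * (1 + y\<^sup>2)" using K by (intro mult_left_mono) auto
      then show ?thesis by (simp add: power_mult_distrib algebra_simps)
    qed
    have "(\<integral>\<^sup>+\<omega>. (\<integral>\<^sup>+s\<in>{0..t}. ennreal (K * X s \<omega> + (m * X s \<omega>)\<^sup>2) \<partial>lborel) \<partial>M)
      \<le> (\<integral>\<^sup>+\<omega>. (\<integral>\<^sup>+s. ennreal K * indicator {0..t} s + ennreal (K + m\<^sup>2) * ennreal ((clip t X (\<omega>, s))\<^sup>2) \<partial>lborel) \<partial>M)"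
    proof (intro nn_integral_mono)
      fix \<omega> s
      show "ennreal (K * X s \<omega> + (m * X s \<omega>)\<^sup>2) * indicator {0..t} s \<le> ennreal K * indicator {0..t} s + ennreal (K + m\<^sup>2) * ennreal ((clip t X (\<omega>, s))\<^sup>2)"
      proof (cases "s \<in> {0..t}")
        case True
        have "ennreal (K * X s \<omega> + (m * X s \<omega>)\<^sup>2) \<le> ennreal (K + (K + m\<^sup>2) * (X s \<omega>)\<^sup>2)" by (intro ennreal_leI le)
        also have "\<dots> = ennreal K + ennreal (K + m\<^sup>2) * ennreal ((X s \<omega>)\<^sup>2)"
          using K by (subst ennreal_plus) (auto simp: ennreal_mult'')
        finally show ?thesis using True by (simp add: clip_def)
      qed simp
    qed
    also have "\<dots> = (\<integral>\<^sup>+\<omega>. ennreal K * ennreal t + ennreal (K + m\<^sup>2) * (\<integral>\<^sup>+s. ennreal ((clip t X (\<omega>, s))\<^sup>2) \<partial>lborel) \<partial>M)"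
      using t by (intro nn_integral_cong, subst nn_integral_add) (auto simp: nn_integral_cmult nn_integral_cmult_indicator)
    also have "\<dots> = ennreal K * ennreal t + ennreal (K + m\<^sup>2) * (\<integral>\<^sup>+z. ennreal ((clip t X z)\<^sup>2) \<partial>(M \<Otimes>\<^sub>M lborel))"
    proof -
      have "(\<integral>\<^sup>+\<omega>. \<integral>\<^sup>+s. ennreal ((clip t X (\<omega>, s))\<^sup>2) \<partial>lborel \<partial>M) = (\<integral>\<^sup>+z. ennreal ((clip t X z)\<^sup>2) \<partial>(M \<Otimes>\<^sub>M lborel))"
        by (rule lborel.nn_integral_fst) measurable
      then show ?thesis by (simp add: nn_integral_add nn_integral_cmult emeasure_space_1)
    qed
    also have "\<dots> < \<infinity>"
      using closed_loop_square_integrable[OF cl m t] by (auto simp: ennreal_mult_less_top)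
    finally show ?thesis .
  qed
  have "AE \<omega> in M. 0 \<le> X t \<omega> \<and> k * X t \<omega> + 0 \<le> K * X t \<omega>" if t: "0 \<le> t" for t
    using closed_loop_unique[OF cl closed_loop_gbm[OF x m \<sigma>] m t]
  proof eventually_elim
    case (elim \<omega>)
    then have "0 \<le> X t \<omega>" using gbm_nonneg[OF x] by simp
    then show ?case using K by (auto intro: mult_right_mono)
  qed
  then show ?thesis
    unfolding admissible_def using progressive_const_mult[OF p] p I fin by blast
qed

text \<open>The objective depends on the law of the wealth at single times only, so a solution may
  be replaced by geometric Brownian motion, whose \<open>p\<close>-th moment is an exponential.
  \<open>expo\<close> says that, after discounting, it decays at rate \<open>D\<close>.\<close>

lemma closed_loop_objective:
  assumes cl: "closed_loop M F W r \<mu> \<sigma> x K m X" and x: "0 \<le> x" and m: "m \<noteq> 0" and \<sigma>: "0 < \<sigma>" and K: "0 \<le> K"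
    and p: "0 < p" and D: "0 < D" and expo: "- \<beta> + p * (r - K + \<mu> * m) + (p\<^sup>2 - p) * (\<sigma> * m)\<^sup>2 / 2 = - D"
  shows "objective M \<beta> p (\<lambda>t \<omega>. K * X t \<omega>) = ennreal (K powr p / (p * D) * x powr p)"
proof -
  have pX: "progressive M F X" using cl by (simp add: closed_loop_def)
  let ?Y = "gbm x (r - K + \<mu> * m) (\<sigma> * m)"
  define A where "A = K powr p * x powr p / p"
  have A: "0 \<le> A" using p by (simp add: A_def)
  have "(\<integral>\<^sup>+\<omega>. ennreal (exp (- \<beta> * t) * ((K * X t \<omega>) powr p / p)) \<partial>M) = ennreal (A * exp (- D * t))" if t: "0 \<le> t" for t
  proof -
    have [measurable]: "?Y t \<in> borel_measurable M" using t by (rule gbm_M)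
    have "(\<integral>\<^sup>+\<omega>. ennreal (exp (- \<beta> * t) * ((K * X t \<omega>) powr p / p)) \<partial>M) = (\<integral>\<^sup>+\<omega>. ennreal (exp (- \<beta> * t) * K powr p / p) * ennreal (?Y t \<omega> powr p) \<partial>M)"
      using closed_loop_unique[OF cl closed_loop_gbm[OF x m \<sigma>] m t]
    proof (intro nn_integral_cong_AE, eventually_elim)
      case (elim \<omega>)
      show ?case unfolding elim using K p gbm_nonneg[OF x]
        by (subst ennreal_mult[symmetric]) (auto simp: powr_mult)
    qed
    also have "\<dots> = ennreal (exp (- \<beta> * t) * K powr p / p) * ennreal (x powr p * exp ((p * (r - K + \<mu> * m) + (p\<^sup>2 - p) * (\<sigma> * m)\<^sup>2 / 2) * t))"
      using x t by (simp add: nn_integral_cmult nn_integral_gbm_powr)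
    also have "\<dots> = ennreal (A * (exp (- \<beta> * t) * exp ((p * (r - K + \<mu> * m) + (p\<^sup>2 - p) * (\<sigma> * m)\<^sup>2 / 2) * t)))"
      using p by (subst ennreal_mult[symmetric]) (auto simp: A_def)
    also have "exp (- \<beta> * t) * exp ((p * (r - K + \<mu> * m) + (p\<^sup>2 - p) * (\<sigma> * m)\<^sup>2 / 2) * t) = exp (- D * t)"
      unfolding exp_add[symmetric] expo[symmetric] by (simp add: algebra_simps)
    finally show ?thesis .
  qed
  then have "objective M \<beta> p (\<lambda>t \<omega>. K * X t \<omega>) = (\<integral>\<^sup>+t. ennreal (A * exp (- D * t)) * indicator {0..} t \<partial>lborel)"
    unfolding objective_eq(1)[OF progressive_const_mult[OF pX]] by (intro nn_integral_cong) (auto simp: indicator_def)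
  also have "\<dots> = ennreal (0 - (- (A / D * exp (- D * 0))))"
  proof (rule nn_integral_FTC_atLeast)
    have "((\<lambda>t. exp (- (D * t))) \<longlongrightarrow> 0) at_top"
      using D by (intro filterlim_compose[OF exp_at_bot] filterlim_compose[OF filterlim_uminus_at_bot_at_top]
          filterlim_tendsto_pos_mult_at_top[OF tendsto_const] filterlim_ident)
    then have "((\<lambda>t. - (A / D * exp (- (D * t)))) \<longlongrightarrow> - (A / D * 0)) at_top" by (intro tendsto_intros)
    then show "((\<lambda>t. - (A / D * exp (- D * t))) \<longlongrightarrow> 0) at_top" by simp
  qed (use A D in \<open>auto intro!: derivative_eq_intros\<close>)
  also have "\<dots> = ennreal (K powr p / (p * D) * x powr p)" by (simp add: A_def)
  finally show ?thesis .
qed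

text \<open>The multiplier \<open>y\<close> in \<open>objective_dual_bound\<close> is optimised: for
  \<open>x > 0\<close> there is a minimiser, for \<open>x = 0\<close> the infimum is approached as
  \<open>y\<close> grows.\<close>

lemma admissible_objective_bound:
  assumes adm: "admissible M F W r \<mu> \<sigma> k 0 x c \<pi>"
    and nn: "0 \<le> r" "0 < \<mu>" "0 < \<sigma>" "0 \<le> x" "0 \<le> k" and p: "0 < p" "p < 1"
    and \<kappa>: "\<kappa> = kappa r \<mu> \<sigma> \<beta> p" "0 < \<kappa>"
    and K: "K = max \<kappa> k" and D: "D = \<kappa> * (1 - p) + K * p"
  shows "objective M \<beta> p c \<le> ennreal (K powr p / (p * D) * x powr p)"
proof -
  obtain X I where adm': "progressive M F c" "progressive M F \<pi>" "progressive M F X" "ito_integral M F W \<pi> I"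
      "wealth_eq M r \<mu> \<sigma> x c \<pi> X I"
    and fin: "\<And>t. 0 \<le> t \<Longrightarrow> (\<integral>\<^sup>+\<omega>. (\<integral>\<^sup>+s\<in>{0..t}. ennreal (c s \<omega> + (\<pi> s \<omega>)\<^sup>2) \<partial>lborel) \<partial>M) < \<infinity>"
    and AE: "\<And>t. 0 \<le> t \<Longrightarrow> AE \<omega> in M. 0 \<le> X t \<omega> \<and> k * X t \<omega> + 0 \<le> c t \<omega>"
    using adm unfolding admissible_def by blast
  have pos: "AE \<omega> in M. 0 \<le> X t \<omega> \<and> 0 \<le> c t \<omega>" if "0 \<le> t" for t
    using AE[OF that]
  proof eventually_elim
    case (elim \<omega>)
    then have "0 \<le> k * X t \<omega>" using nn by (intro mult_nonneg_nonneg) auto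
    with elim show ?case by auto
  qed
  interpret wealth M F W r \<mu> \<sigma> x c \<pi> X I
    by unfold_locales (use nn adm' fin pos in auto)
  define q where "q = p / (1 - p)"
  define \<delta> where "\<delta> = (1 - p) * (K - \<kappa>)"
  have K0: "0 < K" using \<kappa> K by auto
  have D0: "0 < D" using \<kappa> p K0 by (auto simp: D intro!: add_pos_pos)
  have \<delta>0: "0 \<le> \<delta>" using p K by (auto simp: \<delta>_def)
  have KD: "K - D = \<delta>" by (simp add: D \<delta>_def algebra_simps)
  have constr: "AE \<omega> in M. D / K * c t \<omega> \<le> c t \<omega> - \<delta> * X t \<omega>" if t: "0 \<le> t" for t
    using AE[OF t]
  proof eventually_elim
    case (elim \<omega>)
    have "\<delta> * (K * X t \<omega>) \<le> \<delta> * c t \<omega>"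
    \<comment> \<open>Complementary slackness: either \<open>K = k\<close> and the constraint gives
      the inequality, or \<open>K = \<kappa>\<close> and \<delta> is zero.\<close>
    proof (cases "\<kappa> < k")
      case True
      then show ?thesis using elim \<delta>0 K by (intro mult_left_mono) auto
    next
      case False
      then show ?thesis using K by (simp add: \<delta>_def)
    qed
    then have "\<delta> * X t \<omega> \<le> \<delta> / K * c t \<omega>" using K0 by (simp add: field_simps)
    moreover have "\<delta> / K * c t \<omega> = c t \<omega> - D / K * c t \<omega>" using K0 by (simp add: KD[symmetric] field_simps)
    ultimately show ?case by simp
  qed
  have \<beta>: "\<beta> = \<kappa> * (1 - p) + p * (\<mu>\<^sup>2 / (2 * \<sigma>\<^sup>2 * (1 - p)) + r)"
    using p by (simp add: \<kappa>(1) kappa_def)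
  \<comment> \<open>In terms of \<kappa> the left side is \<open>\<kappa> + q * \<delta>\<close>,
    and \<open>q * \<delta> = p * (K - \<kappa>)\<close>; this is where the choice of \<delta> is
    tuned to \<open>D\<close>.\<close>
  have "\<beta> * (1 + q) - q * (r - \<delta>) - q * (1 + q) * (\<mu> / \<sigma>)\<^sup>2 / 2 = D"
  proof -
    have q1: "1 + q = 1 / (1 - p)" using p by (simp add: q_def field_simps)
    have f1: "\<beta> * (1 + q) = \<kappa> + q * (\<mu>\<^sup>2 / (2 * \<sigma>\<^sup>2 * (1 - p)) + r)"
      unfolding q1 unfolding \<beta> q_def using p by (simp add: add_divide_distrib)
    have f2: "q * (1 + q) * (\<mu> / \<sigma>)\<^sup>2 / 2 = q * (\<mu>\<^sup>2 / (2 * \<sigma>\<^sup>2 * (1 - p)))"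
      unfolding q1 by (simp add: power_divide)
    have "q * \<delta> = p * (K - \<kappa>)" using p by (simp add: q_def \<delta>_def)
    then show ?thesis unfolding f1 f2 by (simp add: D algebra_simps)
  qed
  note bound = objective_dual_bound[OF p K0 D0 \<delta>0 _ constr q_def this]
  show ?thesis
  proof (cases "x = 0")
    case False
    then have x: "0 < x" using nn by simp
    \<comment> \<open>The derivative at \<open>x\<close> of the claimed value function, which
      minimises the dual bound.\<close>
    define y where "y = K powr p / D * x powr (p - 1)"
    have y: "0 < y" using K0 D0 x by (simp add: y_def)
    have "y * D / K = (K * x) powr (p - 1)"
      using K0 D0 x by (simp add: y_def powr_mult powr_diff)
    then have "(y * D / K) powr (- q) = (K * x) powr ((p - 1) * (- q))" by (simp add: powr_powr)
    also have "(p - 1) * (- q) = p" using p by (simp add: q_def field_simps)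
    finally have 1: "(y * D / K) powr (- q) = K powr p * x powr p" using K0 x by (simp add: powr_mult)
    have 2: "y * x = K powr p * x powr p / D" using x by (simp add: y_def powr_diff)
    have "(1 - p) / p * (y * D / K) powr (- q) / D + y * x = K powr p / (p * D) * x powr p"
      unfolding 1 2 using p D0 by (simp add: field_simps)
    then show ?thesis using bound[OF y] by simp
  next
    case True
    have le: "objective M \<beta> p c \<le> 0 + ennreal e" if e: "0 < e" for e
    proof -
      \<comment> \<open>Chosen to make the dual bound equal to \<open>e\<close>; with zero capital
        the term \<open>y * x\<close> vanishes, so large multipliers cost nothing.\<close>
      define z where "z = (e * p * D / (1 - p)) powr (- (1 / q))"
      have q0: "0 < q" using p by (simp add: q_def)
      have z: "0 < z" using e p D0 by (simp add: z_def)
      have "z powr (- q) = e * p * D / (1 - p)"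
        using q0 e p D0 by (simp add: z_def powr_powr)
      moreover have "(z * K / D) * D / K = z" using K0 D0 by simp
      ultimately have "(1 - p) / p * ((z * K / D) * D / K) powr (- q) / D + (z * K / D) * x = e"
        using True p D0 by simp
      then show ?thesis using bound[of "z * K / D"] z K0 D0 by simp
    qed
    have "objective M \<beta> p c \<le> 0" by (rule ennreal_le_epsilon) (rule le)
    then show ?thesis using True by simp
  qed
qed

end

text \<open>A feedback strategy is given through the equation of its wealth. Optimality is therefore
  asserted for every solution of that equation, and the existence clause keeps this from being
  vacuous.\<close>

theorem mainTheorem3:
  fixes M :: "'w measure" and F :: "real \<Rightarrow> 'w measure" and W :: "real \<Rightarrow> 'w \<Rightarrow> real"
    and r \<mu> \<sigma> \<beta> p k x :: real
  assumes "brownian_motion M F W"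
    and "r \<ge> 0" and "\<mu> > 0" and "\<sigma> > 0" and "\<beta> > 0" and "0 < p" and "p < 1" and "k \<ge> 0"
    and "kappa r \<mu> \<sigma> \<beta> p > 0"
    and "x \<ge> 0"
  shows "let \<kappa> = kappa r \<mu> \<sigma> \<beta> p; K = max \<kappa> k; m = \<mu> / (\<sigma>\<^sup>2 * (1 - p)) in
    value_fn M F W r \<mu> \<sigma> \<beta> p k 0 x
      = ennreal (K powr p / (p * (\<kappa> * (1 - p) + K * p)) * x powr p) \<and>
    (\<exists>X. closed_loop M F W r \<mu> \<sigma> x K m X) \<and>
    (\<forall>X. closed_loop M F W r \<mu> \<sigma> x K m X \<longrightarrow>
        admissible M F W r \<mu> \<sigma> k 0 x (\<lambda>t \<omega>. K * X t \<omega>) (\<lambda>t \<omega>. m * X t \<omega>) \<and>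
        objective M \<beta> p (\<lambda>t \<omega>. K * X t \<omega>) = value_fn M F W r \<mu> \<sigma> \<beta> p k 0 x)"
proof -
  interpret prob_space M using assms(1) unfolding brownian_motion_def by blast
  interpret brownian M F W by unfold_locales (rule assms(1))
  define \<kappa> where "\<kappa> = kappa r \<mu> \<sigma> \<beta> p"
  define K where "K = max \<kappa> k"
  define m where "m = \<mu> / (\<sigma>\<^sup>2 * (1 - p))"
  define D where "D = \<kappa> * (1 - p) + K * p"
  have \<kappa>: "0 < \<kappa>" using assms by (simp add: \<kappa>_def)
  have K: "0 < K" "k \<le> K" using \<kappa> by (auto simp: K_def)
  have m: "m \<noteq> 0" using assms by (simp add: m_def)
  have D: "0 < D" using \<kappa> K assms by (auto simp: D_def intro!: add_pos_pos)
  have \<beta>: "\<beta> = \<kappa> * (1 - p) + p * (\<mu>\<^sup>2 / (2 * \<sigma>\<^sup>2 * (1 - p)) + r)"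
    using assms by (simp add: \<kappa>_def kappa_def)
  \<comment> \<open>With \<eta> the risk premium \<open>\<mu> * m\<close>, the volatility term takes
    away half of \<open>p * \<eta>\<close>, and the other half is the one contained in
    \<open>\<beta>\<close> through \<kappa>.\<close>
  have expo: "- \<beta> + p * (r - K + \<mu> * m) + (p\<^sup>2 - p) * (\<sigma> * m)\<^sup>2 / 2 = - D"
  proof -
    define \<eta> where "\<eta> = \<mu>\<^sup>2 / (\<sigma>\<^sup>2 * (1 - p))"
    have 1: "\<mu> * m = \<eta>" by (simp add: m_def \<eta>_def power2_eq_square)
    have 2: "(p\<^sup>2 - p) * (\<sigma> * m)\<^sup>2 = - (p * \<eta>)"
    proof -
      have "p\<^sup>2 - p = - (p * (1 - p))" by (simp add: power2_eq_square algebra_simps)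
      moreover have "(1 - p) * (\<sigma> * m)\<^sup>2 = \<eta>"
        using assms by (simp add: m_def \<eta>_def power_mult_distrib power_divide power2_eq_square)
      ultimately show ?thesis by (simp add: mult.assoc)
    qed
    have 3: "\<mu>\<^sup>2 / (2 * \<sigma>\<^sup>2 * (1 - p)) = \<eta> / 2" by (simp add: \<eta>_def)
    show ?thesis unfolding 1 2 \<beta> 3 D_def by (simp add: algebra_simps)
  qed
  define V where "V = ennreal (K powr p / (p * D) * x powr p)"
  have cl: "closed_loop M F W r \<mu> \<sigma> x K m (gbm x (r - K + \<mu> * m) (\<sigma> * m))"
    using assms m by (intro closed_loop_gbm) auto
  have opt: "admissible M F W r \<mu> \<sigma> k 0 x (\<lambda>t \<omega>. K * X t \<omega>) (\<lambda>t \<omega>. m * X t \<omega>)" "objective M \<beta> p (\<lambda>t \<omega>. K * X t \<omega>) = V"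
    if "closed_loop M F W r \<mu> \<sigma> x K m X" for X
  proof -
    show "admissible M F W r \<mu> \<sigma> k 0 x (\<lambda>t \<omega>. K * X t \<omega>) (\<lambda>t \<omega>. m * X t \<omega>)"
      using K assms by (intro closed_loop_admissible[OF that _ m]) auto
    show "objective M \<beta> p (\<lambda>t \<omega>. K * X t \<omega>) = V"
      unfolding V_def using K assms by (intro closed_loop_objective[OF that _ m _ _ _ D expo]) auto
  qed
  have val: "value_fn M F W r \<mu> \<sigma> \<beta> p k 0 x = V"
    unfolding value_fn_def
  proof (rule antisym)
    show "(SUP cp\<in>{(c, \<pi>). admissible M F W r \<mu> \<sigma> k 0 x c \<pi>}. objective M \<beta> p (fst cp)) \<le> V"
      unfolding V_def
      by (rule SUP_least, clarsimp simp del: times_divide_eq_left)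
         (rule admissible_objective_bound[OF _ assms(2-4,10,8,6,7) \<kappa>_def \<kappa> K_def D_def])
    \<comment> \<open>The supremum is attained by the feedback pair built on the explicit solution
      \<open>cl\<close>.\<close>
    show "V \<le> (SUP cp\<in>{(c, \<pi>). admissible M F W r \<mu> \<sigma> k 0 x c \<pi>}. objective M \<beta> p (fst cp))"
      using opt[OF cl] by (intro SUP_upper2[where i="(\<lambda>t \<omega>. K * gbm x (r - K + \<mu> * m) (\<sigma> * m) t \<omega>, \<lambda>t \<omega>. m * gbm x (r - K + \<mu> * m) (\<sigma> * m) t \<omega>)"]) auto
  qed
  show ?thesis
    unfolding Let_def \<kappa>_def[symmetric] K_def[symmetric] m_def[symmetric] D_def[symmetric] V_def[symmetric]
    using cl opt val by auto
qed

end
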